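(* Let $m\ge0$. Then $$H^{\frac{\infty}{2}-p}_{2m+1}\simeq\begin{cases}W_{2m+1,0},& p=0,\\ 0,& p\ge1.\end{cases}$$
   Context: Let $q$ be an indeterminate, $A=\mathbb{C}[q,q^{-1}]$, and for $m\in\mathbb Z$ let $V_A(\Lambda_1)_{2m+1}=A[b_n\mid n<0]\,\mathrm e^{\Lambda_1+m\alpha_1}$ (free $A$-module, formal symbols $\mathrm e^{\Lambda_1+m\alpha_1}$). On $\bigoplus_m V_A(\Lambda_1)_{2m+1}$ (and on its extension of scalars to $\mathbb C(q)$) let $b_n$ ($n<0$) act by multiplication, $b_n=n(q^n+q^{-n})\,\partial/\partial b_{-n}$ for $n>0$, let $\mathrm e^{-\alpha_1}$ send $P\mathrm e^{\Lambda_1+m\alpha_1}$ to $P\mathrm e^{\Lambda_1+(m-1)\alpha_1}$, and let $\partial$ act on $V_A(\Lambda_1)_{2m+1}$ by the scalar $2m+1$. Define operators $x_n^-$ by $$\sum_{n\in\mathbb Z}x_n^-z^{-n-1}=\exp\Big(-\sum_{n\ge1}\tfrac{b_{-n}}{n}(qz)^n\Big)\exp\Big(\sum_{n\ge1}\tfrac{b_n}{n}z^{-n}\Big)\mathrm e^{-\alpha_1}z^{-\partial}.$$ The operators $x_0^-$ and $(x_0^-)^{(2)}=(x_0^-)^2/(q+q^{-1})$ preserve the $A$-lattice. Put $\mathcal V_{2m+1}=\big(A/(q-\sqrt{-1})A\big)\otimes_A V_A(\Lambda_1)_{2m+1}=\mathbb C[b_{-1},b_{-2},\dots]\mathrm e^{\Lambda_1+m\alpha_1}$,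 and denote again by $x_0^-:\mathcal V_{2m+1}\to\mathcal V_{2m-1}$ and $(x_0^-)^{(2)}:\mathcal V_{2m+1}\to\mathcal V_{2m-3}$ the specialized operators. They commute with multiplication by $b_{-1},b_{-3},\dots$. Let $\mathcal D=\mathbb C[b_{-1},b_{-3},b_{-5},\dots]$, acting by multiplication, and for $m\ge0$ let $$A_{2m+1}=\frac{\mathcal V_{2m+1}}{x_0^-\mathcal V_{2m+3}+(x_0^-)^{(2)}\mathcal V_{2m+5}}.$$ De Rham type complex: let $v_\phi=dt_{-1}\wedge dt_{-3}\wedge dt_{-5}\wedge\cdots$ (a formal infinite wedge) and, for odd integers $0>i_1>\dots>i_p$, let $v_{i_1,\dots,i_p}$ be the formal infinite wedge obtained from $v_\phi$ by removing $dt_{i_1},\dots,dt_{i_p}$. Let $\Omega^{\frac\infty2-p}$ be the vector space with basis the $v_{i_1,\dots,i_p}$ ($\Omega^{\frac\infty2}=\mathbb Cv_\phi$). Left wedge multiplication by $dt_j$ follows the usual rule: $dt_j\wedge v_{i_1,\dots,i_p}=0$ if $j\notin\{i_1,\dots,i_p\}$, and $dt_{i_k}\wedge v_{i_1,\dots,i_p}=(-1)^{(-i_k-1)/2-(k-1)}v_{i_1,\dots,\widehat{i_k},\dots,i_p}$. Set $C_{2m+1}^{\frac\infty2-p}=A_{2m+1}\otimes\Omega^{\frac\infty2-p}$ with differential $d=\sum_{s\ge1}b_{-(2s-1)}\otimes dt_{-(2s-1)}:C_{2m+1}^{\frac\infty2-p}\to C_{2m+1}^{\frac\infty2-p+1}$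 (with $C_{2m+1}^{\frac\infty2+1}=0$). $H_{2m+1}^{\frac\infty2-p}$ is the cohomology of this complex at $C_{2m+1}^{\frac\infty2-p}$. Fermionic Fock space: let $\tilde\psi_{2n+1},\tilde\psi_{2n+1}^*$ ($n\in\mathbb Z$) satisfy the canonical anticommutation relations $[\tilde\psi_{k},\tilde\psi_{l}]_+=[\tilde\psi^*_{k},\tilde\psi^*_{l}]_+=0$, $[\tilde\psi_{k},\tilde\psi^*_{l}]_+=\delta_{k,l}$, and let $|1\rangle$ be the vacuum with $\tilde\psi_{2n+1}|1\rangle=0$ for $n>0$ and $\tilde\psi^*_{2n+1}|1\rangle=0$ for $n\le0$. For $m\in\mathbb Z$, $\tilde H_{2m+1,0}$ is the complex vector space with basis $\tilde\psi_{2r_1+1}\cdots\tilde\psi_{2r_k+1}\tilde\psi^*_{2s_1+1}\cdots\tilde\psi^*_{2s_{k+m}+1}|1\rangle$, $r_1<\dots<r_k<0<s_1<\dots<s_{k+m}$ ($k\ge\max(0,-m)$). Let $\omega=-\sum_{n\ge1}\tilde\psi_{-(2n-1)}\tilde\psi_{2n+1}$, so $\omega:\tilde H_{2n+5,0}\to\tilde H_{2n+1,0}$, and $W_{2n+1,0}=\tilde H_{2n+1,0}/\omega\tilde H_{2n+5,0}$. *)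

theory Defs
  imports
    "HOL-Library.Poly_Mapping"
    "HOL-Library.FSet"
    "HOL-Algebra.Module"
    "HOL-Algebra.Algebraic_Closure_Type"
begin

section \<open>Finitely supported functions as free modules\<close>

definition scl :: "'a::semiring_0 \<Rightarrow> ('k \<Rightarrow>\<^sub>0 'a) \<Rightarrow> ('k \<Rightarrow>\<^sub>0 'a)" where
  "scl c v = Poly_Mapping.map ((*) c) v"

definition lin_ext :: "('k \<Rightarrow> ('l \<Rightarrow>\<^sub>0 'a::semiring_0)) \<Rightarrow> ('k \<Rightarrow>\<^sub>0 'a) \<Rightarrow> ('l \<Rightarrow>\<^sub>0 'a)" where
  "lin_ext g v = (\<Sum>k\<in>Poly_Mapping.keys v. scl (Poly_Mapping.lookup v k) (g k))"

lemma lookup_scl [simp]: "Poly_Mapping.lookup (scl c v) k = c * Poly_Mapping.lookup v k"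
  by (simp add: scl_def Poly_Mapping.map.rep_eq when_def)

lemma scl_zero_right [simp]: "scl c 0 = 0"
  by (rule poly_mapping_eqI) simp

lemma scl_zero_left [simp]: "scl 0 v = 0"
  by (rule poly_mapping_eqI) simp

lemma scl_one [simp]: "scl (1::'a::semiring_1) v = v"
  by (rule poly_mapping_eqI) simp

lemma scl_scl [simp]: "scl c (scl d v) = scl (c * d) v"
  by (rule poly_mapping_eqI) (simp add: mult.assoc)

lemma scl_add_right: "scl c (v + w) = scl c v + scl c w"
  by (rule poly_mapping_eqI) (simp add: lookup_add distrib_left)

lemma scl_add_left: "scl (c + d) v = scl c v + scl d v"
  by (rule poly_mapping_eqI) (simp add: lookup_add distrib_right)

lemma scl_sum: "scl c (sum f A) = (\<Sum>x\<in>A. scl c (f x))"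
  by (induction A rule: infinite_finite_induct) (simp_all add: scl_add_right)

lemma scl_single [simp]: "scl c (Poly_Mapping.single k d) = Poly_Mapping.single k (c * d)"
  by (rule poly_mapping_eqI) (simp add: lookup_single when_def)

lemma lin_ext_superset:
  assumes "finite K" "Poly_Mapping.keys v \<subseteq> K"
  shows "lin_ext g v = (\<Sum>k\<in>K. scl (Poly_Mapping.lookup v k) (g k))"
  unfolding lin_ext_def
  by (rule sum.mono_neutral_left) (use assms in \<open>auto simp: in_keys_iff\<close>)

lemma lin_ext_add: "lin_ext g (v + w) = lin_ext g v + lin_ext g w"
proof -
  let ?K = "Poly_Mapping.keys v \<union> Poly_Mapping.keys w"
  have "lin_ext g u = (\<Sum>k\<in>?K. scl (Poly_Mapping.lookup u k) (g k))"
    if "Poly_Mapping.keys u \<subseteq> ?K" for u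
    by (rule lin_ext_superset) (use that in auto)
  from this[of v] this[of w] this[of "v + w"] show ?thesis
    using Poly_Mapping.keys_add[of v w]
    by (simp add: lookup_add scl_add_left sum.distrib)
qed

lemma lin_ext_zero [simp]: "lin_ext g 0 = 0"
  by (simp add: lin_ext_def)

lemma lin_ext_sum: "lin_ext g (sum f A) = (\<Sum>x\<in>A. lin_ext g (f x))"
  by (induction A rule: infinite_finite_induct) (simp_all add: lin_ext_add)

lemma lin_ext_scl: "lin_ext g (scl c v) = scl c (lin_ext g v)"
proof -
  have "lin_ext g (scl c v) = (\<Sum>k\<in>Poly_Mapping.keys v. scl (c * Poly_Mapping.lookup v k) (g k))"
    by (subst lin_ext_superset[of "Poly_Mapping.keys v"]) (auto simp: in_keys_iff)
  then show ?thesis by (simp add: lin_ext_def scl_sum)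
qed

lemma lin_ext_single [simp]: "lin_ext g (Poly_Mapping.single k c) = scl c (g k)"
  by (cases "c = 0") (simp_all add: lin_ext_def)

lemma expand_singles:
  "v = (\<Sum>k\<in>Poly_Mapping.keys v. Poly_Mapping.single k (Poly_Mapping.lookup v k))"
  by (rule poly_mapping_eqI)
    (auto simp: lookup_sum lookup_single when_def in_keys_iff sum.delta)

section \<open>The bosonic lattice and the operators \<open>x\<^sub>n\<^sup>-\<close>\<close>

text \<open>\<open>laurent\<close> is the group ring of the integers over the complex numbers.
  In \<open>'a bpoly\<close> the \<open>k\<close>-th variable (\<open>k = 0, 1, \<dots>\<close>) is \<open>b\<^sub>-\<^sub>(\<^sub>k\<^sub>+\<^sub>1\<^sub>)\<close>.\<close>

type_synonym laurent = "int \<Rightarrow>\<^sub>0 complex"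
type_synonym 'a bpoly = "(nat \<Rightarrow>\<^sub>0 nat) \<Rightarrow>\<^sub>0 'a"

definition qpow :: "int \<Rightarrow> laurent" where
  "qpow n = Poly_Mapping.single n 1"

definition const :: "complex \<Rightarrow> laurent" where
  "const c = Poly_Mapping.single 0 c"

text \<open>\<open>bvar n\<close> is \<open>b\<^sub>-\<^sub>n\<close> and \<open>bderiv n\<close> is \<open>\<partial>/\<partial>b\<^sub>-\<^sub>n\<close>, for \<open>n \<ge> 1\<close>.\<close>

definition bvar :: "nat \<Rightarrow> 'a::{zero,one} bpoly" where
  "bvar n = Poly_Mapping.single (Poly_Mapping.single (n - 1) 1) 1"

definition bderiv :: "nat \<Rightarrow> 'a::semiring_1 bpoly \<Rightarrow> 'a bpoly" where
  "bderiv n = lin_ext (\<lambda>\<mu>. Poly_Mapping.single (\<mu> - Poly_Mapping.single (n - 1) 1)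
                               (of_nat (Poly_Mapping.lookup \<mu> (n - 1))))"

text \<open>There is no \<open>b\<^sub>0\<close>; its value below is never used.\<close>

definition b_op :: "int \<Rightarrow> laurent bpoly \<Rightarrow> laurent bpoly" where
  "b_op n P = (if n < 0 then bvar (nat (- n)) * P
               else if n > 0 then scl (of_int n * (qpow n + qpow (- n))) (bderiv (nat n) P)
               else 0)"

text \<open>For operators \<open>F n\<close>, regarded as the coefficients of \<open>w\<^sup>n\<close> (\<open>n \<ge> 0\<close>) in a series \<open>F(w)\<close>,
  \<open>op_pow F j l\<close> is the coefficient of \<open>w\<^sup>l\<close> in \<open>F(w)\<^sup>j\<close>.  The coefficient \<open>op_exp F l\<close> of
  \<open>w\<^sup>l\<close> in \<open>exp (F(w))\<close> is given for \<open>F 0 = 0\<close>, where powers \<open>j > l\<close> do not contribute.\<close>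

primrec op_pow :: "(nat \<Rightarrow> laurent bpoly \<Rightarrow> laurent bpoly) \<Rightarrow> nat \<Rightarrow> nat \<Rightarrow> laurent bpoly \<Rightarrow> laurent bpoly"
where
  "op_pow F 0 l P = (if l = 0 then P else 0)"
| "op_pow F (Suc j) l P = (\<Sum>n\<le>l. F n (op_pow F j (l - n) P))"

definition op_exp :: "(nat \<Rightarrow> laurent bpoly \<Rightarrow> laurent bpoly) \<Rightarrow> nat \<Rightarrow> laurent bpoly \<Rightarrow> laurent bpoly"
where
  "op_exp F l P = (\<Sum>j\<le>l. scl (const (1 / fact j)) (op_pow F j l P))"

text \<open>The coefficients of \<open>z\<^sup>k\<close> in \<open>exp (-\<Sum>\<^sub>n b\<^sub>-\<^sub>n (qz)\<^sup>n / n)\<close> and of \<open>z\<^sup>-\<^sup>l\<close> in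
  \<open>exp (\<Sum>\<^sub>n b\<^sub>n z\<^sup>-\<^sup>n / n)\<close>.\<close>

definition exp_creation :: "nat \<Rightarrow> laurent bpoly \<Rightarrow> laurent bpoly" where
  "exp_creation = op_exp (\<lambda>n P. if n = 0 then 0
      else scl (const (- 1 / of_nat n) * qpow (int n)) (b_op (- int n) P))"

definition exp_annihilation :: "nat \<Rightarrow> laurent bpoly \<Rightarrow> laurent bpoly" where
  "exp_annihilation = op_exp (\<lambda>n P. if n = 0 then 0
      else scl (const (1 / of_nat n)) (b_op (int n) P))"

text \<open>An element \<open>P e\<^bsup>\<Lambda>\<^sub>1 + m\<alpha>\<^sub>1\<^esup>\<close> of \<open>V\<^sub>A(\<Lambda>\<^sub>1)\<^sub>2\<^sub>m\<^sub>+\<^sub>1\<close> is represented by its coefficient \<open>P\<close>, and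
  operators carry \<open>m\<close> as an argument: \<open>x_minus m n\<close> is
  \<open>x\<^sub>n\<^sup>- : V\<^sub>A(\<Lambda>\<^sub>1)\<^sub>2\<^sub>m\<^sub>+\<^sub>1 \<rightarrow> V\<^sub>A(\<Lambda>\<^sub>1)\<^sub>2\<^sub>m\<^sub>-\<^sub>1\<close>.  Since \<open>z\<^sup>-\<^sup>\<partial>\<close> contributes \<open>z\<^bsup>-2m-1\<^esup>\<close>, the coefficient of
  \<open>z\<^bsup>-n-1\<^esup>\<close> pairs \<open>z\<^sup>k\<close> with \<open>z\<^sup>-\<^sup>l\<close> such that \<open>k - l - 2m - 1 = -n - 1\<close>.  The sum is finite by
  \<open>finite_exp_annihilation\<close> below.\<close>

definition x_minus :: "int \<Rightarrow> int \<Rightarrow> laurent bpoly \<Rightarrow> laurent bpoly" where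
  "x_minus m n P = (\<Sum>l | exp_annihilation l P \<noteq> 0 \<and> 0 \<le> int l + 2 * m - n.
      exp_creation (nat (int l + 2 * m - n)) (exp_annihilation l P))"

abbreviation x0_minus :: "int \<Rightarrow> laurent bpoly \<Rightarrow> laurent bpoly" where
  "x0_minus m \<equiv> x_minus m 0"

text \<open>\<open>(x\<^sub>0\<^sup>-)\<^sup>(\<^sup>2\<^sup>) = (x\<^sub>0\<^sup>-)\<^sup>2 / (q + q\<^sup>-\<^sup>1)\<close> from \<open>V\<^sub>A(\<Lambda>\<^sub>1)\<^sub>2\<^sub>m\<^sub>+\<^sub>1\<close> to \<open>V\<^sub>A(\<Lambda>\<^sub>1)\<^sub>2\<^sub>m\<^sub>-\<^sub>3\<close>: the unique lattice
  element whose \<open>(q + q\<^sup>-\<^sup>1)\<close>-multiple is \<open>(x\<^sub>0\<^sup>-)\<^sup>2 P\<close>; see \<open>scl_quantum_two_cancel\<close> for uniqueness.\<close>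

definition x0_minus_div2 :: "int \<Rightarrow> laurent bpoly \<Rightarrow> laurent bpoly" where
  "x0_minus_div2 m P =
     (THE Q. scl (qpow 1 + qpow (- 1)) Q = x0_minus (m - 1) (x0_minus m P))"

lemma scl_quantum_two_cancel:
  fixes Q :: "laurent bpoly"
  assumes "scl (qpow 1 + qpow (- 1)) Q = scl (qpow 1 + qpow (- 1)) Q'"
  shows "Q = Q'"
proof (rule poly_mapping_eqI)
  fix k
  have "qpow 1 + qpow (- 1) \<noteq> 0"
  proof
    assume "qpow 1 + qpow (- 1) = 0"
    then have "Poly_Mapping.lookup (qpow 1 + qpow (- 1)) 1 = 0" by simp
    then show False by (simp add: qpow_def lookup_add lookup_single)
  qed
  moreover have "(qpow 1 + qpow (- 1)) * Poly_Mapping.lookup Q k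
      = (qpow 1 + qpow (- 1)) * Poly_Mapping.lookup Q' k"
    using arg_cong[OF assms, of "\<lambda>R. Poly_Mapping.lookup R k"] by simp
  ultimately show "Poly_Mapping.lookup Q k = Poly_Mapping.lookup Q' k" by simp
qed

definition monom_wt :: "(nat \<Rightarrow>\<^sub>0 nat) \<Rightarrow> int" where
  "monom_wt \<mu> = (\<Sum>k\<in>Poly_Mapping.keys \<mu>. (int k + 1) * int (Poly_Mapping.lookup \<mu> k))"

definition wt_le :: "int \<Rightarrow> 'a::zero bpoly \<Rightarrow> bool" where
  "wt_le w P \<longleftrightarrow> (\<forall>\<mu>\<in>Poly_Mapping.keys P. monom_wt \<mu> \<le> w)"

lemma monom_wt_nonneg: "0 \<le> monom_wt \<mu>"
  by (simp add: monom_wt_def sum_nonneg)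

lemma monom_wt_superset:
  assumes "finite K" "Poly_Mapping.keys \<mu> \<subseteq> K"
  shows "monom_wt \<mu> = (\<Sum>k\<in>K. (int k + 1) * int (Poly_Mapping.lookup \<mu> k))"
  unfolding monom_wt_def
  by (rule sum.mono_neutral_left) (use assms in \<open>auto simp: in_keys_iff\<close>)

lemma monom_wt_minus:
  assumes "Poly_Mapping.lookup \<mu> k \<noteq> 0"
  shows "monom_wt (\<mu> - Poly_Mapping.single k 1) = monom_wt \<mu> - (int k + 1)"
proof -
  let ?K = "Poly_Mapping.keys \<mu>"
  have k: "k \<in> ?K" using assms by (simp add: in_keys_iff)
  have "Poly_Mapping.keys (\<mu> - Poly_Mapping.single k 1) \<subseteq> ?K"
    by (auto simp: in_keys_iff lookup_minus)
  then have "monom_wt (\<mu> - Poly_Mapping.single k 1)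
      = (\<Sum>j\<in>?K. (int j + 1) * int (Poly_Mapping.lookup (\<mu> - Poly_Mapping.single k 1) j))"
    by (intro monom_wt_superset) auto
  also have "\<dots> = (\<Sum>j\<in>?K. (int j + 1) * int (Poly_Mapping.lookup \<mu> j) - (if j = k then int k + 1 else 0))"
  proof (intro sum.cong refl)
    fix j
    have "int (Poly_Mapping.lookup (\<mu> - Poly_Mapping.single k 1) j)
        = int (Poly_Mapping.lookup \<mu> j) - (if j = k then 1 else 0)"
      using assms by (cases "j = k") (auto simp: lookup_minus lookup_single)
    then show "(int j + 1) * int (Poly_Mapping.lookup (\<mu> - Poly_Mapping.single k 1) j)
        = (int j + 1) * int (Poly_Mapping.lookup \<mu> j) - (if j = k then int k + 1 else 0)"
      by (cases "j = k") (simp_all add: right_diff_distrib)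
  qed
  also have "\<dots> = (\<Sum>j\<in>?K. (int j + 1) * int (Poly_Mapping.lookup \<mu> j))
      - (\<Sum>j\<in>?K. if j = k then int k + 1 else 0)"
    by (rule sum_subtractf)
  also have "\<dots> = monom_wt \<mu> - (int k + 1)"
    using k by (simp only: sum.delta finite_keys monom_wt_def if_True)
  finally show ?thesis .
qed

lemma wt_le_zero [simp]: "wt_le w 0" by (simp add: wt_le_def)

lemma wt_le_add: "wt_le w P \<Longrightarrow> wt_le w Q \<Longrightarrow> wt_le w (P + Q)"
  using Poly_Mapping.keys_add[of P Q] by (auto simp: wt_le_def)

lemma wt_le_sum: "(\<And>x. x \<in> A \<Longrightarrow> wt_le w (f x)) \<Longrightarrow> wt_le w (sum f A)"
  by (induction A rule: infinite_finite_induct) (auto intro: wt_le_add)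

lemma wt_le_scl: "wt_le w P \<Longrightarrow> wt_le w (scl c P)"
  by (auto simp: wt_le_def in_keys_iff)

lemma wt_le_neg: "wt_le w P \<Longrightarrow> w < 0 \<Longrightarrow> P = 0"
  unfolding wt_le_def by (metis keys_eq_empty all_not_in_conv monom_wt_nonneg not_le order_trans)

lemma wt_le_bderiv:
  assumes "wt_le w P" "0 < n" shows "wt_le (w - int n) (bderiv n P)"
  unfolding bderiv_def lin_ext_def
proof (intro wt_le_sum)
  fix \<mu> assume "\<mu> \<in> Poly_Mapping.keys P"
  then have "monom_wt \<mu> \<le> w" using assms(1) by (simp add: wt_le_def)
  then have "monom_wt (\<mu> - Poly_Mapping.single (n - 1) 1) \<le> w - int n"
    if "Poly_Mapping.lookup \<mu> (n - 1) \<noteq> 0"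
    using monom_wt_minus[OF that] assms(2) by (simp add: of_nat_diff)
  then show "wt_le (w - int n) (scl (Poly_Mapping.lookup P \<mu>)
      (Poly_Mapping.single (\<mu> - Poly_Mapping.single (n - 1) 1) (of_nat (Poly_Mapping.lookup \<mu> (n - 1)))))"
    by (cases "Poly_Mapping.lookup \<mu> (n - 1) = 0") (simp_all add: wt_le_def)
qed

lemma wt_le_op_pow:
  assumes "\<And>n P w. wt_le w P \<Longrightarrow> wt_le (w - int n) (F n P)" "wt_le w P"
  shows "wt_le (w - int l) (op_pow F j l P)"
proof (induction j arbitrary: l)
  case 0
  then show ?case using assms(2) by simp
next
  case (Suc j)
  have "wt_le (w - int l) (F n (op_pow F j (l - n) P))" if "n \<le> l" for n
    using assms(1)[OF Suc.IH[of "l - n"], of n] that by (simp add: of_nat_diff algebra_simps)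
  then show ?case by (auto intro: wt_le_sum)
qed

lemma wt_le_exp_annihilation:
  assumes "wt_le w P" shows "wt_le (w - int l) (exp_annihilation l P)"
  unfolding exp_annihilation_def op_exp_def
  by (intro wt_le_sum wt_le_scl wt_le_op_pow[OF _ assms]) (auto simp: b_op_def intro: wt_le_scl wt_le_bderiv)

lemma finite_exp_annihilation: "finite {l. exp_annihilation l P \<noteq> 0}"
proof -
  define w where "w = (\<Sum>\<mu>\<in>Poly_Mapping.keys P. monom_wt \<mu>)"
  have "wt_le w P" unfolding wt_le_def w_def
    by (auto intro!: member_le_sum monom_wt_nonneg)
  then have "exp_annihilation l P = 0" if "w < int l" for l
    using wt_le_exp_annihilation[of w P l] that by (intro wt_le_neg) auto
  then have "{l. exp_annihilation l P \<noteq> 0} \<subseteq> {..nat w}"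
    by (force simp: not_less intro: ccontr)
  then show ?thesis using finite_subset by blast
qed

section \<open>Specialization at \<open>q = \<i>\<close>\<close>

definition eval_i :: "laurent \<Rightarrow> complex" where
  "eval_i a = (\<Sum>n\<in>Poly_Mapping.keys a. Poly_Mapping.lookup a n * \<i> powi n)"

definition specialize :: "laurent bpoly \<Rightarrow> complex bpoly" where
  "specialize P = Poly_Mapping.map eval_i P"

definition lift_const :: "complex bpoly \<Rightarrow> laurent bpoly" where
  "lift_const P = Poly_Mapping.map const P"

text \<open>The operators induced on \<open>\<V>\<^sub>2\<^sub>m\<^sub>+\<^sub>1\<close>, computed on the representatives with constant coefficients
  (see \<open>xbar_specialize\<close> and \<open>xbar_div2_specialize\<close> for independence of the representative).\<close>

definition xbar :: "int \<Rightarrow> complex bpoly \<Rightarrow> complex bpoly" where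
  "xbar m P = specialize (x0_minus m (lift_const P))"

definition xbar_div2 :: "int \<Rightarrow> complex bpoly \<Rightarrow> complex bpoly" where
  "xbar_div2 m P = specialize (x0_minus_div2 m (lift_const P))"

lemma eval_i_superset:
  assumes "finite K" "Poly_Mapping.keys a \<subseteq> K"
  shows "eval_i a = (\<Sum>n\<in>K. Poly_Mapping.lookup a n * \<i> powi n)"
  unfolding eval_i_def
  by (rule sum.mono_neutral_left) (use assms in \<open>auto simp: in_keys_iff\<close>)

lemma eval_i_zero [simp]: "eval_i 0 = 0" by (simp add: eval_i_def)

lemma eval_i_single [simp]: "eval_i (Poly_Mapping.single n c) = c * \<i> powi n"
  by (cases "c = 0") (simp_all add: eval_i_def)

lemma eval_i_add: "eval_i (a + b) = eval_i a + eval_i b"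
proof -
  let ?K = "Poly_Mapping.keys a \<union> Poly_Mapping.keys b"
  have "eval_i u = (\<Sum>n\<in>?K. Poly_Mapping.lookup u n * \<i> powi n)"
    if "Poly_Mapping.keys u \<subseteq> ?K" for u
    by (rule eval_i_superset) (use that in auto)
  from this[of a] this[of b] this[of "a + b"] show ?thesis
    using Poly_Mapping.keys_add[of a b]
    by (simp add: lookup_add distrib_right sum.distrib)
qed

lemma eval_i_sum: "eval_i (sum f A) = (\<Sum>x\<in>A. eval_i (f x))"
  by (induction A rule: infinite_finite_induct) (simp_all add: eval_i_add)

lemma eval_i_mult: "eval_i (a * b) = eval_i a * eval_i b"
proof -
  let ?A = "Poly_Mapping.keys a" and ?B = "Poly_Mapping.keys b"
  let ?f = "\<lambda>k. Poly_Mapping.lookup a k" and ?g = "\<lambda>l. Poly_Mapping.lookup b l"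
  have "a * b = (\<Sum>k\<in>?A. Poly_Mapping.single k (?f k)) * (\<Sum>l\<in>?B. Poly_Mapping.single l (?g l))"
    by (rule arg_cong2[where f = "(*)", OF expand_singles expand_singles])
  also have "\<dots> = (\<Sum>k\<in>?A. \<Sum>l\<in>?B. Poly_Mapping.single (k + l) (?f k * ?g l))"
    by (simp only: sum_product mult_single)
  finally have "eval_i (a * b) = (\<Sum>k\<in>?A. \<Sum>l\<in>?B. ?f k * ?g l * \<i> powi (k + l))"
    by (simp only: eval_i_sum eval_i_single)
  also have "\<dots> = (\<Sum>k\<in>?A. \<Sum>l\<in>?B. (?f k * \<i> powi k) * (?g l * \<i> powi l))"
    by (intro sum.cong refl) (simp add: power_int_add)
  also have "\<dots> = eval_i a * eval_i b"
    unfolding eval_i_def by (simp only: sum_product)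
  finally show ?thesis .
qed

lemma lookup_specialize [simp]:
  "Poly_Mapping.lookup (specialize P) \<mu> = eval_i (Poly_Mapping.lookup P \<mu>)"
  by (simp add: specialize_def Poly_Mapping.map.rep_eq when_def)

lemma lookup_lift_const [simp]:
  "Poly_Mapping.lookup (lift_const P) \<mu> = const (Poly_Mapping.lookup P \<mu>)"
  by (simp add: lift_const_def Poly_Mapping.map.rep_eq when_def const_def)

lemma specialize_lift_const [simp]: "specialize (lift_const P) = P"
  by (rule poly_mapping_eqI) (simp add: const_def)

lemma specialize_add: "specialize (P + Q) = specialize P + specialize Q"
  by (rule poly_mapping_eqI) (simp add: lookup_add eval_i_add)

lemma specialize_zero [simp]: "specialize 0 = 0"
  by (rule poly_mapping_eqI) simp

lemma specialize_sum: "specialize (sum f A) = (\<Sum>x\<in>A. specialize (f x))"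
  by (induction A rule: infinite_finite_induct) (simp_all add: specialize_add)

lemma specialize_scl: "specialize (scl c P) = scl (eval_i c) (specialize P)"
  by (rule poly_mapping_eqI) (simp add: eval_i_mult)

definition lattice_linear :: "(laurent bpoly \<Rightarrow> laurent bpoly) \<Rightarrow> bool" where
  "lattice_linear T \<longleftrightarrow> (\<forall>P Q. T (P + Q) = T P + T Q) \<and> (\<forall>c P. T (scl c P) = scl c (T P))"

lemma lattice_linear_zero: "lattice_linear T \<Longrightarrow> T 0 = 0"
  unfolding lattice_linear_def by (metis scl_zero_left)

lemma lattice_linear_sum:
  assumes "lattice_linear T" shows "T (sum f A) = (\<Sum>x\<in>A. T (f x))"
  by (induction A rule: infinite_finite_induct)
    (use assms in \<open>simp_all add: lattice_linear_zero\<close>, simp add: lattice_linear_def)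

lemma specialize_lattice_linear:
  assumes "lattice_linear T"
  shows "specialize (T P) = specialize (T (lift_const (specialize P)))"
proof -
  let ?m = "\<lambda>\<mu>. Poly_Mapping.single \<mu> (1::laurent)"
  have *: "specialize (T Q) = (\<Sum>\<mu>\<in>K. scl (eval_i (Poly_Mapping.lookup Q \<mu>)) (specialize (T (?m \<mu>))))"
    if "finite K" "Poly_Mapping.keys Q \<subseteq> K" for Q K
  proof -
    have "Q = (\<Sum>\<mu>\<in>K. scl (Poly_Mapping.lookup Q \<mu>) (?m \<mu>))"
    proof (rule poly_mapping_eqI)
      fix k
      have "Poly_Mapping.lookup Q k = 0" if "k \<notin> K"
        using \<open>Poly_Mapping.keys Q \<subseteq> K\<close> that by (auto simp: in_keys_iff)
      then show "Poly_Mapping.lookup Q k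
          = Poly_Mapping.lookup (\<Sum>\<mu>\<in>K. scl (Poly_Mapping.lookup Q \<mu>) (?m \<mu>)) k"
        using \<open>finite K\<close> by (simp add: lookup_sum lookup_single when_def)
    qed
    then have "T Q = T (\<Sum>\<mu>\<in>K. scl (Poly_Mapping.lookup Q \<mu>) (?m \<mu>))" by (rule arg_cong)
    also have "\<dots> = (\<Sum>\<mu>\<in>K. T (scl (Poly_Mapping.lookup Q \<mu>) (?m \<mu>)))"
      by (rule lattice_linear_sum[OF assms])
    also have "\<dots> = (\<Sum>\<mu>\<in>K. scl (Poly_Mapping.lookup Q \<mu>) (T (?m \<mu>)))"
      using assms by (simp only: lattice_linear_def)
    finally have "specialize (T Q) = specialize \<dots>" by (rule arg_cong)
    then show ?thesis by (simp only: specialize_sum specialize_scl)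
  qed
  have "Poly_Mapping.keys (lift_const (specialize P)) \<subseteq> Poly_Mapping.keys P"
    by (auto simp: in_keys_iff const_def)
  from *[OF finite_keys this]
  have "specialize (T (lift_const (specialize P))) = (\<Sum>\<mu>\<in>Poly_Mapping.keys P.
      scl (eval_i (Poly_Mapping.lookup P \<mu>)) (specialize (T (?m \<mu>))))"
    by (simp only: lookup_lift_const lookup_specialize const_def eval_i_single power_int_0_right mult_1_right)
  from trans[OF *[OF finite_keys order_refl, of P] this[symmetric]] show ?thesis .
qed

lemma lattice_linear_lin_ext: "lattice_linear (lin_ext g)"
  by (simp add: lattice_linear_def lin_ext_add lin_ext_scl)

lemma lattice_linear_compose: "lattice_linear T \<Longrightarrow> lattice_linear S \<Longrightarrow> lattice_linear (\<lambda>P. T (S P))"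
  by (simp add: lattice_linear_def)

lemma lattice_linear_scl: "lattice_linear T \<Longrightarrow> lattice_linear (\<lambda>P. scl c (T P))"
  by (simp add: lattice_linear_def scl_add_right mult.commute)

lemma lattice_linear_plus: "lattice_linear T \<Longrightarrow> lattice_linear S \<Longrightarrow> lattice_linear (\<lambda>P. T P + S P)"
  by (simp add: lattice_linear_def scl_add_right)

lemma lattice_linear_const_zero: "lattice_linear (\<lambda>P. 0)"
  by (simp add: lattice_linear_def)

lemma lattice_linear_sum_op:
  "(\<And>x. x \<in> A \<Longrightarrow> lattice_linear (T x)) \<Longrightarrow> lattice_linear (\<lambda>P. \<Sum>x\<in>A. T x P)"
  by (induction A rule: infinite_finite_induct)
    (auto intro: lattice_linear_const_zero lattice_linear_plus)

lemma scl_conv_mult: "scl c P = Poly_Mapping.single 0 c * P"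
  by (simp add: scl_def mult_map_scale_conv_mult)

lemma lattice_linear_b_op: "lattice_linear (b_op n)"
proof -
  have *: "lattice_linear (\<lambda>P. R * P)" for R :: "laurent bpoly"
    unfolding lattice_linear_def scl_conv_mult by (simp add: distrib_left mult.left_commute)
  consider "n < 0" | "n = 0" | "n > 0" by linarith
  then show ?thesis
  proof cases
    case 1
    then have "b_op n = (\<lambda>P. bvar (nat (- n)) * P)" by (simp add: b_op_def fun_eq_iff)
    then show ?thesis using * by simp
  next
    case 2
    then have "b_op n = (\<lambda>P. 0)" by (simp add: b_op_def fun_eq_iff)
    then show ?thesis by (simp add: lattice_linear_const_zero)
  next
    case 3
    then have "b_op n = (\<lambda>P. scl (of_int n * (qpow n + qpow (- n))) (bderiv (nat n) P))"
      by (simp add: b_op_def fun_eq_iff)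
    then show ?thesis
      by (simp only: bderiv_def) (rule lattice_linear_scl, rule lattice_linear_lin_ext)
  qed
qed

lemma lattice_linear_op_pow:
  assumes "\<And>n. lattice_linear (F n)" shows "lattice_linear (op_pow F j l)"
proof (induction j arbitrary: l)
  case 0
  show ?case by (simp add: lattice_linear_def)
next
  case (Suc j)
  have "op_pow F (Suc j) l = (\<lambda>P. \<Sum>n\<le>l. F n (op_pow F j (l - n) P))" by (rule ext) simp
  moreover have "lattice_linear (\<lambda>P. F n (op_pow F j (l - n) P))" for n
    by (rule lattice_linear_compose[OF assms Suc.IH])
  ultimately show ?case by (simp only:) (rule lattice_linear_sum_op)
qed

lemma lattice_linear_op_exp:
  assumes "\<And>n. lattice_linear (F n)" shows "lattice_linear (op_exp F l)"
proof -
  have "op_exp F l = (\<lambda>P. \<Sum>j\<le>l. scl (const (1 / fact j)) (op_pow F j l P))"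
    by (rule ext) (simp add: op_exp_def)
  moreover have "lattice_linear (\<lambda>P. scl c (op_pow F j l P))" for c j
    by (rule lattice_linear_scl[OF lattice_linear_op_pow[OF assms]])
  ultimately show ?thesis by (simp only:) (rule lattice_linear_sum_op)
qed

lemma lattice_linear_if_scl_b_op:
  "lattice_linear (\<lambda>P. if i = (0::nat) then 0 else scl c (b_op n P))"
  using lattice_linear_scl[OF lattice_linear_b_op, of c n] lattice_linear_const_zero by (cases "i = 0") simp_all

lemma lattice_linear_exp_creation: "lattice_linear (exp_creation l)"
  unfolding exp_creation_def by (rule lattice_linear_op_exp) (rule lattice_linear_if_scl_b_op)

lemma lattice_linear_exp_annihilation: "lattice_linear (exp_annihilation l)"
  unfolding exp_annihilation_def by (rule lattice_linear_op_exp) (rule lattice_linear_if_scl_b_op)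

lemma x_minus_superset:
  assumes "finite L" "{l. exp_annihilation l P \<noteq> 0} \<subseteq> L"
  shows "x_minus m n P = (\<Sum>l\<in>{l\<in>L. 0 \<le> int l + 2 * m - n}.
           exp_creation (nat (int l + 2 * m - n)) (exp_annihilation l P))"
  unfolding x_minus_def
  by (rule sum.mono_neutral_left)
    (use assms in \<open>auto simp: lattice_linear_zero[OF lattice_linear_exp_creation]\<close>)

lemma lattice_linear_x_minus: "lattice_linear (x_minus m n)"
proof -
  have E: "lattice_linear (\<lambda>P. \<Sum>l\<in>{l\<in>L. 0 \<le> int l + 2 * m - n}.
           exp_creation (nat (int l + 2 * m - n)) (exp_annihilation l P))" for L
    by (rule lattice_linear_sum_op)
      (rule lattice_linear_compose[OF lattice_linear_exp_creation lattice_linear_exp_annihilation])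
  have "x_minus m n (P + Q) = x_minus m n P + x_minus m n Q" for P Q
  proof -
    let ?L = "{l. exp_annihilation l P \<noteq> 0} \<union> {l. exp_annihilation l Q \<noteq> 0}
       \<union> {l. exp_annihilation l (P + Q) \<noteq> 0}"
    have "finite ?L" by (simp add: finite_exp_annihilation)
    note * = x_minus_superset[OF this, where m = m and n = n]
    have "x_minus m n R = (\<Sum>l\<in>{l\<in>?L. 0 \<le> int l + 2 * m - n}.
        exp_creation (nat (int l + 2 * m - n)) (exp_annihilation l R))" if "R \<in> {P, Q, P + Q}" for R
      by (rule *) (use that in auto)
    then show ?thesis using E[of ?L] unfolding lattice_linear_def by simp
  qed
  moreover have "x_minus m n (scl c P) = scl c (x_minus m n P)" for c P
  proof -
    let ?L = "{l. exp_annihilation l P \<noteq> 0} \<union> {l. exp_annihilation l (scl c P) \<noteq> 0}"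
    have "finite ?L" by (simp add: finite_exp_annihilation)
    note * = x_minus_superset[OF this, where m = m and n = n]
    have "x_minus m n R = (\<Sum>l\<in>{l\<in>?L. 0 \<le> int l + 2 * m - n}.
        exp_creation (nat (int l + 2 * m - n)) (exp_annihilation l R))" if "R \<in> {P, scl c P}" for R
      by (rule *) (use that in auto)
    then show ?thesis using E[of ?L] unfolding lattice_linear_def by simp
  qed
  ultimately show ?thesis by (simp add: lattice_linear_def)
qed

lemma xbar_specialize: "xbar m (specialize P) = specialize (x0_minus m P)"
  unfolding xbar_def by (rule specialize_lattice_linear[symmetric]) (rule lattice_linear_x_minus)

lemma x0_minus_div2_eqI:
  "scl (qpow 1 + qpow (- 1)) Q = x0_minus (m - 1) (x0_minus m P) \<Longrightarrow> x0_minus_div2 m P = Q"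
  unfolding x0_minus_div2_def by (rule the_equality) (auto intro: scl_quantum_two_cancel)

lemma xbar_div2_specialize:
  assumes "\<And>P. \<exists>Q. scl (qpow 1 + qpow (- 1)) Q = x0_minus (m - 1) (x0_minus m P)"
  shows "xbar_div2 m (specialize P) = specialize (x0_minus_div2 m P)"
proof -
  let ?t = "qpow 1 + qpow (- 1)"
  have *: "scl ?t (x0_minus_div2 m P) = x0_minus (m - 1) (x0_minus m P)" for P
    using assms[of P] x0_minus_div2_eqI by metis
  have lin: "lattice_linear (\<lambda>P. x0_minus (m - 1) (x0_minus m P))"
    by (rule lattice_linear_compose[OF lattice_linear_x_minus lattice_linear_x_minus])
  have "lattice_linear (x0_minus_div2 m)"
    unfolding lattice_linear_def
  proof (intro conjI allI)
    show "x0_minus_div2 m (P + Q) = x0_minus_div2 m P + x0_minus_div2 m Q" for P Q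
      by (rule x0_minus_div2_eqI) (use lin in \<open>simp add: scl_add_right * lattice_linear_def\<close>)
    show "x0_minus_div2 m (scl c P) = scl c (x0_minus_div2 m P)" for c P
    proof (rule x0_minus_div2_eqI)
      have "scl ?t (scl c (x0_minus_div2 m P)) = scl c (scl ?t (x0_minus_div2 m P))"
        by (simp add: mult.commute)
      then show "scl ?t (scl c (x0_minus_div2 m P)) = x0_minus (m - 1) (x0_minus m (scl c P))"
        using lin by (simp add: * lattice_linear_def)
    qed
  qed
  then show ?thesis
    unfolding xbar_div2_def by (rule specialize_lattice_linear[symmetric])
qed

section \<open>Vector spaces and their quotients\<close>

text \<open>Complex vector spaces are modules over the ring of complex numbers; the ring
  multiplication and unit in the module record play no role.\<close>

abbreviation complex_ring :: "complex ring" where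
  "complex_ring \<equiv> ring_of_type_algebra"

definition free_space :: "('k \<Rightarrow>\<^sub>0 complex) set \<Rightarrow> (complex, 'k \<Rightarrow>\<^sub>0 complex) module" where
  "free_space S = \<lparr>carrier = S, monoid.mult = undefined, one = undefined, zero = 0, add = (+), module.smult = scl\<rparr>"

definition quot_module :: "('a, 'b) module \<Rightarrow> 'b set \<Rightarrow> ('a, 'b set) module" where
  "quot_module M N = \<lparr>carrier = a_rcosets\<^bsub>M\<^esub> N, monoid.mult = undefined, one = undefined,
     zero = N, add = set_add M, module.smult = (\<lambda>a C. \<Union>x\<in>C. N +>\<^bsub>M\<^esub> (a \<odot>\<^bsub>M\<^esub> x))\<rparr>"

definition linear_isos ::
  "('r, 'x) ring_scheme \<Rightarrow> ('r, 'a) module \<Rightarrow> ('r, 'b) module \<Rightarrow> ('a \<Rightarrow> 'b) set" where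
  "linear_isos R M N = {h. bij_betw h (carrier M) (carrier N)
     \<and> (\<forall>x\<in>carrier M. \<forall>y\<in>carrier M. h (x \<oplus>\<^bsub>M\<^esub> y) = h x \<oplus>\<^bsub>N\<^esub> h y)
     \<and> (\<forall>a\<in>carrier R. \<forall>x\<in>carrier M. h (a \<odot>\<^bsub>M\<^esub> x) = a \<odot>\<^bsub>N\<^esub> h x)}"

definition isomorphic_spaces :: "(complex, 'a) module \<Rightarrow> (complex, 'b) module \<Rightarrow> bool"
    (infix \<open>\<simeq>\<^sub>\<complex>\<close> 50) where
  "M \<simeq>\<^sub>\<complex> N \<longleftrightarrow> linear_isos complex_ring M N \<noteq> {}"

lemma module_quot_module:
  assumes "module R M" "submodule N R M"
  shows "module R (quot_module M N)"
proof -
  interpret module R M by fact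
  have subg: "subgroup N (add_monoid M)" using assms(2) by (rule submodule.axioms(1))
  interpret N: abelian_subgroup N M
    by (rule abelian_subgroupI3[OF _ M.abelian_group_axioms])
      (rule additive_subgroup.intro[OF subg])
  have N_smult: "a \<odot>\<^bsub>M\<^esub> x \<in> N" if "a \<in> carrier R" "x \<in> N" for a x
    using submodule.smult_closed[OF assms(2)] that by blast
  let ?c = "\<lambda>x. N +>\<^bsub>M\<^esub> x"
  have smult: "a \<odot>\<^bsub>quot_module M N\<^esub> ?c x = ?c (a \<odot>\<^bsub>M\<^esub> x)"
    if ax: "a \<in> carrier R" "x \<in> carrier M" for a x
  proof -
    have "?c (a \<odot>\<^bsub>M\<^esub> y) = ?c (a \<odot>\<^bsub>M\<^esub> x)" if y: "y \<in> ?c x" for y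
    proof -
      obtain n where n: "n \<in> N" "y = n \<oplus>\<^bsub>M\<^esub> x"
        using y by (auto simp: a_r_coset_def' )
      then have "n \<in> carrier M" using N.a_Hcarr by blast
      then have "a \<odot>\<^bsub>M\<^esub> y = (a \<odot>\<^bsub>M\<^esub> n) \<oplus>\<^bsub>M\<^esub> (a \<odot>\<^bsub>M\<^esub> x)"
        using n ax by (simp add: smult_r_distr)
      then have "a \<odot>\<^bsub>M\<^esub> y \<in> ?c (a \<odot>\<^bsub>M\<^esub> x)"
        using N_smult[OF ax(1) n(1)] by (auto simp: a_r_coset_def')
      then show ?thesis
        using N.a_repr_independence'[of "a \<odot>\<^bsub>M\<^esub> y" "a \<odot>\<^bsub>M\<^esub> x"] ax by simp
    qed
    then have "(\<Union>y\<in>?c x. ?c (a \<odot>\<^bsub>M\<^esub> y)) = (\<Union>y\<in>?c x. ?c (a \<odot>\<^bsub>M\<^esub> x))"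
      by (intro SUP_cong refl)
    also have "x \<in> ?c x" using ax(2) by (rule N.a_rcos_self)
    then have "(\<Union>y\<in>?c x. ?c (a \<odot>\<^bsub>M\<^esub> x)) = ?c (a \<odot>\<^bsub>M\<^esub> x)" by (intro SUP_const) blast
    finally show ?thesis by (simp add: quot_module_def)
  qed
  have car: "carrier (quot_module M N) = ?c ` carrier M"
    by (auto simp: quot_module_def A_RCOSETS_def')
  have add: "?c x \<oplus>\<^bsub>quot_module M N\<^esub> ?c y = ?c (x \<oplus>\<^bsub>M\<^esub> y)"
    if "x \<in> carrier M" "y \<in> carrier M" for x y
    using N.a_rcos_sum[OF that] by (simp add: quot_module_def)
  have zero: "\<zero>\<^bsub>quot_module M N\<^esub> = ?c \<zero>\<^bsub>M\<^esub>"
    using N.a_subset by (simp add: quot_module_def)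
  let ?Q = "quot_module M N"
  have in_car: "?c x \<in> carrier ?Q" if "x \<in> carrier M" for x
    using that by (simp add: car)
  have rep: "\<exists>u\<in>carrier M. x = ?c u" if "x \<in> carrier ?Q" for x
    using that by (auto simp only: car)
  show ?thesis
  proof (rule moduleI)
    show "cring R" by (rule R.cring_axioms)
    show "abelian_group ?Q"
    proof (rule abelian_groupI)
      fix x y z
      assume "x \<in> carrier ?Q" "y \<in> carrier ?Q" "z \<in> carrier ?Q"
      then obtain u v w where u: "u \<in> carrier M" "x = ?c u" and v: "v \<in> carrier M" "y = ?c v"
        and w: "w \<in> carrier M" "z = ?c w"
        using rep by meson
      show "x \<oplus>\<^bsub>?Q\<^esub> y \<in> carrier ?Q"
        using u(1) v(1) by (simp only: u(2) v(2) add) (rule in_car, simp)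
      show "x \<oplus>\<^bsub>?Q\<^esub> y \<oplus>\<^bsub>?Q\<^esub> z = x \<oplus>\<^bsub>?Q\<^esub> (y \<oplus>\<^bsub>?Q\<^esub> z)"
        using u(1) v(1) w(1) by (simp only: u(2) v(2) w(2) add M.add.m_closed M.a_assoc)
    next
      fix x y
      assume "x \<in> carrier ?Q" "y \<in> carrier ?Q"
      then obtain u v where u: "u \<in> carrier M" "x = ?c u" and v: "v \<in> carrier M" "y = ?c v"
        using rep by meson
      show "x \<oplus>\<^bsub>?Q\<^esub> y = y \<oplus>\<^bsub>?Q\<^esub> x"
        using u(1) v(1) by (simp only: u(2) v(2) add M.a_comm)
    next
      fix x assume "x \<in> carrier ?Q"
      then obtain u where u: "u \<in> carrier M" "x = ?c u" using rep by meson
      show "\<zero>\<^bsub>?Q\<^esub> \<oplus>\<^bsub>?Q\<^esub> x = x"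
        using u(1) by (simp only: u(2) zero add M.zero_closed M.l_zero)
      have "?c (\<ominus>\<^bsub>M\<^esub> u) \<oplus>\<^bsub>?Q\<^esub> x = \<zero>\<^bsub>?Q\<^esub>"
        using u(1) by (simp only: u(2) add zero M.a_inv_closed M.l_neg)
      then show "\<exists>y\<in>carrier ?Q. y \<oplus>\<^bsub>?Q\<^esub> x = \<zero>\<^bsub>?Q\<^esub>"
        using in_car[OF M.a_inv_closed[OF u(1)]] by (rule bexI)
    next
      show "\<zero>\<^bsub>?Q\<^esub> \<in> carrier ?Q" by (simp only: zero) (rule in_car, simp)
    qed
  next
    fix a b x y
    assume a: "a \<in> carrier R" and b: "b \<in> carrier R" and "x \<in> carrier ?Q" "y \<in> carrier ?Q"
    then obtain u v where u: "u \<in> carrier M" "x = ?c u" and v: "v \<in> carrier M" "y = ?c v"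
      using rep by meson
    note [simp] = a b u(1) v(1)
    show "a \<odot>\<^bsub>?Q\<^esub> (x \<oplus>\<^bsub>?Q\<^esub> y) = a \<odot>\<^bsub>?Q\<^esub> x \<oplus>\<^bsub>?Q\<^esub> a \<odot>\<^bsub>?Q\<^esub> y"
      unfolding u(2) v(2) by (simp add: add smult smult_r_distr del: N.a_rcos_sum)
  next
    fix a b x
    assume a: "a \<in> carrier R" and b: "b \<in> carrier R" and "x \<in> carrier ?Q"
    then obtain u where u: "u \<in> carrier M" "x = ?c u" using rep by meson
    note [simp] = a b u(1)
    show "(a \<oplus>\<^bsub>R\<^esub> b) \<odot>\<^bsub>?Q\<^esub> x = a \<odot>\<^bsub>?Q\<^esub> x \<oplus>\<^bsub>?Q\<^esub> b \<odot>\<^bsub>?Q\<^esub> x"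
      unfolding u(2) by (simp add: add smult smult_l_distr)
    show "(a \<otimes>\<^bsub>R\<^esub> b) \<odot>\<^bsub>?Q\<^esub> x = a \<odot>\<^bsub>?Q\<^esub> (b \<odot>\<^bsub>?Q\<^esub> x)"
      unfolding u(2) by (simp add: smult smult_assoc1)
  next
    fix a x
    assume a: "a \<in> carrier R" and "x \<in> carrier ?Q"
    then obtain u where u: "u \<in> carrier M" "x = ?c u" using rep by meson
    show "a \<odot>\<^bsub>?Q\<^esub> x \<in> carrier ?Q"
      unfolding u(2) smult[OF a u(1)] by (rule in_car) (rule smult_closed[OF a u(1)])
  next
    fix x assume "x \<in> carrier ?Q"
    then obtain u where u: "u \<in> carrier M" "x = ?c u" using rep by meson
    show "\<one>\<^bsub>R\<^esub> \<odot>\<^bsub>?Q\<^esub> x = x"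
      unfolding u(2) smult[OF R.one_closed u(1)] smult_one[OF u(1)] by (rule refl)
  qed
qed

lemma module_free_space: "module complex_ring (free_space (UNIV :: ('k \<Rightarrow>\<^sub>0 complex) set))"
proof (rule moduleI)
  show "cring complex_ring" by (rule cring_from_type_algebra)
  show "abelian_group (free_space (UNIV :: ('k \<Rightarrow>\<^sub>0 complex) set))"
    by (rule abelian_groupI) (auto simp: free_space_def ac_simps intro: exI[of _ "- _"])
qed (simp_all add: free_space_def ring_of_type_algebra_def scl_add_left scl_add_right)

section \<open>The spaces \<open>A\<^sub>2\<^sub>m\<^sub>+\<^sub>1\<close> and the de Rham type complex\<close>

definition relations :: "int \<Rightarrow> complex bpoly set" where
  "relations m = {xbar (m + 1) P + xbar_div2 (m + 2) Q | P Q. True}"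

definition A_space :: "int \<Rightarrow> (complex, complex bpoly set) module" where
  "A_space m = quot_module (free_space UNIV) (relations m)"

definition b_act :: "int \<Rightarrow> nat \<Rightarrow> complex bpoly set \<Rightarrow> complex bpoly set" where
  "b_act m n C = (\<Union>P\<in>C. relations m +>\<^bsub>free_space UNIV\<^esub> (bvar n * P))"

definition odd_neg :: "int set" where
  "odd_neg = {i. i < 0 \<and> odd i}"

text \<open>The basis vector \<open>v\<^bsub>i\<^sub>1,\<dots>,i\<^sub>p\<^esub>\<close> is indexed by the set \<open>{i\<^sub>1,\<dots>,i\<^sub>p}\<close>.\<close>

definition wedge_basis :: "nat \<Rightarrow> int set set" where
  "wedge_basis p = {I. finite I \<and> card I = p \<and> I \<subseteq> odd_neg}"

text \<open>For \<open>i \<in> I\<close>, \<open>dt\<^sub>i \<and> v\<^sub>I = wedge_sign i I v\<^bsub>I - {i}\<^esub>\<close>: if \<open>i\<close> is the \<open>k\<close>-th largest element of \<open>I\<close> then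
  \<open>k - 1\<close> elements of \<open>I\<close> exceed it.\<close>

definition wedge_sign :: "int \<Rightarrow> int set \<Rightarrow> complex" where
  "wedge_sign i I = (- 1) ^ (nat ((- i - 1) div 2) - card {j\<in>I. i < j})"

text \<open>An element \<open>\<Sum>\<^sub>I a\<^sub>I \<otimes> v\<^sub>I\<close> of \<open>A\<^sub>2\<^sub>m\<^sub>+\<^sub>1 \<otimes> \<Omega>\<^bsup>\<infinity>/2-p\<^esup>\<close> is the finitely supported function \<open>I \<mapsto> a\<^sub>I\<close>,
  extended by zero to all sets.\<close>

definition cochains :: "int \<Rightarrow> nat \<Rightarrow> (complex, int set \<Rightarrow> complex bpoly set) module" where
  "cochains m p =
     \<lparr>carrier = {f. (\<forall>I. f I \<in> carrier (A_space m)) \<and> finite {I. f I \<noteq> \<zero>\<^bsub>A_space m\<^esub>}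
                    \<and> {I. f I \<noteq> \<zero>\<^bsub>A_space m\<^esub>} \<subseteq> wedge_basis p},
      monoid.mult = undefined, one = undefined,
      zero = (\<lambda>I. \<zero>\<^bsub>A_space m\<^esub>),
      add = (\<lambda>f g I. f I \<oplus>\<^bsub>A_space m\<^esub> g I),
      module.smult = (\<lambda>c f I. c \<odot>\<^bsub>A_space m\<^esub> f I)\<rparr>"

text \<open>The coefficient of \<open>v\<^sub>J\<close> in \<open>d (\<Sum>\<^sub>I f\<^sub>I \<otimes> v\<^sub>I) = \<Sum>\<^sub>i \<Sum>\<^sub>I b\<^sub>i f\<^sub>I \<otimes> (dt\<^sub>i \<and> v\<^sub>I)\<close> (\<open>i < 0\<close> odd) comes from
  \<open>I = J \<union> {i}\<close> with \<open>i \<notin> J\<close>.  On \<open>p = 0\<close> this is the zero map.\<close>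

definition de_rham_d ::
  "int \<Rightarrow> (int set \<Rightarrow> complex bpoly set) \<Rightarrow> (int set \<Rightarrow> complex bpoly set)" where
  "de_rham_d m f = (\<lambda>J. \<Oplus>\<^bsub>A_space m\<^esub>i\<in>{i\<in>odd_neg - J. f (insert i J) \<noteq> \<zero>\<^bsub>A_space m\<^esub>}.
      wedge_sign i (insert i J) \<odot>\<^bsub>A_space m\<^esub> b_act m (nat (- i)) (f (insert i J)))"

definition cocycles :: "int \<Rightarrow> nat \<Rightarrow> (int set \<Rightarrow> complex bpoly set) set" where
  "cocycles m p = {f \<in> carrier (cochains m p). de_rham_d m f = (\<lambda>I. \<zero>\<^bsub>A_space m\<^esub>)}"

text \<open>\<open>cohomology m p\<close> is \<open>H\<^sub>2\<^sub>m\<^sub>+\<^sub>1\<^bsup>\<infinity>/2-p\<^esup>\<close>.\<close>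

definition cohomology ::
  "int \<Rightarrow> nat \<Rightarrow> (complex, (int set \<Rightarrow> complex bpoly set) set) module" where
  "cohomology m p = quot_module ((cochains m p)\<lparr>carrier := cocycles m p\<rparr>)
                                (de_rham_d m ` carrier (cochains m (p + 1)))"

section \<open>Fermions\<close>

text \<open>\<open>psi n\<close> and \<open>psi_star n\<close> are \<open>\<psi>\<^sub>2\<^sub>n\<^sub>+\<^sub>1\<close> and \<open>\<psi>\<^sub>2\<^sub>n\<^sub>+\<^sub>1\<^sup>*\<close> in the following model of the Fock space.
  The creation operators are \<open>psi n\<close> for \<open>n \<le> 0\<close> and \<open>psi_star n\<close> for \<open>n > 0\<close>.  The basis vector
  indexed by a finite set \<open>F\<close> of modes is the product of the creation operators with modes in \<open>F\<close>, in
  increasing order from left to right, applied to the vacuum.\<close>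

type_synonym fock = "int fset \<Rightarrow>\<^sub>0 complex"

definition mode_sign :: "int \<Rightarrow> int fset \<Rightarrow> complex" where
  "mode_sign n F = (- 1) ^ card {j \<in> fset F. j < n}"

definition create :: "int \<Rightarrow> fock \<Rightarrow> fock" where
  "create n = lin_ext (\<lambda>F. if n |\<in>| F then 0 else Poly_Mapping.single (finsert n F) (mode_sign n F))"

definition annihilate :: "int \<Rightarrow> fock \<Rightarrow> fock" where
  "annihilate n = lin_ext (\<lambda>F. if n |\<in>| F then Poly_Mapping.single (F |-| {|n|}) (mode_sign n F) else 0)"

definition psi :: "int \<Rightarrow> fock \<Rightarrow> fock" where
  "psi n = (if n \<le> 0 then create n else annihilate n)"

definition psi_star :: "int \<Rightarrow> fock \<Rightarrow> fock" where
  "psi_star n = (if n \<le> 0 then annihilate n else create n)"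

definition vacuum :: fock where
  "vacuum = Poly_Mapping.single {||} 1"

text \<open>The vectors \<open>\<psi>\<^bsub>2r\<^sub>1+1\<^esub> \<cdots> \<psi>\<^bsub>2r\<^sub>k+1\<^esub> \<psi>\<^sup>*\<^bsub>2s\<^sub>1+1\<^esub> \<cdots> \<psi>\<^sup>*\<^bsub>2s\<^sub>l+1\<^esub> |1\<rangle>\<close> with
  \<open>r\<^sub>1 < \<dots> < r\<^sub>k < 0 < s\<^sub>1 < \<dots> < s\<^sub>l\<close> and \<open>l = k + m\<close>.\<close>

definition fock_basis :: "int \<Rightarrow> fock set" where
  "fock_basis m = {foldr psi rs (foldr psi_star ss vacuum) | rs ss.
     sorted_wrt (<) rs \<and> sorted_wrt (<) ss \<and> (\<forall>r\<in>set rs. r < 0) \<and> (\<forall>s\<in>set ss. 0 < s)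
     \<and> int (length ss) = int (length rs) + m}"

definition fock_span :: "int \<Rightarrow> fock set" where
  "fock_span m = {(\<Sum>v\<in>B. scl (c v) v) | B c. finite B \<and> B \<subseteq> fock_basis m}"

text \<open>\<open>\<omega> = -\<Sum>\<^bsub>n \<ge> 1\<^esub> \<psi>\<^bsub>-(2n-1)\<^esub> \<psi>\<^bsub>2n+1\<^esub>\<close>, where \<open>-(2n-1) = 2(-n)+1\<close>.\<close>

definition omega :: "fock \<Rightarrow> fock" where
  "omega v = - (\<Sum>n | 1 \<le> n \<and> psi n v \<noteq> 0. psi (- n) (psi n v))"

lemma mode_sign_insert:
  assumes "k |\<notin>| F"
  shows "mode_sign n (finsert k F) = (if k < n then - mode_sign n F else mode_sign n F)"
proof -
  have fin: "finite {j \<in> fset F. j < n}" by simp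
  have "{j \<in> fset (finsert k F). j < n}
      = (if k < n then insert k {j \<in> fset F. j < n} else {j \<in> fset F. j < n})"
    by auto
  moreover have "k \<notin> {j \<in> fset F. j < n}" using assms by auto
  ultimately show ?thesis unfolding mode_sign_def using fin assms by simp
qed

lemma mode_sign_remove:
  assumes "k |\<in>| F"
  shows "mode_sign n (F |-| {|k|}) = (if k < n then - mode_sign n F else mode_sign n F)"
  using mode_sign_insert[of k "F |-| {|k|}" n] assms by (auto simp: finsert_absorb split: if_splits)

lemma mode_sign_square [simp]: "mode_sign n F * mode_sign n F = 1"
  by (simp add: mode_sign_def flip: power_add)

lemma lin_ext_eqI:
  assumes "\<And>k. lin_ext f (g k) + lin_ext f' (g' k) = h k"
  shows "lin_ext f (lin_ext g v) + lin_ext f' (lin_ext g' v) = lin_ext h v"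
proof -
  have "lin_ext f (lin_ext g v) + lin_ext f' (lin_ext g' v)
      = (\<Sum>k\<in>Poly_Mapping.keys v. scl (Poly_Mapping.lookup v k) (lin_ext f (g k) + lin_ext f' (g' k)))"
    by (simp add: lin_ext_def[of g v] lin_ext_def[of g' v] lin_ext_sum lin_ext_scl
        scl_add_right sum.distrib)
  also have "\<dots> = lin_ext h v"
    by (simp add: assms) (simp add: lin_ext_def)
  finally show ?thesis .
qed

lemma lin_ext_basis: "lin_ext (\<lambda>k. Poly_Mapping.single k 1) (v :: 'k \<Rightarrow>\<^sub>0 complex) = v"
  using expand_singles[of v] by (simp add: lin_ext_def)

lemma lin_ext_null [simp]: "lin_ext (\<lambda>k. 0) v = 0"
  by (simp add: lin_ext_def)

lemma create_create: "create k (create l v) + create l (create k v) = 0"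
proof -
  have "create k (create l v) + create l (create k v) = lin_ext (\<lambda>F. 0) v"
    unfolding create_def
    by (rule lin_ext_eqI)
      (auto simp: mode_sign_insert finsert_commute mult.commute simp flip: single_add)
  then show ?thesis by simp
qed

lemma annihilate_annihilate: "annihilate k (annihilate l v) + annihilate l (annihilate k v) = 0"
proof -
  have [simp]: "F |-| {|a|} |-| {|b|} = F |-| {|b|} |-| {|a|}" for F :: "int fset" and a b
    by auto
  have "annihilate k (annihilate l v) + annihilate l (annihilate k v) = lin_ext (\<lambda>F. 0) v"
    unfolding annihilate_def
    by (rule lin_ext_eqI)
      (auto simp: mode_sign_remove mult.commute simp flip: single_add)
  then show ?thesis by simp
qed

lemma create_annihilate:
  "create k (annihilate l v) + annihilate l (create k v) = (if k = l then v else 0)"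
proof -
  have *: "finsert k (F |-| {|l|}) = finsert k F |-| {|l|}" if "k \<noteq> l" for F :: "int fset"
    using that by auto
  have "create k (annihilate l v) + annihilate l (create k v)
      = lin_ext (\<lambda>F. if k = l then Poly_Mapping.single F 1 else 0) v"
    unfolding create_def annihilate_def
    by (rule lin_ext_eqI)
      (auto simp: mode_sign_insert mode_sign_remove * finsert_absorb mult.commute simp flip: single_add)
  then show ?thesis by (simp add: lin_ext_basis)
qed

lemma psi_psi: "psi k (psi l v) + psi l (psi k v) = 0"
  and psi_star_psi_star: "psi_star k (psi_star l v) + psi_star l (psi_star k v) = 0"
  and psi_psi_star: "psi k (psi_star l v) + psi_star l (psi k v) = (if k = l then v else 0)"
  using create_annihilate[of k l v] create_annihilate[of l k v]
  by (auto simp: psi_def psi_star_def create_create annihilate_annihilate add.commute)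

lemma psi_vacuum: "0 < n \<Longrightarrow> psi n vacuum = 0"
  and psi_star_vacuum: "n \<le> 0 \<Longrightarrow> psi_star n vacuum = 0"
  by (simp_all add: psi_def psi_star_def annihilate_def vacuum_def)

lemma create_single:
  assumes "\<And>j. j |\<in>| F \<Longrightarrow> n < j"
  shows "create n (Poly_Mapping.single F 1) = Poly_Mapping.single (finsert n F) 1"
proof -
  have "n |\<notin>| F" using assms by force
  moreover have "{j \<in> fset F. j < n} = {}" using assms by force
  then have "mode_sign n F = 1" unfolding mode_sign_def by (simp only: card.empty power_0)
  ultimately show ?thesis by (simp add: create_def)
qed

lemma foldr_create_single:
  assumes "sorted_wrt (<) xs" "\<And>x j. x \<in> set xs \<Longrightarrow> j |\<in>| F \<Longrightarrow> x < j"
  shows "foldr create xs (Poly_Mapping.single F 1) = Poly_Mapping.single (fset_of_list xs |\<union>| F) 1"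
  using assms
proof (induction xs)
  case (Cons a xs)
  have "create a (Poly_Mapping.single (fset_of_list xs |\<union>| F) 1)
      = Poly_Mapping.single (finsert a (fset_of_list xs |\<union>| F)) 1"
    by (rule create_single) (use Cons.prems in \<open>auto simp: fset_of_list_elem\<close>)
  with Cons show ?case by simp
qed simp

lemma fock_basis_vector:
  assumes "sorted_wrt (<) rs" "sorted_wrt (<) ss" "\<And>r. r \<in> set rs \<Longrightarrow> r < 0" "\<And>s. s \<in> set ss \<Longrightarrow> 0 < s"
  shows "foldr psi rs (foldr psi_star ss vacuum) = Poly_Mapping.single (fset_of_list (rs @ ss)) 1"
proof -
  have "foldr psi_star ss v = foldr create ss v" for v
    using assms(4) by (induction ss) (simp_all add: psi_star_def flip: not_less)
  moreover have "foldr psi rs v = foldr create rs v" for v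
    using assms(3) by (induction rs) (auto simp: psi_def dest: less_imp_le)
  ultimately have "foldr psi rs (foldr psi_star ss vacuum) = foldr create (rs @ ss) vacuum" by simp
  also have "sorted_wrt (<) (rs @ ss)"
    using assms by (auto simp: sorted_wrt_append intro: less_trans)
  then have "foldr create (rs @ ss) vacuum = Poly_Mapping.single (fset_of_list (rs @ ss)) 1"
    using foldr_create_single[of "rs @ ss" "{||}"] by (simp add: vacuum_def)
  finally show ?thesis .
qed

lemma finite_psi_nonzero: "finite {n. 1 \<le> n \<and> psi n v \<noteq> 0}"
proof (rule finite_subset)
  show "{n. 1 \<le> n \<and> psi n v \<noteq> 0} \<subseteq> (\<Union>F\<in>Poly_Mapping.keys v. fset F)"
    by (auto simp: psi_def annihilate_def lin_ext_def intro!: sum.neutral)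
qed auto

text \<open>\<open>fock_space m\<close> is \<open>H\<^sub>2\<^sub>m\<^sub>+\<^sub>1\<^sub>,\<^sub>0\<close> and \<open>W_space m\<close> is \<open>W\<^sub>2\<^sub>m\<^sub>+\<^sub>1\<^sub>,\<^sub>0\<close>.\<close>

definition fock_space :: "int \<Rightarrow> (complex, fock) module" where
  "fock_space m = free_space (fock_span m)"

definition W_space :: "int \<Rightarrow> (complex, fock set) module" where
  "W_space m = quot_module (fock_space m) (omega ` carrier (fock_space (m + 2)))"

end

theory Submission
  imports Defs
begin

text \<open>At \<open>q = \<i>\<close> the operators \<open>x\<^sub>2\<^sub>n\<^sup>-\<close> anticommute, and over \<open>D = \<complex>[b\<^sub>-\<^sub>1, b\<^sub>-\<^sub>3, \<dots>]\<close> the odd ones are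
  combinations of them: \<open>x\<^sub>2\<^sub>n\<^sub>-\<^sub>1\<^sup>- = \<Sum>\<^sub>i \<eta>\<^sub>i x\<^sub>2\<^sub>(\<^sub>n\<^sub>+\<^sub>i\<^sub>)\<^sup>-\<close> with \<open>\<eta>\<^sub>i \<in> D\<close>.  Telescoping the vertex operator product gives
  \<open>(x\<^sub>0\<^sup>-)\<^sup>(\<^sup>2\<^sup>) = \<i> (\<Sum>\<^bsub>n \<ge> 1\<^esub> x\<^sub>-\<^sub>2\<^sub>n\<^sup>- x\<^sub>2\<^sub>n\<^sup>- - \<Sum>\<^bsub>n \<ge> 1\<^esub> x\<^sub>1\<^sub>-\<^sub>2\<^sub>n\<^sup>- x\<^sub>2\<^sub>n\<^sub>-\<^sub>1\<^sup>-)\<close>, and a unitriangular change of the \<open>x\<^sub>2\<^sub>n\<^sup>-\<close> with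
  \<open>n < 0\<close> over \<open>D\<close> turns this into \<open>\<i> \<Sum>\<^bsub>n \<ge> 1\<^esub> G\<^sub>-\<^sub>n G\<^sub>n\<close> while \<open>x\<^sub>0\<^sup>- = G\<^sub>0\<close>.  Semi-infinite products of
  the anticommuting \<open>G\<^sub>n\<close> form a \<open>D\<close>-basis, which identifies \<open>\<V>\<^sub>2\<^sub>m\<^sub>+\<^sub>1\<close> with \<open>D\<close> tensored with the charge
  \<open>m\<close> fermions and \<open>A\<^sub>2\<^sub>m\<^sub>+\<^sub>1\<close> with \<open>D \<otimes> W\<^sub>2\<^sub>m\<^sub>+\<^sub>1\<^sub>,\<^sub>0\<close>.  So \<open>A\<^sub>2\<^sub>m\<^sub>+\<^sub>1\<close> is free over \<open>D\<close>, the complex is a Koszul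
  complex, and only \<open>A\<^sub>2\<^sub>m\<^sub>+\<^sub>1 / \<Sum>\<^sub>i b\<^sub>i A\<^sub>2\<^sub>m\<^sub>+\<^sub>1 = W\<^sub>2\<^sub>m\<^sub>+\<^sub>1\<^sub>,\<^sub>0\<close> survives.\<close>

text \<open>At q = i the factor q^n + q^-n vanishes for odd n, so b_n with n > 0 odd acts as zero
  and multiplication by b_-n commutes with everything: hence the role of \<open>D\<close>. The
  contraction factor (1 - w/z)(1 - q^2 w/z) of two vertex operators becomes 1 - (w/z)^2; for modes
  of one parity this reads 1 - u, and since normally ordered products are symmetric, it forces
  anticommutation. The divided square is 0/0 at q = i, because (x_0^-)^2 and q + q^-1 both vanish
  there, so the division has to be carried out over the Laurent ring, before specializing. The even
  and odd parts of the creation series are translated by the same factor, so their quotient is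
  translation invariant and its coefficients \<open>eta\<close> lie in \<open>D\<close>. The basis
  property needs no character count: every monomial is generated from vacua, and a relation between
  basis vectors is reduced by applying fermions until a vacuum remains. The image of x_0^- accounts
  for the mode 0, which is missing from \<open>fock_span\<close>. The Koszul homotopy divides by
  polynomial degree plus number of removed forms, which is zero only for constants at p = 0; these
  form W.\<close>

abbreviation (input) "lookup \<equiv> Poly_Mapping.lookup"
abbreviation (input) "single \<equiv> Poly_Mapping.single"
abbreviation (input) "keys \<equiv> Poly_Mapping.keys"

section \<open>Exponentials of commuting operators\<close>

lemma lattice_linear_scl_commute: "lattice_linear T \<Longrightarrow> T (scl c P) = scl c (T P)"
  by (simp add: lattice_linear_def)

lemma op_pow_commute:
  assumes T: "lattice_linear T" and c: "\<And>n P. T (F n P) = F n (T P)"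
  shows "T (op_pow F j l P) = op_pow F j l (T P)"
  by (induction j arbitrary: l) (simp_all add: lattice_linear_zero[OF T] lattice_linear_sum[OF T] c)

lemma op_exp_commute:
  assumes "lattice_linear T" and "\<And>n P. T (F n P) = F n (T P)"
  shows "T (op_exp F l P) = op_exp F l (T P)"
  by (simp add: op_exp_def lattice_linear_sum[OF assms(1)] lattice_linear_scl_commute[OF assms(1)]
      op_pow_commute[where T = T and F = F, OF assms])

lemma sum_triangle_swap:
  fixes h :: "nat \<Rightarrow> nat \<Rightarrow> 'a::comm_monoid_add"
  shows "(\<Sum>n\<le>l. \<Sum>k\<le>l-n. h n k) = (\<Sum>k\<le>l. \<Sum>n\<le>l-k. h n k)"
proof -
  have "(\<Sum>n\<le>l. \<Sum>k\<le>l-n. h n k) = (\<Sum>(n,k)\<in>(SIGMA n:{..l}. {..l-n}). h n k)"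
    by (rule sum.Sigma) auto
  also have "\<dots> = (\<Sum>(k,n)\<in>(SIGMA k:{..l}. {..l-k}). h n k)"
    by (rule sum.reindex_bij_witness[of _ "\<lambda>(k,n). (n,k)" "\<lambda>(n,k). (k,n)"]) auto
  also have "\<dots> = (\<Sum>k\<le>l. \<Sum>n\<le>l-k. h n k)"
    by (rule sum.Sigma[symmetric]) auto
  finally show ?thesis .
qed

text \<open>Coefficient form of (F^(j+1))' = (j+1) F' F^j, with w d/dw as derivative; it needs
  commuting coefficients. The induction splits the weight l as n + (l - n) inside the
  convolution.\<close>

lemma op_pow_Suc_weight:
  assumes F: "\<And>n. lattice_linear (F n)" and c: "\<And>a b P. F a (F b P) = F b (F a P)"
  shows "scl (of_nat l) (op_pow F (Suc j) l P)
       = scl (of_nat (Suc j)) (\<Sum>n\<le>l. scl (of_nat n) (F n (op_pow F j (l - n) P)))"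
proof (induction j arbitrary: l)
  case 0
  have "(\<Sum>n\<le>l. F n (if l - n = 0 then P else 0)) = (\<Sum>n\<le>l. if n = l then F n P else 0)"
    by (intro sum.cong refl) (auto simp: lattice_linear_zero[OF F])
  moreover have "(\<Sum>n\<le>l. scl (of_nat n) (F n (if l - n = 0 then P else 0)))
      = (\<Sum>n\<le>l. if n = l then scl (of_nat n) (F n P) else 0)"
    by (intro sum.cong refl) (auto simp: lattice_linear_zero[OF F])
  ultimately show ?case by simp
next
  case (Suc j)
  let ?p = "op_pow F"
  let ?s = "\<lambda>n. scl (of_nat n :: laurent)"
  have "?s l (?p (Suc (Suc j)) l P) = (\<Sum>n\<le>l. ?s l (F n (?p (Suc j) (l - n) P)))"
    by (simp only: op_pow.simps(2)[of F "Suc j"] scl_sum)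
  also have "\<dots> = (\<Sum>n\<le>l. ?s n (F n (?p (Suc j) (l - n) P)) + F n (?s (l - n) (?p (Suc j) (l - n) P)))"
  proof (intro sum.cong refl)
    fix n assume "n \<in> {..l}"
    then have "of_nat l = (of_nat n + of_nat (l - n) :: laurent)" by (simp flip: of_nat_add)
    then show "?s l (F n (?p (Suc j) (l - n) P))
        = ?s n (F n (?p (Suc j) (l - n) P)) + F n (?s (l - n) (?p (Suc j) (l - n) P))"
      by (simp only: lattice_linear_scl_commute[OF F] scl_add_left)
  qed
  also have "\<dots> = (\<Sum>n\<le>l. ?s n (F n (?p (Suc j) (l - n) P)))
      + (\<Sum>n\<le>l. F n (?s (Suc j) (\<Sum>k\<le>l-n. ?s k (F k (?p j (l - n - k) P)))))"
    by (simp only: Suc.IH sum.distrib)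
  also have "(\<Sum>n\<le>l. F n (?s (Suc j) (\<Sum>k\<le>l-n. ?s k (F k (?p j (l - n - k) P)))))
      = ?s (Suc j) (\<Sum>n\<le>l. \<Sum>k\<le>l-n. ?s k (F k (F n (?p j (l - n - k) P))))"
    by (simp only: lattice_linear_scl_commute[OF F] lattice_linear_sum[OF F] scl_sum c)
  also have "(\<Sum>n\<le>l. \<Sum>k\<le>l-n. ?s k (F k (F n (?p j (l - n - k) P))))
      = (\<Sum>k\<le>l. \<Sum>n\<le>l-k. ?s k (F k (F n (?p j (l - n - k) P))))"
    by (rule sum_triangle_swap)
  also have "\<dots> = (\<Sum>k\<le>l. ?s k (F k (?p (Suc j) (l - k) P)))"
    by (simp add: lattice_linear_sum[OF F] scl_sum add.commute)
  also have "(\<Sum>n\<le>l. ?s n (F n (?p (Suc j) (l - n) P))) + ?s (Suc j) \<dots>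
      = ?s (Suc (Suc j)) (\<Sum>n\<le>l. ?s n (F n (?p (Suc j) (l - n) P)))"
    by (simp only: of_nat_Suc[of "Suc j"] scl_add_left scl_one)
  finally show ?case .
qed

lemma op_pow_eq_0:
  assumes F: "\<And>n. lattice_linear (F n)" and F0: "\<And>P. F 0 P = 0"
  shows "l < j \<Longrightarrow> op_pow F j l P = 0"
proof (induction j arbitrary: l)
  case (Suc j)
  have "F n (op_pow F j (l - n) P) = 0" if "n \<le> l" for n
    by (cases "n = 0") (use F0 Suc that in \<open>auto simp: lattice_linear_zero[OF F]\<close>)
  then show ?case by simp
qed simp

lemma const_mult: "const a * const b = const (a * b)"
  by (simp add: const_def mult_single)

lemma const_of_nat: "of_nat n = const (of_nat n)"
  by (simp add: const_def)

lemma const_one [simp]: "const 1 = 1"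
  by (simp add: const_def)

text \<open>The differential equation w E' = (w F') E for E = exp F. As positive integers are
  invertible, it determines E recursively, and the main identities for the two exponentials are
  derived from this recursion.\<close>

lemma op_exp_weight:
  assumes F: "\<And>n. lattice_linear (F n)" and c: "\<And>a b P. F a (F b P) = F b (F a P)"
    and F0: "\<And>P. F 0 P = 0"
  shows "scl (of_nat l) (op_exp F l P) = (\<Sum>n\<in>{1..l}. scl (of_nat n) (F n (op_exp F (l - n) P)))"
proof (cases l)
  case 0
  then show ?thesis by simp
next
  case (Suc L)
  let ?f = "\<lambda>j. const (1 / fact j)"
  let ?s = "\<lambda>n. scl (of_nat n :: laurent)"
  \<comment> \<open>Since \<open>F 0\<close> is zero, powers beyond k contribute nothing, so all
    coefficients up to index L = l - 1 can be summed over one range of j.\<close>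
  have ext: "op_exp F k P = (\<Sum>j\<le>L. scl (?f j) (op_pow F j k P))" if "k \<le> L" for k
    unfolding op_exp_def
    by (rule sum.mono_neutral_left) (use that in \<open>auto simp: op_pow_eq_0[where F = F, OF F F0]\<close>)
  have f: "scl (?f (Suc j)) (?s (Suc j) Q) = scl (?f j) Q" for j Q
    by (simp add: const_of_nat const_mult field_simps del: of_nat_Suc)
  have "?s l (op_exp F l P) = (\<Sum>j\<le>Suc L. scl (?f j) (?s l (op_pow F j l P)))"
    by (simp only: op_exp_def Suc scl_sum scl_scl mult.commute)
  also have "\<dots> = (\<Sum>j\<le>L. scl (?f (Suc j)) (?s l (op_pow F (Suc j) l P)))"
    by (subst sum.atMost_Suc_shift) (simp add: Suc)
  also have "\<dots> = (\<Sum>j\<le>L. scl (?f j) (\<Sum>n\<le>l. ?s n (F n (op_pow F j (l - n) P))))"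
    by (simp only: op_pow_Suc_weight[OF F c] f)
  also have "\<dots> = (\<Sum>j\<le>L. scl (?f j) (\<Sum>n\<in>{1..l}. ?s n (F n (op_pow F j (l - n) P))))"
  proof -
    have "(\<Sum>n\<le>l. ?s n (F n (op_pow F j (l - n) P)))
        = (\<Sum>n\<in>{1..l}. ?s n (F n (op_pow F j (l - n) P)))" for j
      by (rule sum.mono_neutral_right) (auto simp: Suc_le_eq)
    then show ?thesis by simp
  qed
  also have "\<dots> = (\<Sum>n\<in>{1..l}. \<Sum>j\<le>L. scl (?f j) (?s n (F n (op_pow F j (l - n) P))))"
    by (simp only: scl_sum) (rule sum.swap)
  also have "\<dots> = (\<Sum>n\<in>{1..l}. ?s n (F n (op_exp F (l - n) P)))"
  proof (intro sum.cong refl)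
    fix n assume "n \<in> {1..l}"
    then have "op_exp F (l - n) P = (\<Sum>j\<le>L. scl (?f j) (op_pow F j (l - n) P))"
      using Suc by (intro ext) auto
    then show "(\<Sum>j\<le>L. scl (?f j) (?s n (F n (op_pow F j (l - n) P)))) = ?s n (F n (op_exp F (l - n) P))"
      by (simp only: lattice_linear_sum[OF F] lattice_linear_scl_commute[OF F] scl_sum scl_scl mult.commute)
  qed
  finally show ?thesis .
qed


section \<open>Vertex operators as translations\<close>

lemma of_nat_laurent_cancel:
  fixes P Q :: "laurent bpoly"
  assumes "scl (of_nat k) P = scl (of_nat k) Q" "k \<noteq> 0"
  shows "P = Q"
proof -
  have "scl (const (1 / of_nat k)) (scl (of_nat k) R) = R" for R :: "laurent bpoly"
    using assms(2) by (simp add: const_of_nat const_mult)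
  then show ?thesis using assms(1) by metis
qed

lemma scl_mult_left: "scl c P * Q = scl c (P * Q)"
  and scl_mult_right: "P * scl c Q = scl c (P * Q)"
  for P Q :: "'a::comm_semiring_1 bpoly"
  by (simp_all add: scl_conv_mult ac_simps)

lemma scl_neg_left: "scl (- c) P = - scl c P"
  and scl_neg_right: "scl c (- P) = - scl c P"
  for P :: "'k \<Rightarrow>\<^sub>0 'a::comm_ring_1"
  by (rule poly_mapping_eqI, simp)+

section \<open>Derivatives of bosonic polynomials and the Leibniz rule\<close>

lemma bderiv_scl: "bderiv n (scl c P) = scl c (bderiv n P)"
  by (simp add: bderiv_def lin_ext_scl)

lemma bderiv_zero [simp]: "bderiv n 0 = 0"
  by (simp add: bderiv_def)

lemma bderiv_sum: "bderiv n (sum f A) = (\<Sum>x\<in>A. bderiv n (f x))"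
  by (simp add: bderiv_def lin_ext_sum)

lemma bderiv_single:
  "bderiv n (single \<mu> c) = single (\<mu> - single (n - 1) 1)
     (c * of_nat (lookup \<mu> (n - 1)))"
  by (simp add: bderiv_def)

lemma lookup_bderiv:
  fixes P :: "'a::comm_semiring_1 bpoly"
  shows "lookup (bderiv n P) \<mu> = of_nat (Suc (lookup \<mu> (n - 1)))
     * lookup P (\<mu> + single (n - 1) 1)"
proof -
  let ?e = "single (n - 1) 1 :: nat \<Rightarrow>\<^sub>0 nat"
  have *: "(c * of_nat (lookup \<nu> (n - 1)) when \<nu> - ?e = \<mu>)
      = of_nat (Suc (lookup \<mu> (n - 1))) * (c when \<nu> = \<mu> + ?e)" for c :: 'a and \<nu>
  proof (cases "lookup \<nu> (n - 1) = 0")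
    case True
    then have "\<nu> \<noteq> \<mu> + ?e" by (auto simp: lookup_add)
    with True show ?thesis by simp
  next
    case False
    then have "\<nu> - ?e + ?e = \<nu>"
      by (intro poly_mapping_eqI) (auto simp: lookup_add lookup_minus lookup_single when_def)
    then have "\<nu> - ?e = \<mu> \<longleftrightarrow> \<nu> = \<mu> + ?e" by (metis add_diff_cancel_right')
    then show ?thesis by (auto simp: when_def lookup_add mult.commute)
  qed
  have "lookup (bderiv n P) \<mu> = (\<Sum>\<nu>\<in>keys P.
      (lookup P \<nu> * of_nat (lookup \<nu> (n - 1)) when \<nu> - ?e = \<mu>))"
    unfolding bderiv_def lin_ext_def by (simp add: lookup_sum lookup_single)
  also have "\<dots> = of_nat (Suc (lookup \<mu> (n - 1)))
      * (\<Sum>\<nu>\<in>keys P. (lookup P \<nu> when \<nu> = \<mu> + ?e))"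
    by (simp only: * sum_distrib_left)
  also have "(\<Sum>\<nu>\<in>keys P. (lookup P \<nu> when \<nu> = \<mu> + ?e))
      = lookup P (\<mu> + ?e)"
    by (simp add: when_def in_keys_iff)
  finally show ?thesis .
qed

lemma bderiv_commute:
  fixes P :: "'a::comm_semiring_1 bpoly"
  shows "bderiv k (bderiv n P) = bderiv n (bderiv k P)"
  by (rule poly_mapping_eqI)
    (cases "k - 1 = n - 1", simp_all add: lookup_bderiv lookup_add lookup_single ac_simps)

lemma bpoly_mult_expand:
  fixes P Q :: "'a::comm_semiring_1 bpoly"
  shows "P * Q = (\<Sum>\<mu>\<in>keys P. \<Sum>\<nu>\<in>keys Q.
     single (\<mu> + \<nu>) (lookup P \<mu> * lookup Q \<nu>))"
  by (subst expand_singles[of P], subst expand_singles[of Q]) (simp only: sum_product mult_single)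

lemma bderiv_mult:
  fixes P Q :: "'a::comm_semiring_1 bpoly"
  shows "bderiv n (P * Q) = bderiv n P * Q + P * bderiv n Q"
proof -
  let ?e = "single (n - 1) 1 :: nat \<Rightarrow>\<^sub>0 nat"
  let ?s = "single"
  have *: "bderiv n (?s (\<mu> + \<nu>) (c * d)) = bderiv n (?s \<mu> c) * ?s \<nu> d + ?s \<mu> c * bderiv n (?s \<nu> d)"
    for \<mu> \<nu> and c d :: 'a
  proof -
    have 1: "\<mu> + \<nu> - ?e = \<mu> - ?e + \<nu>" if "lookup \<mu> (n - 1) \<noteq> 0" for \<mu> \<nu> :: "nat \<Rightarrow>\<^sub>0 nat"
      using that by (intro poly_mapping_eqI) (auto simp: lookup_add lookup_minus lookup_single when_def)
    have 2: "bderiv n (?s \<mu> c) * ?s \<nu> d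
        = ?s (\<mu> + \<nu> - ?e) (c * d * of_nat (lookup \<mu> (n - 1)))" for \<mu> \<nu> and c d :: 'a
    proof (cases "lookup \<mu> (n - 1) = 0")
      case False
      have "c * of_nat k * d = c * d * of_nat k" for k by (simp only: ac_simps)
      then show ?thesis by (simp only: bderiv_single mult_single 1[OF False])
    qed (simp add: bderiv_single)
    have "?s \<mu> c * bderiv n (?s \<nu> d)
        = ?s (\<mu> + \<nu> - ?e) (c * d * of_nat (lookup \<nu> (n - 1)))"
      using 2[of \<nu> d \<mu> c] by (simp only: mult.commute[of _ "?s \<mu> c"] mult.commute[of d] add.commute[of \<nu>])
    with 2[of \<mu> c \<nu> d] show ?thesis
      by (simp only: bderiv_single lookup_add of_nat_add distrib_left single_add)
  qed
  have 1: "bderiv n P * Q = (\<Sum>\<mu>\<in>keys P. \<Sum>\<nu>\<in>keys Q.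
      bderiv n (?s \<mu> (lookup P \<mu>)) * ?s \<nu> (lookup Q \<nu>))"
    by (subst (1) expand_singles[of P], subst (1) expand_singles[of Q])
      (simp only: bderiv_sum sum_product)
  have 2: "P * bderiv n Q = (\<Sum>\<mu>\<in>keys P. \<Sum>\<nu>\<in>keys Q.
      ?s \<mu> (lookup P \<mu>) * bderiv n (?s \<nu> (lookup Q \<nu>)))"
    by (subst (1) expand_singles[of P], subst (1) expand_singles[of Q])
      (simp only: bderiv_sum sum_product)
  have "bderiv n (P * Q) = (\<Sum>\<mu>\<in>keys P. \<Sum>\<nu>\<in>keys Q.
      bderiv n (?s (\<mu> + \<nu>) (lookup P \<mu> * lookup Q \<nu>)))"
    by (simp only: bpoly_mult_expand[of P Q] bderiv_sum)
  then show ?thesis unfolding 1 2 by (simp only: * sum.distrib)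
qed

lemma b_op_commute:
  assumes "0 \<le> k \<and> 0 \<le> n \<or> k \<le> 0 \<and> n \<le> 0"
  shows "b_op k (b_op n P) = b_op n (b_op k P)"
  using assms by (auto simp: b_op_def bderiv_scl bderiv_commute[of "nat k"] ac_simps)

text \<open>Coefficient of z^k in the creation exponential applied to 1. The extension by zero to
  negative k absorbs the side condition on indices in \<open>x_minus\<close>.\<close>

definition e_coeff :: "int \<Rightarrow> laurent bpoly" where
  "e_coeff k = (if k < 0 then 0 else exp_creation (nat k) 1)"

lemma exp_creation_weight:
  "scl (of_nat k) (exp_creation k P)
     = - (\<Sum>n\<in>{1..k}. scl (qpow (int n)) (bvar n * exp_creation (k - n) P))"
proof -
  let ?F = "\<lambda>n P. if n = 0 then 0 else scl (const (- 1 / of_nat n) * qpow (int n)) (b_op (- int n) P)"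
  have w: "scl (of_nat k) (op_exp ?F k P) = (\<Sum>n\<in>{1..k}. scl (of_nat n) (?F n (op_exp ?F (k - n) P)))"
  proof (rule op_exp_weight[where F = ?F])
    show "lattice_linear (?F n)" for n by (rule lattice_linear_if_scl_b_op)
    show "?F a (?F b Q) = ?F b (?F a Q)" for a b Q
      by (auto simp: lattice_linear_zero[OF lattice_linear_b_op] lattice_linear_scl_commute[OF lattice_linear_b_op]
          b_op_commute[of "- int a"] ac_simps)
  qed simp
  have "of_nat n * (const (- 1 / of_nat n) * qpow (int n)) = - qpow (int n)" if "n \<noteq> 0" for n
  proof -
    have "of_nat n * (const (- 1 / of_nat n) * qpow (int n)) = const (of_nat n * (- 1 / of_nat n)) * qpow (int n)"
      by (simp add: const_of_nat const_mult flip: mult.assoc)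
    also have "\<dots> = const (- 1) * qpow (int n)" using that by simp
    also have "\<dots> = - qpow (int n)" by (simp add: const_def qpow_def mult_single single_uminus)
    finally show ?thesis .
  qed
  then have "scl (of_nat n) (?F n R) = - scl (qpow (int n)) (bvar n * R)" if "n \<in> {1..k}" for n R
    using that by (simp add: b_op_def scl_neg_left)
  then have "(\<Sum>n\<in>{1..k}. scl (of_nat n) (?F n (op_exp ?F (k - n) P)))
     = (\<Sum>n\<in>{1..k}. - scl (qpow (int n)) (bvar n * op_exp ?F (k - n) P))"
    by (intro sum.cong refl) blast
  then show ?thesis
    unfolding exp_creation_def w by (simp only: sum_negf)
qed

lemma exp_creation_0: "exp_creation 0 P = P"
  and exp_annihilation_0: "exp_annihilation 0 P = P"
  by (simp_all add: exp_creation_def exp_annihilation_def op_exp_def)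

text \<open>Creation modes act by multiplication, so the exponential multiplies by its value at 1;
  both sides obey the recursion \<open>exp_creation_weight\<close>.\<close>

lemma exp_creation_mult: "exp_creation k P = e_coeff (int k) * P"
proof (induction k rule: less_induct)
  case (less k)
  show ?case
  proof (cases "k = 0")
    case False
    have 1: "exp_creation (k - n) P = exp_creation (k - n) 1 * P" if "n \<in> {1..k}" for n
    proof -
      have "k - n < k" using that by auto
      from less.IH[OF this] show ?thesis by (simp add: e_coeff_def)
    qed
    have "scl (of_nat k) (exp_creation k P)
       = - (\<Sum>n\<in>{1..k}. scl (qpow (int n)) (bvar n * (exp_creation (k - n) 1 * P)))"
      unfolding exp_creation_weight by (intro arg_cong[of _ _ uminus] sum.cong refl) (simp only: 1)
    also have "\<dots> = scl (of_nat k) (exp_creation k 1) * P"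
      unfolding exp_creation_weight
      by (simp add: sum_distrib_right scl_mult_left mult.assoc)
    finally show ?thesis
      using False of_nat_laurent_cancel by (simp add: scl_mult_left e_coeff_def)
  qed (simp add: exp_creation_0 e_coeff_def)
qed

lemma e_coeff_weight:
  "scl (of_nat k) (e_coeff (int k)) = - (\<Sum>n\<in>{1..k}. scl (qpow (int n)) (bvar n * e_coeff (int k - int n)))"
proof -
  have "exp_creation (k - n) 1 = e_coeff (int k - int n)" if "n \<in> {1..k}" for n
    using that by (auto simp: e_coeff_def nat_diff_distrib)
  then show ?thesis
    using exp_creation_weight[of k 1] by (simp only: e_coeff_def) simp
qed

lemma e_coeff_0 [simp]: "e_coeff 0 = 1"
  and e_coeff_neg [simp]: "k < 0 \<Longrightarrow> e_coeff k = 0"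
  by (simp_all add: e_coeff_def exp_creation_0)

lemma exp_annihilation_weight:
  "scl (of_nat l) (exp_annihilation l P)
     = (\<Sum>n\<in>{1..l}. b_op (int n) (exp_annihilation (l - n) P))"
proof -
  let ?F = "\<lambda>n P. if n = 0 then 0 else scl (const (1 / of_nat n)) (b_op (int n) P)"
  have w: "scl (of_nat l) (op_exp ?F l P) = (\<Sum>n\<in>{1..l}. scl (of_nat n) (?F n (op_exp ?F (l - n) P)))"
  proof (rule op_exp_weight[where F = ?F])
    show "lattice_linear (?F n)" for n by (rule lattice_linear_if_scl_b_op)
    show "?F a (?F b Q) = ?F b (?F a Q)" for a b Q
      by (auto simp: lattice_linear_zero[OF lattice_linear_b_op] lattice_linear_scl_commute[OF lattice_linear_b_op]
          b_op_commute[of "int a"] ac_simps)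
  qed simp
  have "scl (of_nat n) (?F n R) = b_op (int n) R" if "n \<in> {1..l}" for n R
    using that by (simp add: const_of_nat const_mult)
  then have "(\<Sum>n\<in>{1..l}. scl (of_nat n) (?F n (op_exp ?F (l - n) P)))
     = (\<Sum>n\<in>{1..l}. b_op (int n) (op_exp ?F (l - n) P))"
    by (intro sum.cong refl) blast
  then show ?thesis
    unfolding exp_annihilation_def w .
qed

lemma b_op_exp_annihilation:
  "0 \<le> n \<Longrightarrow> b_op n (exp_annihilation l P) = exp_annihilation l (b_op n P)"
  unfolding exp_annihilation_def
  by (rule op_exp_commute[where T = "b_op n", OF lattice_linear_b_op])
    (auto simp: lattice_linear_zero[OF lattice_linear_b_op] lattice_linear_scl_commute[OF lattice_linear_b_op]
          b_op_commute[of n])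

lemma exp_annihilation_commute:
  "exp_annihilation r (exp_annihilation l P) = exp_annihilation l (exp_annihilation r P)"
proof -
  let ?F = "\<lambda>n P. if n = 0 then 0 else scl (const (1 / of_nat n)) (b_op (int n) P)"
  have "exp_annihilation r (op_exp ?F l P) = op_exp ?F l (exp_annihilation r P)"
    by (rule op_exp_commute[where T = "exp_annihilation r", OF lattice_linear_exp_annihilation])
      (auto simp: lattice_linear_zero[OF lattice_linear_exp_annihilation] b_op_exp_annihilation
        lattice_linear_scl_commute[OF lattice_linear_exp_annihilation])
  then show ?thesis by (simp only: exp_annihilation_def)
qed

lemma b_op_mult: "0 \<le> n \<Longrightarrow> b_op n (P * Q) = b_op n P * Q + P * b_op n Q"
  by (auto simp: b_op_def bderiv_mult scl_add_right scl_mult_left scl_mult_right)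

text \<open>Triples with sum l, regrouped by attaching n to the second or to the third index: the
  two halves of a Leibniz rule under a convolution.\<close>

lemma sum_triangle_3:
  fixes h :: "nat \<Rightarrow> nat \<Rightarrow> nat \<Rightarrow> 'a::comm_monoid_add"
  shows "(\<Sum>n\<in>{1..l}. \<Sum>i\<le>l-n. h n i (l - n - i)) = (\<Sum>i\<le>l. \<Sum>n\<in>{1..i}. h n (i - n) (l - i))"
    and "(\<Sum>n\<in>{1..l}. \<Sum>i\<le>l-n. h n i (l - n - i)) = (\<Sum>i\<le>l. \<Sum>n\<in>{1..l-i}. h n i (l - i - n))"
proof -
  have L: "(\<Sum>n\<in>{1..l}. \<Sum>i\<le>l-n. h n i (l - n - i))
      = (\<Sum>(n,i)\<in>(SIGMA n:{1..l}. {..l-n}). h n i (l - n - i))"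
    by (rule sum.Sigma) auto
  have R: "(\<Sum>i\<le>l. \<Sum>n\<in>{1..i}. h n (i - n) (l - i)) = (\<Sum>(i,n)\<in>(SIGMA i:{..l}. {1..i}). h n (i - n) (l - i))"
    "(\<Sum>i\<le>l. \<Sum>n\<in>{1..l-i}. h n i (l - i - n)) = (\<Sum>(i,n)\<in>(SIGMA i:{..l}. {1..l-i}). h n i (l - i - n))"
    by (rule sum.Sigma; auto)+
  show "(\<Sum>n\<in>{1..l}. \<Sum>i\<le>l-n. h n i (l - n - i)) = (\<Sum>i\<le>l. \<Sum>n\<in>{1..i}. h n (i - n) (l - i))"
    unfolding L R
    by (rule sum.reindex_bij_witness[of _ "\<lambda>(i,n). (n,i-n)" "\<lambda>(n,i). (n+i,n)"])
      auto
  show "(\<Sum>n\<in>{1..l}. \<Sum>i\<le>l-n. h n i (l - n - i)) = (\<Sum>i\<le>l. \<Sum>n\<in>{1..l-i}. h n i (l - i - n))"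
    unfolding L R
    by (rule sum.reindex_bij_witness[of _ "\<lambda>(i,n). (n,i)" "\<lambda>(n,i). (i,n)"]) (auto simp: add.commute)
qed

text \<open>Positive modes are derivations, and the exponential of a derivation is a ring
  homomorphism. In coefficients: differentiate the convolution and use l = i + (l - i).\<close>

lemma exp_annihilation_mult:
  "exp_annihilation l (P * Q) = (\<Sum>i\<le>l. exp_annihilation i P * exp_annihilation (l - i) Q)"
proof (induction l rule: less_induct)
  case (less l)
  let ?t = "exp_annihilation"
  let ?b = "\<lambda>n. b_op (int n)"
  let ?s = "\<lambda>n. scl (of_nat n :: laurent)"
  show ?case
  proof (cases "l = 0")
    case False
    have "?s l (?t l (P * Q)) = (\<Sum>n\<in>{1..l}. ?b n (?t (l - n) (P * Q)))"
      by (rule exp_annihilation_weight)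
    also have "\<dots> = (\<Sum>n\<in>{1..l}. ?b n (\<Sum>i\<le>l-n. ?t i P * ?t (l - n - i) Q))"
      by (intro sum.cong refl arg_cong[of _ _ "b_op _"] less.IH) auto
    also have "\<dots> = (\<Sum>n\<in>{1..l}. \<Sum>i\<le>l-n. ?b n (?t i P) * ?t (l - n - i) Q)
        + (\<Sum>n\<in>{1..l}. \<Sum>i\<le>l-n. ?t i P * ?b n (?t (l - n - i) Q))"
      by (simp add: lattice_linear_sum[OF lattice_linear_b_op] b_op_mult sum.distrib)
    also have "(\<Sum>n\<in>{1..l}. \<Sum>i\<le>l-n. ?b n (?t i P) * ?t (l - n - i) Q)
        = (\<Sum>i\<le>l. (\<Sum>n\<in>{1..i}. ?b n (?t (i - n) P)) * ?t (l - i) Q)"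
      unfolding sum_distrib_right by (rule sum_triangle_3(1)[of "\<lambda>n i j. ?b n (?t i P) * ?t j Q"])
    also have "(\<Sum>n\<in>{1..l}. \<Sum>i\<le>l-n. ?t i P * ?b n (?t (l - n - i) Q))
        = (\<Sum>i\<le>l. ?t i P * (\<Sum>n\<in>{1..l-i}. ?b n (?t (l - i - n) Q)))"
      unfolding sum_distrib_left by (rule sum_triangle_3(2)[of "\<lambda>n i j. ?t i P * ?b n (?t j Q)"])
    also have "(\<Sum>i\<le>l. (\<Sum>n\<in>{1..i}. ?b n (?t (i - n) P)) * ?t (l - i) Q)
        + (\<Sum>i\<le>l. ?t i P * (\<Sum>n\<in>{1..l-i}. ?b n (?t (l - i - n) Q)))
        = (\<Sum>i\<le>l. ?s i (?t i P * ?t (l - i) Q) + ?s (l - i) (?t i P * ?t (l - i) Q))"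
      by (simp only: exp_annihilation_weight[symmetric] scl_mult_left scl_mult_right sum.distrib)
    also have "\<dots> = (\<Sum>i\<le>l. ?s l (?t i P * ?t (l - i) Q))"
      by (intro sum.cong refl) (simp flip: scl_add_left of_nat_add)
    finally show ?thesis
      using False of_nat_laurent_cancel by (simp flip: scl_sum)
  qed (simp add: exp_annihilation_0)
qed

text \<open>The contraction factor of an annihilation exponential at z with a creation exponential
  at w, in powers of w/z. It comes from [b_n, b_-n] = n (q^n + q^-n), which after the normalizations
  1/n and -q^n/n leaves -(1 + q^(2n))/n in the exponent.\<close>

definition shift_coeff :: "nat \<Rightarrow> laurent" where
  "shift_coeff l = (if l = 0 then 1 else if l = 1 then - (1 + qpow 2) else if l = 2 then qpow 2 else 0)"

lemma qpow_add: "qpow a * qpow b = qpow (a + b)"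
  by (simp add: qpow_def mult_single)

lemma qpow_0 [simp]: "qpow 0 = 1"
  by (simp add: qpow_def)

text \<open>Logarithmic derivative of \<open>(1 - w) (1 - q\<^sup>2w) = exp (- \<Sum> (1 + q\<^sup>2\<^sup>n) w\<^sup>n / n)\<close>.\<close>

lemma shift_coeff_weight:
  "of_nat l * shift_coeff l = - (\<Sum>n\<in>{1..l}. (1 + qpow (2 * int n)) * shift_coeff (l - n))"
proof -
  consider "l = 0" | "l = 1" | "l = 2" | k where "l = k + 3"
    using le_add_diff_inverse2[of 3 l] by atomize_elim presburger
  then show ?thesis
  proof cases
    case 4
    have "(\<Sum>n\<in>{1..l}. (1 + qpow (2 * int n)) * shift_coeff (l - n))
        = (\<Sum>n\<in>{l-2,l-1,l}. (1 + qpow (2 * int n)) * shift_coeff (l - n))"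
      by (rule sum.mono_neutral_right) (use 4 in \<open>auto simp: shift_coeff_def\<close>)
    also have "\<dots> = (1 + qpow (2 * int k + 2)) * qpow 2 - (1 + qpow (2 * int k + 4)) * (1 + qpow 2)
        + (1 + qpow (2 * int k + 6))"
      using 4 by (simp add: shift_coeff_def algebra_simps)
    also have "\<dots> = 0"
      by (simp add: algebra_simps qpow_add)
    finally show ?thesis using 4 by (simp add: shift_coeff_def)
  qed (simp_all add: shift_coeff_def numeral_2_eq_2 qpow_add algebra_simps)
qed

lemma bderiv_bvar:
  assumes "0 < n" "0 < k"
  shows "bderiv n (bvar k :: 'a::comm_semiring_1 bpoly) = (if n = k then 1 else 0)"
  using assms by (auto simp: bvar_def bderiv_single lookup_single when_def)

lemma exp_annihilation_1: "exp_annihilation l 1 = (if l = 0 then 1 else 0)"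
proof (induction l rule: less_induct)
  case (less l)
  have 1: "b_op (int n) 1 = 0" for n
    using bderiv_single[of n 0 "1::laurent"] by (simp add: b_op_def)
  have "b_op (int n) (exp_annihilation (l - n) 1) = 0" if "n \<in> {1..l}" for n
    using that less[of "l - n"] by (auto simp: 1 lattice_linear_zero[OF lattice_linear_b_op])
  then have "scl (of_nat l) (exp_annihilation l 1) = scl (of_nat l) 0"
    unfolding exp_annihilation_weight by simp
  from of_nat_laurent_cancel[OF this] show ?case by (auto simp: exp_annihilation_0)
qed

text \<open>The variable is translated by (q^k + q^-k) z^-k: among the positive modes only b_k acts
  nontrivially on b_-k, and its value there is a scalar.\<close>

lemma exp_annihilation_bvar:
  assumes "0 < k"
  shows "exp_annihilation l (bvar k) = (if l = 0 then bvar k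
     else if l = k then scl (qpow (int k) + qpow (- int k)) 1 else 0)"
proof (cases "l = 0")
  case False
  have b: "b_op (int n) (bvar k) = (if n = k then scl (of_nat k * (qpow (int k) + qpow (- int k))) 1 else 0)"
    if "0 < n" for n
    using that assms by (simp add: b_op_def bderiv_bvar)
  have "scl (of_nat l) (exp_annihilation l (bvar k))
      = (\<Sum>n\<in>{1..l}. exp_annihilation (l - n) (b_op (int n) (bvar k)))"
    unfolding exp_annihilation_weight by (simp add: b_op_exp_annihilation)
  also have "\<dots> = (\<Sum>n\<in>{1..l}. if n = k then scl (of_nat k * (qpow (int k) + qpow (- int k))) (exp_annihilation (l - n) 1) else 0)"
    by (intro sum.cong refl)
      (auto simp: b lattice_linear_zero[OF lattice_linear_exp_annihilation]
        lattice_linear_scl_commute[OF lattice_linear_exp_annihilation])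
  also have "\<dots> = scl (of_nat l) (if l = k then scl (qpow (int k) + qpow (- int k)) 1 else 0)"
    using assms by (auto simp: exp_annihilation_1)
  finally have "exp_annihilation l (bvar k) = (if l = k then scl (qpow (int k) + qpow (- int k)) 1 else 0)"
    by (rule of_nat_laurent_cancel[OF _ False])
  then show ?thesis using False by (simp only: if_False)
qed (simp add: exp_annihilation_0)

text \<open>Translation multiplies the creation series by the contraction factor. The induction
  applies the translation to the recursion for \<open>e_coeff\<close>, whose variables are shifted
  by scalars.\<close>

lemma exp_annihilation_e_coeff:
  "exp_annihilation l (e_coeff k) = scl (shift_coeff l) (e_coeff (k - int l))"
proof (cases "k < 0")
  case True
  then show ?thesis by (simp add: lattice_linear_zero[OF lattice_linear_exp_annihilation])
next
  case False
  then obtain K where K: "k = int K" by (metis nonneg_int_cases not_less)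
  show ?thesis unfolding K
  proof (induction K arbitrary: l rule: less_induct)
    case (less K)
    let ?t = "exp_annihilation"
    let ?e = "\<lambda>l. scl (shift_coeff l) (e_coeff (int K - int l))"
    show ?case
    proof (cases "K = 0")
      case True
      then show ?thesis by (auto simp: exp_annihilation_1 shift_coeff_def)
    next
      case False
      have IH: "?t l (e_coeff (int K - int n)) = scl (shift_coeff l) (e_coeff (int K - int n - int l))"
        if "n \<in> {1..K}" for n l
        using less[of "K - n" l] that False by (simp add: of_nat_diff)
      \<comment> \<open>In the product rule only i = 0 and i = n survive, since
        \<open>bvar n\<close> has no other nonzero translates.\<close>
      have s: "?t l (bvar n * e_coeff (int K - int n))
          = scl (shift_coeff l) (bvar n * e_coeff (int K - int l - int n))
            + (if n \<le> l then scl ((qpow (int n) + qpow (- int n)) * shift_coeff (l - n)) (e_coeff (int K - int l)) else 0)"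
        if n: "n \<in> {1..K}" for n
      proof -
        have "?t l (bvar n * e_coeff (int K - int n)) = (\<Sum>i\<le>l. ?t i (bvar n) * ?t (l - i) (e_coeff (int K - int n)))"
          by (rule exp_annihilation_mult)
        also have "\<dots> = (\<Sum>i\<le>l. (if i = 0 then bvar n * ?t l (e_coeff (int K - int n)) else 0)
            + (if i = n then scl (qpow (int n) + qpow (- int n)) (?t (l - n) (e_coeff (int K - int n))) else 0))"
          using n by (intro sum.cong refl) (auto simp: exp_annihilation_bvar scl_mult_left)
        also have "\<dots> = bvar n * ?t l (e_coeff (int K - int n))
            + (if n \<le> l then scl (qpow (int n) + qpow (- int n)) (?t (l - n) (e_coeff (int K - int n))) else 0)"
          by (simp add: sum.distrib)
        finally show ?thesis
          using n by (auto simp: IH scl_mult_right of_nat_diff algebra_simps)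
      qed
      have q: "qpow (int n) * ((qpow (int n) + qpow (- int n)) * c) = (1 + qpow (2 * int n)) * c" for n c
        by (simp add: distrib_left qpow_add flip: mult.assoc)
      have s2: "scl (qpow (int n)) (?t l (bvar n * e_coeff (int K - int n)))
          = scl (shift_coeff l) (scl (qpow (int n)) (bvar n * e_coeff (int K - int l - int n)))
            + (if n \<le> l then scl ((1 + qpow (2 * int n)) * shift_coeff (l - n)) (e_coeff (int K - int l)) else 0)"
        if "n \<in> {1..K}" for n
        by (cases "n \<le> l") (simp_all only: s[OF that] scl_add_right scl_scl q if_True if_False scl_zero_right
            mult.commute[of "shift_coeff l"])
      have "scl (of_nat K) (?t l (e_coeff (int K))) = - (\<Sum>n\<in>{1..K}. scl (qpow (int n)) (?t l (bvar n * e_coeff (int K - int n))))"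
      proof -
        have "scl (of_nat K) (?t l (e_coeff (int K))) = ?t l (scl (of_nat K) (e_coeff (int K)))"
          by (rule lattice_linear_scl_commute[OF lattice_linear_exp_annihilation, symmetric])
        also have "\<dots> = ?t l (\<Sum>n\<in>{1..K}. scl (- qpow (int n)) (bvar n * e_coeff (int K - int n)))"
          by (simp only: e_coeff_weight sum_negf[symmetric] scl_neg_left[symmetric])
        also have "\<dots> = (\<Sum>n\<in>{1..K}. scl (- qpow (int n)) (?t l (bvar n * e_coeff (int K - int n))))"
          by (simp only: lattice_linear_sum[OF lattice_linear_exp_annihilation]
            lattice_linear_scl_commute[OF lattice_linear_exp_annihilation])
        finally show ?thesis by (simp only: scl_neg_left sum_negf)
      qed
      also have "\<dots> = - (\<Sum>n\<in>{1..K}. scl (shift_coeff l) (scl (qpow (int n)) (bvar n * e_coeff (int K - int l - int n))))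
          - (\<Sum>n\<in>{1..K}. if n \<le> l then scl ((1 + qpow (2 * int n)) * shift_coeff (l - n)) (e_coeff (int K - int l)) else 0)"
        by (simp only: s2 sum.distrib minus_add_distrib diff_conv_add_uminus[symmetric] cong: sum.cong)
      also have "\<dots> = scl (of_nat K) (?e l)"
      proof (cases "l \<le> K")
        case True
        have 1: "(\<Sum>n\<in>{1..K}. scl (qpow (int n)) (bvar n * e_coeff (int K - int l - int n)))
           = (\<Sum>n\<in>{1..K-l}. scl (qpow (int n)) (bvar n * e_coeff (int (K - l) - int n)))"
          using True by (intro sum.mono_neutral_cong_right) (auto simp: of_nat_diff)
        have 2: "(\<Sum>n\<in>{1..K}. if n \<le> l then scl ((1 + qpow (2 * int n)) * shift_coeff (l - n)) (e_coeff (int K - int l)) else 0)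
           = (\<Sum>n\<in>{1..l}. scl ((1 + qpow (2 * int n)) * shift_coeff (l - n)) (e_coeff (int K - int l)))"
          using True by (intro sum.mono_neutral_cong_right) auto
        have 3: "(\<Sum>n\<in>A. scl (h n) P) = scl (\<Sum>n\<in>A. h n) P" for A and h :: "nat \<Rightarrow> laurent" and P :: "laurent bpoly"
          by (induction A rule: infinite_finite_induct) (simp_all add: scl_add_left)
        have 4: "(\<Sum>n\<in>{1..l}. (1 + qpow (2 * int n)) * shift_coeff (l - n)) = - (of_nat l * shift_coeff l)"
          by (simp add: shift_coeff_weight)
        \<comment> \<open>Split K as (K - l) + l: the part K - l matches the recursion for
          \<open>e_coeff\<close>, the part l the one for \<open>shift_coeff\<close>.\<close>
        have "scl (of_nat K) (?e l) = scl (of_nat (K - l)) (?e l) + scl (of_nat l) (?e l)"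
          using True by (simp add: of_nat_diff left_diff_distrib flip: scl_add_left)
        moreover have "- (\<Sum>n\<in>{1..K-l}. scl (qpow (int n)) (bvar n * e_coeff (int (K - l) - int n)))
            = scl (of_nat (K - l)) (e_coeff (int K - int l))"
          using e_coeff_weight[of "K - l"] True by (simp add: of_nat_diff)
        then have "- scl (shift_coeff l) (\<Sum>n\<in>{1..K-l}. scl (qpow (int n)) (bvar n * e_coeff (int (K - l) - int n)))
            = scl (shift_coeff l) (scl (of_nat (K - l)) (e_coeff (int K - int l)))"
          by (simp only: scl_neg_right[symmetric])
        ultimately show ?thesis
          unfolding 1 2 3 4 scl_sum[symmetric]
          by (simp only: scl_neg_left diff_minus_eq_add scl_scl mult.commute[of "shift_coeff l"])
      next
        case False
        then have "e_coeff (int K - int l - int n) = 0" "e_coeff (int K - int l) = 0" for n by auto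
        then show ?thesis by (simp cong: if_cong)
      qed
      finally show ?thesis by (rule of_nat_laurent_cancel[OF _ False])
    qed
  qed
qed

section \<open>Compositions of shift operators\<close>

text \<open>\<open>\<tau> l\<close> is the coefficient of \<open>z\<^sup>-\<^sup>l\<close> in a translation \<open>\<tau>(z)\<close>; a sequence \<open>s\<close> is shifted if the
  translation multiplies its generating series \<open>s(w)\<close> by \<open>1 + c1 (w/z) + c2 (w/z)\<^sup>2\<close>.\<close>

locale translation =
  fixes \<tau> :: "nat \<Rightarrow> 'a::comm_ring_1 \<Rightarrow> 'a" and c1 c2 :: 'a
  assumes tau_add: "\<tau> l (P + Q) = \<tau> l P + \<tau> l Q"
    and tau_mult: "\<tau> l (P * Q) = (\<Sum>i\<le>l. \<tau> i P * \<tau> (l - i) Q)"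
    and tau_commute: "\<tau> r (\<tau> l P) = \<tau> l (\<tau> r P)"
    and tau_0: "\<tau> 0 P = P"
    and tau_finite: "finite {l. \<tau> l P \<noteq> 0}"
begin

lemma tau_zero [simp]: "\<tau> l 0 = 0"
  using tau_add[of l 0 0] by simp

lemma tau_sum: "\<tau> l (sum f A) = (\<Sum>x\<in>A. \<tau> l (f x))"
  by (induction A rule: infinite_finite_induct) (simp_all add: tau_add)

text \<open>The sums in \<open>Op\<close> and \<open>Op2\<close> run over supports depending on P; a
  bound N supplies one finite range for several arguments at once.\<close>

definition vanish :: "nat \<Rightarrow> 'a \<Rightarrow> bool" where
  "vanish N P \<longleftrightarrow> (\<forall>l>N. \<tau> l P = 0)"

lemma vanish_ex: "\<exists>N. vanish N P"
proof -
  obtain N where "{l. \<tau> l P \<noteq> 0} \<subseteq> {..N}"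
    using tau_finite[of P] finite_nat_iff_bounded_le by blast
  then have "vanish N P" by (force simp: vanish_def)
  then show ?thesis ..
qed

lemma vanish_mono: "vanish N P \<Longrightarrow> N \<le> M \<Longrightarrow> vanish M P"
  by (auto simp: vanish_def)

lemma vanish_tau: "vanish N P \<Longrightarrow> vanish N (\<tau> l P)"
  by (auto simp: vanish_def tau_commute[of _ l])

definition shifted :: "(int \<Rightarrow> 'a) \<Rightarrow> bool" where
  "shifted s \<longleftrightarrow> (\<forall>k l. \<tau> l (s k) =
     (if l = 0 then s k else if l = 1 then c1 * s (k - 1) else if l = 2 then c2 * s (k - 2) else 0))"

text \<open>A mode of a vertex operator: translate, then multiply by the series s. The offset a
  combines the mode index with the power of z coming from the charge; for s = \<open>e_coeff\<close>
  the offset 2m - n gives \<open>x_minus m n\<close>.\<close>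

definition Op :: "(int \<Rightarrow> 'a) \<Rightarrow> int \<Rightarrow> 'a \<Rightarrow> 'a" where
  "Op s a P = (\<Sum>l | \<tau> l P \<noteq> 0. s (int l + a) * \<tau> l P)"

text \<open>The normally ordered product of two such operators.\<close>

definition Op2 :: "(int \<Rightarrow> 'a) \<Rightarrow> (int \<Rightarrow> 'a) \<Rightarrow> int \<Rightarrow> int \<Rightarrow> 'a \<Rightarrow> 'a" where
  "Op2 s t a b P = (\<Sum>l | \<tau> l P \<noteq> 0. \<Sum>r | \<tau> r P \<noteq> 0. s (int r + a) * t (int l + b) * \<tau> r (\<tau> l P))"

lemma Op_eq: "vanish N P \<Longrightarrow> Op s a P = (\<Sum>l\<le>N. s (int l + a) * \<tau> l P)"
  unfolding Op_def vanish_def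
  by (rule sum.mono_neutral_left) (auto simp: not_less[symmetric])

lemma Op2_eq:
  assumes "vanish N P"
  shows "Op2 s t a b P = (\<Sum>l\<le>N. \<Sum>r\<le>N. s (int r + a) * t (int l + b) * \<tau> r (\<tau> l P))"
proof -
  have sub: "{l. \<tau> l P \<noteq> 0} \<subseteq> {..N}" using assms by (auto simp: vanish_def not_less[symmetric])
  have "\<tau> r (\<tau> l P) = 0" if "\<tau> r P = 0" for r l
    using that by (simp add: tau_commute[of r])
  then have "(\<Sum>r | \<tau> r P \<noteq> 0. s (int r + a) * t (int l + b) * \<tau> r (\<tau> l P))
      = (\<Sum>r\<le>N. s (int r + a) * t (int l + b) * \<tau> r (\<tau> l P))" for l
    using sub by (intro sum.mono_neutral_left) auto
  then show ?thesis
    unfolding Op2_def using sub by (simp only:) (rule sum.mono_neutral_left, auto)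
qed

lemma Op2_commute: "Op2 s t a b P = Op2 t s b a P"
  unfolding Op2_def by (subst sum.swap) (simp add: tau_commute mult.commute mult.left_commute)

lemma shifted_tau_big: "shifted s \<Longrightarrow> 2 < l \<Longrightarrow> \<tau> l (s k) = 0"
  by (simp add: shifted_def)

text \<open>Here l = i + r, with i at most 2 the degree spent on a shifted sequence and r the degree
  spent on the other factor; the range N + 2 contains every nonzero pair.\<close>

lemma sum_rectangle_shift:
  fixes f :: "nat \<Rightarrow> nat \<Rightarrow> 'b::comm_monoid_add"
  assumes "\<And>i r. 2 < i \<Longrightarrow> f i r = 0" "\<And>i r. N < r \<Longrightarrow> f i r = 0"
  shows "(\<Sum>l\<le>N+2. \<Sum>i\<le>l. f i (l - i)) = (\<Sum>r\<le>N. f 0 r + f 1 r + f 2 r)"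
proof -
  have "(\<Sum>l\<le>N+2. \<Sum>i\<le>l. f i (l - i)) = (\<Sum>(i, r)\<in>{(i, r). i + r \<le> N + 2}. f i r)"
    by (rule sum.triangle_reindex_eq[symmetric])
  also have "\<dots> = (\<Sum>(i, r)\<in>{..2}\<times>{..N}. f i r)"
  proof (rule sum.mono_neutral_right)
    show "finite {(i, r). i + r \<le> N + 2}"
      by (rule finite_subset[of _ "{..N+2}\<times>{..N+2}"]) auto
    show "{..2} \<times> {..N} \<subseteq> {(i, r). i + r \<le> N + 2}" by auto
    show "\<forall>i\<in>{(i, r). i + r \<le> N + 2} - {..2} \<times> {..N}. (case i of (i, r) \<Rightarrow> f i r) = 0"
      using assms by auto (meson not_le_imp_less)+
  qed
  also have "\<dots> = (\<Sum>i\<le>2. \<Sum>r\<le>N. f i r)" by (simp add: sum.cartesian_product)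
  finally show ?thesis by (simp add: numeral_2_eq_2 sum.distrib)
qed

lemma Op_shifted_mult:
  assumes t: "shifted t" and R: "vanish N R"
  shows "vanish (N + 2) (t k * R)"
    and "(\<Sum>l\<le>N+2. f l * \<tau> l (t k * R))
      = (\<Sum>r\<le>N. (f r * t k + c1 * f (r + 1) * t (k - 1) + c2 * f (r + 2) * t (k - 2)) * \<tau> r R)"
proof -
  have "\<tau> i (t k) * \<tau> (l - i) R = 0" if "N + 2 < l" for l i
    using shifted_tau_big[OF t, of i k] R that by (cases "2 < i") (auto simp: vanish_def)
  then show "vanish (N + 2) (t k * R)"
    unfolding vanish_def tau_mult by (intro allI impI sum.neutral ballI) auto
  have "(\<Sum>l\<le>N+2. f l * \<tau> l (t k * R)) = (\<Sum>l\<le>N+2. \<Sum>i\<le>l. f (i + (l - i)) * \<tau> i (t k) * \<tau> (l - i) R)"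
    by (simp add: tau_mult sum_distrib_left mult.assoc)
  also have "\<dots> = (\<Sum>r\<le>N. f (0 + r) * \<tau> 0 (t k) * \<tau> r R + f (1 + r) * \<tau> 1 (t k) * \<tau> r R
      + f (2 + r) * \<tau> 2 (t k) * \<tau> r R)"
    by (rule sum_rectangle_shift[where f = "\<lambda>i r. f (i + r) * \<tau> i (t k) * \<tau> r R"])
      (use R shifted_tau_big[OF t] in \<open>auto simp: vanish_def\<close>)
  also have "\<dots> = (\<Sum>r\<le>N. (f r * t k + c1 * f (r + 1) * t (k - 1) + c2 * f (r + 2) * t (k - 2)) * \<tau> r R)"
    using t by (intro sum.cong refl) (simp add: shifted_def algebra_simps)
  finally show "(\<Sum>l\<le>N+2. f l * \<tau> l (t k * R))
      = (\<Sum>r\<le>N. (f r * t k + c1 * f (r + 1) * t (k - 1) + c2 * f (r + 2) * t (k - 2)) * \<tau> r R)" .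
qed

lemma vanish_sum: "(\<And>x. x \<in> A \<Longrightarrow> vanish N (f x)) \<Longrightarrow> vanish N (sum f A)"
  by (auto simp: vanish_def tau_sum)

lemma vanish_Op:
  assumes "shifted t" "vanish N P" shows "vanish (N + 2) (Op t b P)"
  unfolding Op_eq[OF assms(2)]
  by (intro vanish_sum Op_shifted_mult(1) assms vanish_tau)

text \<open>Normal ordering: moving the left translation past the series t produces 1 + c1 w/z + c2
  (w/z)^2, and each factor w/z raises the left offset and lowers the right one.\<close>

lemma Op_Op:
  assumes t: "shifted t"
  shows "Op s a (Op t b P) = Op2 s t a b P + c1 * Op2 s t (a + 1) (b - 1) P + c2 * Op2 s t (a + 2) (b - 2) P"
proof -
  obtain N where N: "vanish N P" using vanish_ex by blast
  have "Op s a (Op t b P) = (\<Sum>i\<le>N+2. s (int i + a) * \<tau> i (\<Sum>l\<le>N. t (int l + b) * \<tau> l P))"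
    unfolding Op_eq[OF vanish_Op[OF t N]] unfolding Op_eq[OF N] ..
  also have "\<dots> = (\<Sum>l\<le>N. \<Sum>i\<le>N+2. s (int i + a) * \<tau> i (t (int l + b) * \<tau> l P))"
    unfolding tau_sum sum_distrib_left by (rule sum.swap)
  also have "\<dots> = (\<Sum>l\<le>N. \<Sum>r\<le>N. (s (int r + a) * t (int l + b)
      + c1 * s (int (r + 1) + a) * t (int l + b - 1)
      + c2 * s (int (r + 2) + a) * t (int l + b - 2)) * \<tau> r (\<tau> l P))"
    by (intro sum.cong refl Op_shifted_mult(2)[OF t vanish_tau[OF N], where f = "\<lambda>i. s (int i + a)"])
  also have "\<dots> = Op2 s t a b P + c1 * Op2 s t (a + 1) (b - 1) P + c2 * Op2 s t (a + 2) (b - 2) P"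
    unfolding Op2_eq[OF N]
    by (simp add: sum_distrib_left sum.distrib algebra_simps)
  finally show ?thesis .
qed

lemma Op_add: "Op s a (P + Q) = Op s a P + Op s a Q"
proof -
  obtain N M where "vanish N P" "vanish M Q" using vanish_ex by meson
  then have "vanish (max N M) P" "vanish (max N M) Q" by (auto intro: vanish_mono)
  moreover from this have "vanish (max N M) (P + Q)" by (simp add: vanish_def tau_add)
  ultimately show ?thesis by (simp add: Op_eq tau_add distrib_left sum.distrib)
qed

lemma Op_zero [simp]: "Op s a 0 = 0"
  by (simp add: Op_def)

lemma Op_sum: "Op s a (sum f A) = (\<Sum>x\<in>A. Op s a (f x))"
  by (induction A rule: infinite_finite_induct) (simp_all add: Op_add)

text \<open>Elements fixed by the translation; the operators \<open>Op\<close> are linear over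
  them.\<close>

definition invariant :: "'a \<Rightarrow> bool" where
  "invariant d \<longleftrightarrow> (\<forall>l>0. \<tau> l d = 0)"

lemma tau_invariant_mult:
  assumes "invariant d" shows "\<tau> l (d * P) = d * \<tau> l P"
proof -
  have "\<tau> l (d * P) = (\<Sum>i\<le>l. if i = 0 then d * \<tau> l P else 0)"
    unfolding tau_mult by (intro sum.cong refl) (use assms in \<open>auto simp: invariant_def tau_0\<close>)
  then show ?thesis by simp
qed

lemma Op_invariant_mult:
  assumes "invariant d" shows "Op s a (d * P) = d * Op s a P"
proof -
  obtain N where N: "vanish N P" using vanish_ex by blast
  then have "vanish N (d * P)" by (simp add: vanish_def tau_invariant_mult[OF assms])
  with N show ?thesis
    by (simp add: Op_eq tau_invariant_mult[OF assms] sum_distrib_left mult.left_commute)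
qed

lemma Op_1: "invariant 1 \<Longrightarrow> Op s a 1 = s a"
  using Op_eq[of 0 1 s a] by (simp add: vanish_def invariant_def tau_0)

lemma Op_seq_diff: "Op (\<lambda>k. s k - t k) a P = Op s a P - Op t a P"
  and Op_seq_mult: "Op (\<lambda>k. d * s k) a P = d * Op s a P"
  by (simp_all add: Op_def algebra_simps sum_subtractf sum_distrib_left)

lemma Op_seq_sum: "Op (\<lambda>k. \<Sum>x\<in>A. s x k) a P = (\<Sum>x\<in>A. Op (s x) a P)"
  unfolding Op_def by (subst sum.swap) (simp add: sum_distrib_right)

lemma Op_seq_shift: "Op (\<lambda>k. s (k + j)) a P = Op s (a + j) P"
  by (simp add: Op_def algebra_simps)

lemma Op2_seq_diff: "Op2 (\<lambda>k. s k - s' k) t a b P = Op2 s t a b P - Op2 s' t a b P"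
  and Op2_seq_mult: "Op2 (\<lambda>k. d * s k) t a b P = d * Op2 s t a b P"
  by (simp_all add: Op2_def left_diff_distrib sum_subtractf sum_distrib_left mult.assoc)

lemma Op2_seq_sum: "Op2 (\<lambda>k. \<Sum>x\<in>A. s x k) t a b P = (\<Sum>x\<in>A. Op2 (s x) t a b P)"
proof -
  have "Op2 (\<lambda>k. \<Sum>x\<in>A. s x k) t a b P
    = (\<Sum>l | \<tau> l P \<noteq> 0. \<Sum>x\<in>A. \<Sum>r | \<tau> r P \<noteq> 0. s x (int r + a) * t (int l + b) * \<tau> r (\<tau> l P))"
    unfolding Op2_def by (intro sum.cong refl, subst sum.swap) (simp add: sum_distrib_right)
  then show ?thesis unfolding Op2_def by (subst (asm) sum.swap)
qed

lemma Op2_seq_shift: "Op2 (\<lambda>k. s (k + i)) (\<lambda>k. t (k + j)) a b P = Op2 s t (a + i) (b + j) P"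
  by (simp add: Op2_def algebra_simps)

lemma shifted_shift: "shifted s \<Longrightarrow> shifted (\<lambda>k. s (k + j))"
  by (simp add: shifted_def algebra_simps)

lemma tau_minus: "\<tau> l (- P) = - \<tau> l P"
  using tau_add[of l "- P" P] by (simp add: eq_neg_iff_add_eq_0)

lemma shifted_diff: "shifted s \<Longrightarrow> shifted t \<Longrightarrow> shifted (\<lambda>k. s k - t k)"
  using tau_add[of _ _ "- _"] by (simp add: shifted_def tau_minus right_diff_distrib)

lemma shifted_mult: "shifted s \<Longrightarrow> invariant d \<Longrightarrow> shifted (\<lambda>k. d * s k)"
  by (simp add: shifted_def tau_invariant_mult mult.left_commute)

lemma shifted_zero: "shifted (\<lambda>k. 0)"
  by (simp add: shifted_def)

lemma shifted_add: "shifted s \<Longrightarrow> shifted t \<Longrightarrow> shifted (\<lambda>k. s k + t k)"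
  by (simp add: shifted_def tau_add distrib_left)

lemma shifted_sum: "(\<And>x. x \<in> A \<Longrightarrow> shifted (s x)) \<Longrightarrow> shifted (\<lambda>k. \<Sum>x\<in>A. s x k)"
  by (induction A rule: infinite_finite_induct) (simp_all add: shifted_zero shifted_add)

end

section \<open>Vertex operators and the divided square for generic q\<close>

interpretation generic: translation exp_annihilation
    "scl (shift_coeff 1) 1" "scl (shift_coeff 2) 1"
proof
  show "exp_annihilation l (P + Q) = exp_annihilation l P + exp_annihilation l Q" for l P Q
    using lattice_linear_exp_annihilation by (simp add: lattice_linear_def)
qed (simp_all add: exp_annihilation_mult exp_annihilation_commute exp_annihilation_0 finite_exp_annihilation)

lemma generic_shifted: "generic.shifted e_coeff"
  unfolding generic.shifted_def by (auto simp: exp_annihilation_e_coeff scl_mult_left) (simp_all add: shift_coeff_def)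

lemma x_minus_eq: "x_minus m n P = generic.Op e_coeff (2 * m - n) P"
proof -
  have "x_minus m n P = (\<Sum>l | exp_annihilation l P \<noteq> 0 \<and> 0 \<le> int l + 2 * m - n.
      e_coeff (int l + (2 * m - n)) * exp_annihilation l P)"
    unfolding x_minus_def by (intro sum.cong refl) (simp add: exp_creation_mult algebra_simps)
  also have "\<dots> = generic.Op e_coeff (2 * m - n) P"
    unfolding generic.Op_def by (rule sum.mono_neutral_left) (auto simp: finite_exp_annihilation e_coeff_def split: if_splits)
  finally show ?thesis .
qed

text \<open>This formula proves that the divided square exists on the lattice. In the normal
  ordering of the square, the two outer terms have exchanged offsets and hence agree; together they
  have coefficient 1 + q^2, as does the middle term up to sign.\<close>

lemma x0_minus_div2_eq:
  "x0_minus_div2 m P = scl (qpow 1) (generic.Op2 e_coeff e_coeff (2 * m - 2) (2 * m) P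
      - generic.Op2 e_coeff e_coeff (2 * m - 1) (2 * m - 1) P)"
proof (rule x0_minus_div2_eqI)
  let ?N = "\<lambda>a b. generic.Op2 e_coeff e_coeff a b P"
  have c: "shift_coeff 1 = - (1 + qpow 2)" "shift_coeff 2 = qpow 2"
    by (simp_all only: shift_coeff_def) simp_all
  have i: "2 * (m - 1) - 0 = 2 * m - 2" "2 * m - 0 = 2 * m" "2 * m - 2 + 1 = 2 * m - 1" "2 * m - 2 + 2 = 2 * m"
    by simp_all
  \<comment> \<open>The common factor 1 + q^2 equals q (q + q^-1), which is the source of the
    prefactor \<open>qpow 1\<close>.\<close>
  have q: "(qpow 1 + qpow (- 1)) * qpow 1 = 1 + qpow 2"
    by (simp add: distrib_right qpow_add add.commute)
  have "x0_minus (m - 1) (x0_minus m P) = ?N (2 * m - 2) (2 * m)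
      + scl (- (1 + qpow 2)) 1 * ?N (2 * m - 1) (2 * m - 1) + scl (qpow 2) 1 * ?N (2 * m) (2 * m - 2)"
    by (simp only: x_minus_eq generic.Op_Op[OF generic_shifted] c i)
  also have "\<dots> = (?N (2 * m - 2) (2 * m) + scl (qpow 2) (?N (2 * m - 2) (2 * m)))
      - scl (1 + qpow 2) (?N (2 * m - 1) (2 * m - 1))"
    by (simp only: scl_mult_left mult_1 generic.Op2_commute[of _ _ "2 * m" "2 * m - 2"] scl_neg_left)
      (simp add: scl_mult_left)
  also have "\<dots> = scl (1 + qpow 2) (?N (2 * m - 2) (2 * m)) - scl (1 + qpow 2) (?N (2 * m - 1) (2 * m - 1))"
    by (simp only: scl_add_left scl_one)
  also have "\<dots> = scl (qpow 1 + qpow (- 1)) (scl (qpow 1) (?N (2 * m - 2) (2 * m) - ?N (2 * m - 1) (2 * m - 1)))"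
    by (simp only: scl_scl q diff_conv_add_uminus scl_add_right scl_neg_right)
  finally show "scl (qpow 1 + qpow (- 1)) (scl (qpow 1) (?N (2 * m - 2) (2 * m) - ?N (2 * m - 1) (2 * m - 1)))
    = x0_minus (m - 1) (x0_minus m P)" ..
qed

section \<open>Specialized operators\<close>

lemma eval_i_of_nat: "eval_i (of_nat n) = of_nat n"
  by (simp only: const_of_nat const_def eval_i_single power_int_0_right mult_1_right)

lemma eval_i_qpow: "eval_i (qpow n) = \<i> powi n"
  by (simp add: qpow_def)

lemma specialize_single: "specialize (single \<mu> c) = single \<mu> (eval_i c)"
  by (rule poly_mapping_eqI) (simp add: lookup_single when_def)

lemma specialize_expand:
  "specialize R = (\<Sum>\<mu>\<in>keys R. single \<mu> (eval_i (lookup R \<mu>)))"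
  unfolding specialize_single[symmetric] specialize_sum[symmetric] by (rule arg_cong[OF expand_singles])

lemma specialize_mult: "specialize (P * Q) = specialize P * specialize Q"
proof -
  have "specialize (P * Q) = (\<Sum>\<mu>\<in>keys P. \<Sum>\<nu>\<in>keys Q. single (\<mu> + \<nu>)
      (eval_i (lookup P \<mu>) * eval_i (lookup Q \<nu>)))"
    unfolding bpoly_mult_expand specialize_sum specialize_single eval_i_mult ..
  also have "\<dots> = specialize P * specialize Q"
    unfolding specialize_expand sum_product mult_single ..
  finally show ?thesis .
qed

lemma specialize_one [simp]: "specialize 1 = 1"
  using specialize_single[of 0 1] eval_i_of_nat[of 1] by simp

lemma specialize_bvar: "specialize (bvar n) = bvar n"
  using eval_i_of_nat[of 1] by (simp add: bvar_def specialize_single)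

lemma specialize_minus: "specialize (- P) = - specialize P"
  using specialize_add[of "- P" P] by (simp add: eq_neg_iff_add_eq_0)

lemma specialize_bderiv: "specialize (bderiv n P) = bderiv n (specialize P)"
  by (rule poly_mapping_eqI) (simp add: lookup_bderiv eval_i_mult eval_i_of_nat del: of_nat_Suc)

section \<open>The translation at q = i\<close>

definition tbar :: "nat \<Rightarrow> complex bpoly \<Rightarrow> complex bpoly" where
  "tbar l P = specialize (exp_annihilation l (lift_const P))"

lemma tbar_specialize: "tbar l (specialize P) = specialize (exp_annihilation l P)"
  unfolding tbar_def by (rule specialize_lattice_linear[symmetric]) (rule lattice_linear_exp_annihilation)

lemma tbar_conv: "\<exists>L. P = specialize L"
  by (metis specialize_lift_const)

lemma tbar_add: "tbar l (P + Q) = tbar l P + tbar l Q"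
proof -
  obtain L M where "P = specialize L" "Q = specialize M" using tbar_conv by metis
  then show ?thesis by (simp add: tbar_specialize generic.tau_add flip: specialize_add)
qed

lemma tbar_mult: "tbar l (P * Q) = (\<Sum>i\<le>l. tbar i P * tbar (l - i) Q)"
proof -
  obtain L M where "P = specialize L" "Q = specialize M" using tbar_conv by metis
  then show ?thesis by (simp add: tbar_specialize generic.tau_mult flip: specialize_mult specialize_sum)
qed

lemma tbar_commute: "tbar r (tbar l P) = tbar l (tbar r P)"
proof -
  obtain L where "P = specialize L" using tbar_conv by metis
  then show ?thesis by (simp add: tbar_specialize generic.tau_commute[of r])
qed

lemma tbar_0: "tbar 0 P = P"
  by (simp add: tbar_def exp_annihilation_0)

lemma tbar_finite: "finite {l. tbar l P \<noteq> 0}"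
  by (rule finite_subset[OF _ finite_exp_annihilation[of "lift_const P"]]) (auto simp: tbar_def)

lemma i_powi_sum: "\<i> powi int n + \<i> powi - int n = (if odd n then 0 else 2 * (-1) ^ (n div 2))"
proof -
  have "\<i> powi - int n = (- \<i>) ^ n"
    by (simp add: power_int_minus flip: power_inverse)
  also have "\<dots> = (-1) ^ n * \<i> ^ n" by (rule power_minus)
  finally show ?thesis by (auto elim!: evenE simp: power_mult)
qed

text \<open>The action of b_n at q = i for n > 0; the case distinction is the value of i^n +
  i^-n.\<close>

definition bbar :: "nat \<Rightarrow> complex bpoly \<Rightarrow> complex bpoly" where
  "bbar n P = (if odd n then 0 else scl (of_nat n * 2 * (-1) ^ (n div 2)) (bderiv n P))"

lemma specialize_b_op:
  assumes "0 < n" shows "specialize (b_op (int n) P) = bbar n (specialize P)"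
proof -
  have "eval_i (of_int (int n) * (qpow (int n) + qpow (- int n)))
      = (if odd n then 0 else of_nat n * 2 * (-1) ^ (n div 2))"
    by (simp only: of_int_of_nat_eq eval_i_mult eval_i_of_nat eval_i_add eval_i_qpow i_powi_sum) simp
  moreover have "b_op (int n) P = scl (of_int (int n) * (qpow (int n) + qpow (- int n))) (bderiv n P)"
    using assms by (simp add: b_op_def)
  ultimately show ?thesis
    by (simp only: bbar_def specialize_scl specialize_bderiv) simp
qed

lemma tbar_weight: "scl (of_nat l) (tbar l P) = (\<Sum>n\<in>{1..l}. bbar n (tbar (l - n) P))"
proof -
  have "scl (of_nat l) (tbar l P) = specialize (scl (of_nat l) (exp_annihilation l (lift_const P)))"
    by (simp add: tbar_def specialize_scl eval_i_of_nat)
  also have "\<dots> = (\<Sum>n\<in>{1..l}. specialize (b_op (int n) (exp_annihilation (l - n) (lift_const P))))"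
    by (simp only: exp_annihilation_weight specialize_sum)
  also have "\<dots> = (\<Sum>n\<in>{1..l}. bbar n (tbar (l - n) P))"
    by (intro sum.cong refl) (simp add: specialize_b_op tbar_def)
  finally show ?thesis .
qed

lemma scl_of_nat_cancel:
  fixes P :: "complex bpoly"
  assumes "scl (of_nat l) P = scl (of_nat l) Q" "0 < l"
  shows "P = Q"
  using arg_cong[OF assms(1), of "scl (1 / of_nat l)"] assms(2) by simp

text \<open>Only even modes act, so an odd total degree cannot occur.\<close>

lemma tbar_odd: "odd l \<Longrightarrow> tbar l P = 0"
proof (induction l rule: less_induct)
  case (less l)
  have "bbar n (tbar (l - n) P) = 0" if "n \<in> {1..l}" for n
  proof (cases "odd n")
    case False
    then have "odd (l - n)" using less.prems that by auto
    moreover have "l - n < l" using that by auto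
    ultimately have "tbar (l - n) P = 0" by (intro less.IH)
    then show ?thesis by (simp add: bbar_def)
  qed (simp add: bbar_def)
  then have "scl (of_nat l) (tbar l P) = scl (of_nat l) 0" by (simp add: tbar_weight)
  from scl_of_nat_cancel[OF this] show ?case using less.prems by (simp add: odd_pos)
qed

text \<open>The translation as a series in z^2, which is enough because its odd degrees
  vanish.\<close>

definition sigma :: "nat \<Rightarrow> complex bpoly \<Rightarrow> complex bpoly" where
  "sigma l = tbar (2 * l)"

definition ebar :: "int \<Rightarrow> complex bpoly" where
  "ebar k = specialize (e_coeff k)"

definition gseq :: "int \<Rightarrow> complex bpoly" where "gseq k = ebar (2 * k)"

definition oseq :: "int \<Rightarrow> complex bpoly" where "oseq k = ebar (2 * k + 1)"

lemma sum_even_indices: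
  fixes f :: "nat \<Rightarrow> 'a::comm_monoid_add"
  assumes "\<And>i. odd i \<Longrightarrow> f i = 0"
  shows "(\<Sum>i\<le>2*l. f i) = (\<Sum>j\<le>l. f (2 * j))"
  by (induction l) (simp_all add: assms)

text \<open>At q = i the contraction factor is (1 - w)(1 + w) = 1 - w^2, that is 1 - u in u = w^2.
  Hence the constants -1 and 0.\<close>

interpretation special: translation sigma "-1" 0
proof
  show "sigma l (P * Q) = (\<Sum>i\<le>l. sigma i P * sigma (l - i) Q)" for l P Q
    unfolding sigma_def tbar_mult[of "2 * l"]
    by (subst sum_even_indices) (auto simp: tbar_odd diff_mult_distrib2)
  show "finite {l. sigma l P \<noteq> 0}" for P
  proof -
    have "finite ((\<lambda>l. 2 * l) -` {l. tbar l P \<noteq> 0})"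
      by (rule finite_vimageI[OF tbar_finite]) (simp add: inj_def)
    then show ?thesis by (simp add: sigma_def vimage_def)
  qed
qed (simp_all add: sigma_def tbar_add tbar_commute tbar_0)

lemma gseq_0 [simp]: "gseq 0 = 1"
  and gseq_neg [simp]: "k < 0 \<Longrightarrow> gseq k = 0"
  and oseq_neg [simp]: "k < 0 \<Longrightarrow> oseq k = 0"
  by (simp_all add: gseq_def oseq_def ebar_def)

lemma tbar_ebar: "tbar l (ebar k) = scl (eval_i (shift_coeff l)) (ebar (k - int l))"
  by (simp add: ebar_def tbar_specialize exp_annihilation_e_coeff specialize_scl)

lemma eval_i_shift_coeff: "eval_i (shift_coeff (2 * l)) = (if l = 0 then 1 else if l = 1 then -1 else 0)"
  using eval_i_of_nat[of 1] by (auto simp: shift_coeff_def eval_i_qpow)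

lemma shifted_gseq: "special.shifted gseq"
  and shifted_oseq: "special.shifted oseq"
  by (auto simp: special.shifted_def sigma_def gseq_def oseq_def tbar_ebar eval_i_shift_coeff
      scl_neg_left right_diff_distrib add.commute diff_add_eq)

text \<open>The ring \<open>D\<close>. Variable k stands for b_-(k+1), so excluding odd k leaves
  exactly the modes b_-1, b_-3, ...\<close>

definition odd_polys :: "complex bpoly set" where
  "odd_polys = {P. \<forall>\<mu>\<in>keys P. \<forall>k. odd k \<longrightarrow> lookup \<mu> k = 0}"

lemma bbar_zero [simp]: "bbar n 0 = 0"
  by (simp add: bbar_def)

lemma bbar_odd_polys:
  assumes "P \<in> odd_polys" "0 < n" shows "bbar n P = 0"
proof (cases "odd n")
  case False
  then have "odd (n - 1)" using assms(2) by simp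
  then have "bderiv n P = 0"
    unfolding bderiv_def lin_ext_def using assms(1) by (auto simp: odd_polys_def intro!: sum.neutral)
  then show ?thesis by (simp add: bbar_def)
qed (simp add: bbar_def)

lemma tbar_odd_polys:
  assumes "P \<in> odd_polys" "0 < l" shows "tbar l P = 0"
  using assms(2)
proof (induction l rule: less_induct)
  case (less l)
  have "bbar n (tbar (l - n) P) = 0" if "n \<in> {1..l}" for n
    using less.IH[of "l - n"] that less.prems
    by (cases "n = l") (simp_all add: tbar_0 bbar_odd_polys[OF assms(1)])
  then have "scl (of_nat l) (tbar l P) = scl (of_nat l) 0" by (simp add: tbar_weight)
  from scl_of_nat_cancel[OF this less.prems] show ?case .
qed

lemma bbar_invariant:
  assumes "special.invariant P" "0 < l" shows "bbar l P = 0"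
proof -
  have t: "tbar k P = 0" if "0 < k" for k
  proof (cases "odd k")
    case False
    then obtain j where "k = 2 * j" by blast
    with that assms(1) show ?thesis by (simp add: special.invariant_def sigma_def)
  qed (rule tbar_odd)
  have "(\<Sum>n\<in>{1..l}. bbar n (tbar (l - n) P)) = (\<Sum>n\<in>{1..l}. if n = l then bbar l P else 0)"
    by (intro sum.cong refl) (auto simp: t tbar_0)
  then show ?thesis using tbar_weight[of l P] t[OF assms(2)] assms(2) by simp
qed

text \<open>At q = i an even mode b_n is a nonzero multiple of the derivative by b_-n, and the
  recursion for the translation recovers each b_n. Invariance therefore means vanishing of all
  derivatives by even modes.\<close>

lemma invariant_iff: "special.invariant P \<longleftrightarrow> P \<in> odd_polys"
proof
  assume P: "special.invariant P"
  show "P \<in> odd_polys" unfolding odd_polys_def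
  proof (intro CollectI ballI allI impI)
    fix \<mu> k assume \<mu>: "\<mu> \<in> keys P" and k: "odd (k::nat)"
    show "lookup \<mu> k = 0"
    proof (rule ccontr)
      assume nz: "lookup \<mu> k \<noteq> 0"
      have "bderiv (Suc k) P = scl (1 / (of_nat (Suc k) * 2 * (-1) ^ (Suc k div 2))) (bbar (Suc k) P)"
        using k by (simp add: bbar_def del: of_nat_Suc)
      also have "\<dots> = 0" using bbar_invariant[OF P, of "Suc k"] by simp
      finally have "lookup (bderiv (Suc k) P) (\<mu> - single k 1) = 0" by simp
      moreover have "\<mu> - single k 1 + single k 1 = \<mu>"
        using nz by (intro poly_mapping_eqI) (auto simp: lookup_add lookup_minus lookup_single when_def)
      ultimately show False using \<mu> by (simp add: lookup_bderiv in_keys_iff del: of_nat_Suc)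
    qed
  qed
next
  assume "P \<in> odd_polys"
  then show "special.invariant P" by (simp add: special.invariant_def sigma_def tbar_odd_polys)
qed

section \<open>The quotient of the odd by the even part of the creation series\<close>

lemma odd_polys_single: "(\<And>k. odd k \<Longrightarrow> lookup \<mu> k = 0) \<Longrightarrow> single \<mu> c \<in> odd_polys"
  by (auto simp: odd_polys_def)

lemma invariant_const: "special.invariant (single 0 c)"
  unfolding invariant_iff by (rule odd_polys_single) simp

lemma invariant_one: "special.invariant 1"
  using invariant_const[of 1] by simp

text \<open>Power series division: \<open>eta\<close> is \<open>oseq\<close> divided by
  \<open>gseq\<close>, whose constant term is 1. If O(z) denotes the odd-mode part of the creation
  exponent, the even part of the exponential contains cosh O and the odd part sinh O with the same
  cofactor, so the series in z^2 is tanh(O(z))/z.\<close>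

fun eta :: "nat \<Rightarrow> complex bpoly" where
  "eta k = oseq (int k) - (\<Sum>i<k. eta i * gseq (int k - int i))"

declare eta.simps [simp del]

lemma oseq_eta:
  assumes "k \<le> int K" shows "oseq k = (\<Sum>i\<le>K. eta i * gseq (k - int i))"
proof (cases "k < 0")
  case False
  then obtain n where n: "k = int n" by (metis nonneg_int_cases not_less)
  have "(\<Sum>i\<le>K. eta i * gseq (k - int i)) = (\<Sum>i\<le>n. eta i * gseq (k - int i))"
    using assms n by (intro sum.mono_neutral_right) auto
  also have "\<dots> = oseq k"
    unfolding n lessThan_Suc_atMost[symmetric] by (simp add: eta.simps[of n])
  finally show ?thesis ..
qed simp

text \<open>Numerator and denominator of the quotient are both multiplied by 1 - u under
  translation. In degree 1 the terms cancel by \<open>oseq_eta\<close> at k - 1; higher degrees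
  vanish termwise.\<close>

lemma eta_invariant: "special.invariant (eta k)"
proof (induction k rule: less_induct)
  case (less k)
  have "sigma l (eta k) = 0" if l: "0 < l" for l
  proof -
    have "sigma l (eta i * gseq (int k - int i)) = eta i * sigma l (gseq (int k - int i))" if "i < k" for i
      by (rule special.tau_invariant_mult[OF less.IH[OF that]])
    then have 1: "sigma l (eta k) = sigma l (oseq (int k)) - (\<Sum>i<k. eta i * sigma l (gseq (int k - int i)))"
      using special.tau_add[of l "eta k" "\<Sum>i<k. eta i * gseq (int k - int i)"]
      by (simp add: eta.simps[of k] special.tau_sum)
    show ?thesis
    proof (cases "l = 1")
      case True
      have "oseq (int k - 1) = (\<Sum>i<k. eta i * gseq (int k - 1 - int i))"
      proof (cases k)
        case (Suc K)
        then show ?thesis using oseq_eta[of "int k - 1" K] by (simp add: lessThan_Suc_atMost)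
      qed simp
      then show ?thesis
        unfolding 1 using shifted_gseq shifted_oseq True
        by (simp add: special.shifted_def sum_negf algebra_simps)
    next
      case False
      then show ?thesis
        unfolding 1 using shifted_gseq shifted_oseq l
        by (simp add: special.shifted_def)
    qed
  qed
  then show ?case by (simp add: special.invariant_def)
qed

text \<open>\<open>Gam m n\<close> on charge \<open>m\<close> is the \<open>n\<close>-th fermion: \<open>x\<^sub>2\<^sub>n\<^sup>-\<close> for \<open>n \<ge> 0\<close>, and for \<open>n < 0\<close> corrected by
  \<open>D\<close>-multiples of \<open>x\<^sub>2\<^sub>k\<^sup>-\<close> with \<open>k > n\<close> so that \<open>(x\<^sub>0\<^sup>-)\<^sup>(\<^sup>2\<^sup>)\<close> becomes a sum of products of two fermions of
  opposite index (\<open>xbar_div2_eq\<close>).\<close>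

definition sq :: "int \<Rightarrow> int \<Rightarrow> complex bpoly" where
  "sq n k = gseq (k - n) - (\<Sum>t<nat (- n). eta (nat (- n) - 1 - t) * oseq (k + int t))"

definition Gam :: "int \<Rightarrow> int \<Rightarrow> complex bpoly \<Rightarrow> complex bpoly" where
  "Gam m n P = special.Op (sq n) m P"

lemma shifted_sq: "special.shifted (sq n)"
proof -
  have "special.shifted (\<lambda>k. gseq (k + (- n)) - (\<Sum>t<nat (- n). eta (nat (- n) - 1 - t) * oseq (k + int t)))"
    by (intro special.shifted_diff special.shifted_sum special.shifted_mult eta_invariant
        special.shifted_shift[OF shifted_gseq] special.shifted_shift[OF shifted_oseq])
  then show ?thesis by (simp add: sq_def[abs_def])
qed

text \<open>The corrections read \<open>oseq\<close> at n + t with t < -n, thus at negative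
  indices.\<close>

lemma sq_diag: "sq n n = 1"
  by (auto simp: sq_def intro!: sum.neutral)

text \<open>By \<open>Op_Op\<close> with factor 1 - u, the composition is the difference of the
  normally ordered products with offsets (m-1, m) and (m, m-1). The drop of the charge by one makes
  exchanging the fermions exchange these two terms.\<close>

lemma Gam_anticommute: "Gam (m - 1) a (Gam m b P) = - Gam (m - 1) b (Gam m a P)"
  unfolding Gam_def special.Op_Op[OF shifted_sq]
  by (simp add: special.Op2_commute[of "sq a" "sq b"])

lemma Gam_square: "Gam (m - 1) a (Gam m a P) = 0"
  unfolding Gam_def special.Op_Op[OF shifted_sq]
  by (simp add: special.Op2_commute[of "sq a" "sq a" m])

lemma Gam_sum: "Gam m n (sum f A) = (\<Sum>x\<in>A. Gam m n (f x))"
  and Gam_zero [simp]: "Gam m n 0 = 0"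
  by (simp_all add: Gam_def special.Op_sum)

lemma Gam_mult: "d \<in> odd_polys \<Longrightarrow> Gam m n (d * P) = d * Gam m n P"
  by (simp add: Gam_def special.Op_invariant_mult invariant_iff)

lemma Gam_scl: "Gam m n (scl c P) = scl c (Gam m n P)"
  by (simp add: Gam_def special.Op_invariant_mult invariant_const scl_conv_mult)

lemma Gam_one: "Gam m n 1 = sq n m"
  by (simp add: Gam_def special.Op_1 invariant_one)

lemma Gam_one_diag: "Gam m m 1 = 1"
  by (simp add: Gam_one sq_diag)

section \<open>The defining operators at q = i in terms of the fermions\<close>

lemma specialize_Op:
  "specialize (generic.Op e_coeff (2 * m) (lift_const P)) = special.Op gseq m P"
proof -
  obtain N where "generic.vanish N (lift_const P)" using generic.vanish_ex by blast
  then have g: "generic.vanish (2 * N) (lift_const P)" by (rule generic.vanish_mono) simp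
  then have s: "special.vanish N P"
    by (auto simp: generic.vanish_def special.vanish_def sigma_def tbar_def)
  have "specialize (generic.Op e_coeff (2 * m) (lift_const P)) = (\<Sum>l\<le>2*N. ebar (int l + 2 * m) * tbar l P)"
    by (simp add: generic.Op_eq[OF g] specialize_sum specialize_mult ebar_def tbar_def)
  also have "\<dots> = (\<Sum>l\<le>N. ebar (int (2 * l) + 2 * m) * tbar (2 * l) P)"
    by (rule sum_even_indices) (simp add: tbar_odd)
  also have "\<dots> = special.Op gseq m P"
    by (simp add: special.Op_eq[OF s] gseq_def sigma_def distrib_left)
  finally show ?thesis .
qed

lemma specialize_Op2:
  "specialize (generic.Op2 e_coeff e_coeff a b (lift_const P))
     = special.Op2 (\<lambda>k. ebar (2 * k + a)) (\<lambda>k. ebar (2 * k + b)) 0 0 P"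
proof -
  obtain N where "generic.vanish N (lift_const P)" using generic.vanish_ex by blast
  then have g: "generic.vanish (2 * N) (lift_const P)" by (rule generic.vanish_mono) simp
  then have s: "special.vanish N P"
    by (auto simp: generic.vanish_def special.vanish_def sigma_def tbar_def)
  have tt: "tbar r (tbar l P) = specialize (exp_annihilation r (exp_annihilation l (lift_const P)))" for r l
    by (simp only: tbar_def[of l P] tbar_specialize)
  have "specialize (generic.Op2 e_coeff e_coeff a b (lift_const P))
      = (\<Sum>l\<le>2*N. \<Sum>r\<le>2*N. ebar (int r + a) * ebar (int l + b) * tbar r (tbar l P))"
    by (simp add: generic.Op2_eq[OF g] specialize_sum specialize_mult ebar_def tt)
  also have "\<dots> = (\<Sum>l\<le>2*N. \<Sum>r\<le>N. ebar (int (2 * r) + a) * ebar (int l + b) * tbar (2 * r) (tbar l P))"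
    by (intro sum.cong refl sum_even_indices) (simp add: tbar_odd)
  also have "\<dots> = (\<Sum>l\<le>N. \<Sum>r\<le>N. ebar (int (2 * r) + a) * ebar (int (2 * l) + b) * tbar (2 * r) (tbar (2 * l) P))"
    by (rule sum_even_indices) (simp add: tbar_odd special.tau_zero[unfolded sigma_def])
  also have "\<dots> = special.Op2 (\<lambda>k. ebar (2 * k + a)) (\<lambda>k. ebar (2 * k + b)) 0 0 P"
    by (simp add: special.Op2_eq[OF s] sigma_def)
  finally show ?thesis .
qed

lemma xbar_eq: "xbar m P = Gam m 0 P"
  using specialize_Op[of m P] by (simp add: xbar_def x_minus_eq Gam_def sq_def[abs_def])

text \<open>The offsets 2m - 2 and 2m pick the even part of the creation series, 2m - 1 the odd
  part; the prefactor q becomes i.\<close>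

lemma xbar_div2_Op2:
  "xbar_div2 m P = scl \<i> (special.Op2 gseq gseq (m - 1) m P - special.Op2 oseq oseq (m - 1) (m - 1) P)"
proof -
  have "special.Op2 (\<lambda>k. ebar (2 * k + (2 * m - 2))) (\<lambda>k. ebar (2 * k + 2 * m)) 0 0 P
      = special.Op2 gseq gseq (m - 1) m P"
    using special.Op2_seq_shift[of gseq "m - 1" gseq m 0 0 P]
    by (simp add: gseq_def algebra_simps)
  moreover have "special.Op2 (\<lambda>k. ebar (2 * k + (2 * m - 1))) (\<lambda>k. ebar (2 * k + (2 * m - 1))) 0 0 P
      = special.Op2 oseq oseq (m - 1) (m - 1) P"
    using special.Op2_seq_shift[of oseq "m - 1" oseq "m - 1" 0 0 P]
    by (simp add: oseq_def algebra_simps)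
  moreover have "specialize (Q - R) = specialize Q - specialize R" for Q R
    using specialize_add[of Q "- R"] by (simp add: specialize_minus)
  ultimately show ?thesis
    by (simp add: xbar_div2_def x0_minus_div2_eq specialize_scl specialize_Op2 eval_i_qpow)
qed

lemma sum_telescope_desc:
  fixes f :: "nat \<Rightarrow> 'a::ab_group_add"
  shows "(\<Sum>n<K. f n - f (Suc n)) = f 0 - f K"
  by (induction K) simp_all

text \<open>Two telescopes. The even-even terms telescope in n. The corrections contained in the
  negative fermions, grouped by the index of \<open>eta\<close>, telescope in t, and what remains
  reassembles \<open>oseq\<close> from \<open>eta\<close> and \<open>gseq\<close>.\<close>

lemma xbar_div2_eq:
  assumes N: "special.vanish N P" and K: "int N + m < int K"
  shows "xbar_div2 m P = scl \<i> (\<Sum>n\<in>{1..K}. Gam (m - 1) (- int n) (Gam m (int n) P))"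
proof -
  define A where "A a b = special.Op2 gseq gseq a b P" for a b
  define B where "B a b = special.Op2 oseq gseq a b P" for a b
  \<comment> \<open>The upper boundary terms vanish: for l at most N the index l + b is negative by
    the choice of K.\<close>
  have zero: "special.Op2 s gseq a b P = 0" if "b \<le> m - 1 - int K" for s a b
    unfolding special.Op2_eq[OF N] using K that by (intro sum.neutral ballI) auto
  have sq2: "special.Op2 (sq (- int n)) (sq (int n)) a b P
      = A (a + int n) (b - int n) - (\<Sum>t<n. eta (n - 1 - t) * B (a + int t) (b - int n))" if "0 < n" for a b n
  proof -
    have s1: "sq (int n) = (\<lambda>k. gseq (k + (- int n)))"
      using that by (simp add: sq_def[abs_def])
    have s2: "sq (- int n) = (\<lambda>k. gseq (k + int n) - (\<Sum>t<n. eta (n - 1 - t) * oseq (k + int t)))"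
      using that by (simp add: sq_def[abs_def])
    have "special.Op2 oseq (\<lambda>k. gseq (k + (- int n))) a' b P = B a' (b - int n)" for a'
      using special.Op2_seq_shift[of oseq 0 gseq "- int n" a' b P] by (simp add: B_def)
    moreover have "special.Op2 (\<lambda>k. oseq (k + int t)) t' a b P = special.Op2 oseq t' (a + int t) b P" for t t'
      using special.Op2_seq_shift[of oseq "int t" t' 0 a b P] by simp
    ultimately show ?thesis
      unfolding s1 s2 special.Op2_seq_diff special.Op2_seq_sum special.Op2_seq_mult
      using special.Op2_seq_shift[of gseq "int n" gseq "- int n" a b P] by (simp add: A_def)
  qed
  \<comment> \<open>Offsets are written so that consecutive n in A, and consecutive t in B at fixed
    n - t, differ by one step of a telescope.\<close>
  have summand: "Gam (m - 1) (- int (Suc n)) (Gam m (int (Suc n)) P)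
      = (A (m + int n) (m - 1 - int n) - A (m + int (Suc n)) (m - 1 - int (Suc n)))
        - (\<Sum>t\<le>n. eta (n - t) * (B (m - 1 + int t) (m - 1 - int (n - t) - int t)
              - B (m - 1 + int (Suc t)) (m - 1 - int (n - t) - int (Suc t))))" for n
  proof -
    have "Gam (m - 1) (- int (Suc n)) (Gam m (int (Suc n)) P)
      = special.Op2 (sq (- int (Suc n))) (sq (int (Suc n))) (m - 1) m P
        - special.Op2 (sq (- int (Suc n))) (sq (int (Suc n))) m (m - 1) P"
      unfolding Gam_def special.Op_Op[OF shifted_sq] by simp
    also have "\<dots> = (A (m + int n) (m - 1 - int n) - A (m + int (Suc n)) (m - 1 - int (Suc n)))
        - (\<Sum>t<Suc n. eta (n - t) * B (m - 1 + int t) (m - int (Suc n))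
          - eta (n - t) * B (m + int t) (m - 1 - int (Suc n)))"
    proof -
      have "A (m - 1 + int (Suc n)) (m - int (Suc n)) = A (m + int n) (m - 1 - int n)"
        by (simp add: algebra_simps)
      moreover have "Suc n - 1 - t = n - t" for t by simp
      moreover have r: "(a - b) - (c - d) = (a - c) - (b - d)" for a b c d :: "complex bpoly" by simp
      ultimately show ?thesis
        by (simp only: sq2[OF zero_less_Suc, of n "m - 1" m] sq2[OF zero_less_Suc, of n m "m - 1"] sum_subtractf)
    qed
    also have "(\<Sum>t<Suc n. eta (n - t) * B (m - 1 + int t) (m - int (Suc n))
          - eta (n - t) * B (m + int t) (m - 1 - int (Suc n)))
       = (\<Sum>t\<le>n. eta (n - t) * (B (m - 1 + int t) (m - 1 - int (n - t) - int t)
              - B (m - 1 + int (Suc t)) (m - 1 - int (n - t) - int (Suc t))))"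
      unfolding lessThan_Suc_atMost
      by (intro sum.cong refl) (auto simp: of_nat_diff right_diff_distrib algebra_simps)
    finally show ?thesis .
  qed
  have "(\<Sum>n\<in>{1..K}. Gam (m - 1) (- int n) (Gam m (int n) P))
      = (\<Sum>n<K. Gam (m - 1) (- int (Suc n)) (Gam m (int (Suc n)) P))"
    by (rule sum.reindex_bij_witness[of _ Suc "\<lambda>n. n - 1"]) auto
  also have "\<dots> = (\<Sum>n<K. A (m + int n) (m - 1 - int n) - A (m + int (Suc n)) (m - 1 - int (Suc n)))
      - (\<Sum>n<K. \<Sum>t\<le>n. eta (n - t) * (B (m - 1 + int t) (m - 1 - int (n - t) - int t)
              - B (m - 1 + int (Suc t)) (m - 1 - int (n - t) - int (Suc t))))"
    unfolding summand by (rule sum_subtractf)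
  also have "(\<Sum>n<K. A (m + int n) (m - 1 - int n) - A (m + int (Suc n)) (m - 1 - int (Suc n))) = A m (m - 1)"
    unfolding sum_telescope_desc[of "\<lambda>n. A (m + int n) (m - 1 - int n)"]
    by (simp add: A_def zero)
  \<comment> \<open>Regrouping the triangle by j = n - t fixes the coefficient \<open>eta j\<close>
    and leaves t free to telescope.\<close>
  also have "(\<Sum>n<K. \<Sum>t\<le>n. eta (n - t) * (B (m - 1 + int t) (m - 1 - int (n - t) - int t)
              - B (m - 1 + int (Suc t)) (m - 1 - int (n - t) - int (Suc t))))
     = (\<Sum>j<K. \<Sum>t<K-j. eta j * (B (m - 1 + int t) (m - 1 - int j - int t)
              - B (m - 1 + int (Suc t)) (m - 1 - int j - int (Suc t))))"
  proof -
    let ?h = "\<lambda>j t. eta j * (B (m - 1 + int t) (m - 1 - int j - int t)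
              - B (m - 1 + int (Suc t)) (m - 1 - int j - int (Suc t)))"
    have "(\<Sum>n<K. \<Sum>t\<le>n. ?h (n - t) t) = (\<Sum>(n, t)\<in>(SIGMA n:{..<K}. {..n}). ?h (n - t) t)"
      by (rule sum.Sigma) auto
    also have "\<dots> = (\<Sum>(j, t)\<in>(SIGMA j:{..<K}. {..<K-j}). ?h j t)"
      by (rule sum.reindex_bij_witness[of _ "\<lambda>(j, t). (j + t, t)" "\<lambda>(n, t). (n - t, t)"]) auto
    also have "\<dots> = (\<Sum>j<K. \<Sum>t<K-j. ?h j t)"
      by (rule sum.Sigma[symmetric]) auto
    finally show ?thesis .
  qed
  also have "\<dots> = (\<Sum>j<K. eta j * B (m - 1) (m - 1 - int j))"
  proof (intro sum.cong refl)
    fix j assume "j \<in> {..<K}"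
    then have "B (m - 1 + int (K - j)) (m - 1 - int j - int (K - j)) = 0"
      unfolding B_def by (intro zero) (simp add: of_nat_diff)
    then show "(\<Sum>t<K-j. eta j * (B (m - 1 + int t) (m - 1 - int j - int t)
              - B (m - 1 + int (Suc t)) (m - 1 - int j - int (Suc t)))) = eta j * B (m - 1) (m - 1 - int j)"
      unfolding sum_distrib_left[symmetric]
        sum_telescope_desc[of "\<lambda>t. B (m - 1 + int t) (m - 1 - int j - int t)"] by simp
  qed
  also have "\<dots> = special.Op2 oseq oseq (m - 1) (m - 1) P"
  proof -
    have "B (m - 1) (m - 1 - int j) = special.Op2 (\<lambda>k. gseq (k - int j)) oseq (m - 1) (m - 1) P" for j
      using special.Op2_seq_shift[of gseq "- int j" oseq 0 "m - 1" "m - 1" P]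
      by (simp add: B_def special.Op2_commute[of oseq])
    then have "(\<Sum>j<K. eta j * B (m - 1) (m - 1 - int j))
        = special.Op2 (\<lambda>k. \<Sum>j<K. eta j * gseq (k - int j)) oseq (m - 1) (m - 1) P"
      by (simp add: special.Op2_seq_sum special.Op2_seq_mult)
    also have "\<dots> = special.Op2 oseq oseq (m - 1) (m - 1) P"
    proof -
      \<comment> \<open>The truncated quotient series is exact here because r + m - 1 stays below K
        for all r up to N.\<close>
      have "(\<Sum>j<K. eta j * gseq (int r + (m - 1) - int j)) = oseq (int r + (m - 1))" if r: "r \<le> N" for r
      proof (cases K)
        case 0
        then show ?thesis using K r by simp
      next
        case (Suc K')
        then show ?thesis using oseq_eta[of "int r + (m - 1)" K'] K r by (simp add: lessThan_Suc_atMost)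
      qed
      then show ?thesis unfolding special.Op2_eq[OF N] by (intro sum.cong refl) auto
    qed
    finally show ?thesis .
  qed
  finally show ?thesis
    by (simp add: xbar_div2_Op2 A_def special.Op2_commute[of gseq gseq m])
qed

section \<open>The fermionic basis\<close>

text \<open>The product of the fermions in the list, rightmost first, applied to the vacuum
  \<open>1\<close> of charge M. Each fermion lowers the charge by one, which fixes the first
  argument of \<open>Gam\<close>.\<close>

primrec word :: "int list \<Rightarrow> int \<Rightarrow> complex bpoly" where
  "word [] M = 1"
| "word (x # xs) M = Gam (M - int (length xs)) x (word xs M)"

lemma Gam_word_mem:
  "n \<in> set xs \<Longrightarrow> Gam (M - int (length xs)) n (word xs M) = 0"
proof (induction xs)
  case (Cons x xs)
  have c: "M - int (length (x # xs)) = M - int (length xs) - 1" by simp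
  show ?case
  proof (cases "n = x")
    case True
    then show ?thesis unfolding c by (simp add: Gam_square)
  next
    case False
    then show ?thesis
      unfolding c word.simps Gam_anticommute[of "M - int (length xs)" n x] using Cons by simp
  qed
qed simp

lemma Gam_word_insort:
  assumes "sorted_wrt (<) xs" "n \<notin> set xs"
  shows "Gam (M - int (length xs)) n (word xs M) = scl ((-1) ^ card {x\<in>set xs. x < n}) (word (insort n xs) M)"
  using assms
proof (induction xs)
  case (Cons x xs)
  have c: "M - int (length (x # xs)) = M - int (length xs) - 1" by simp
  show ?case
  proof (cases "n < x")
    case True
    with Cons.prems have "{y\<in>set (x # xs). y < n} = {}" by fastforce
    then have "card {y\<in>set (x # xs). y < n} = 0" by (simp only: card.empty)
    moreover have "insort n (x # xs) = n # x # xs" using True by simp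
    ultimately show ?thesis by (simp only: word.simps power_0 scl_one)
  next
    case False
    with Cons.prems have x: "x < n" by auto
    have "{y\<in>set (x # xs). y < n} = insert x {y\<in>set xs. y < n}" using x by auto
    moreover have "x \<notin> {y\<in>set xs. y < n}" using Cons.prems by auto
    ultimately have "card {y\<in>set (x # xs). y < n} = Suc (card {y\<in>set xs. y < n})" by simp
    moreover have "Gam (M - int (length (x # xs))) n (word (x # xs) M)
        = - Gam (M - int (length xs) - 1) x (scl ((-1) ^ card {y\<in>set xs. y < n}) (word (insort n xs) M))"
      unfolding c word.simps Gam_anticommute[of "M - int (length xs)" n x] using Cons by simp
    moreover have "word (insort n (x # xs)) M = Gam (M - int (length xs) - 1) x (word (insort n xs) M)"
      using x by (simp add: algebra_simps)
    ultimately show ?thesis by (simp add: Gam_scl scl_neg_left)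
  qed
qed simp

text \<open>The fermion M + 1 maps the vacuum of charge M + 1 to the one of charge M. This is the
  stability that gives semi-infinite products a meaning.\<close>

lemma word_snoc: "word (xs @ [M + 1]) (M + 1) = word xs M"
  by (induction xs) (simp_all add: Gam_one_diag)

section \<open>Ordered fermion products indexed by finite sets\<close>

definition wset :: "int set \<Rightarrow> int \<Rightarrow> complex bpoly" where
  "wset A M = word (sorted_list_of_set A) M"

lemma Gam_wset_insert:
  assumes "finite A" "n \<notin> A"
  shows "Gam (M - int (card A)) n (wset A M) = scl ((-1) ^ card {x\<in>A. x < n}) (wset (insert n A) M)"
  using Gam_word_insort[of "sorted_list_of_set A" n M] assms by (simp add: wset_def)

lemma Gam_wset_mem:
  assumes "finite A" "n \<in> A"
  shows "Gam (M - int (card A)) n (wset A M) = 0"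
  using Gam_word_mem[of n "sorted_list_of_set A" M] assms by (simp add: wset_def)

lemma wset_extend:
  assumes "finite A" "A \<subseteq> {..M}"
  shows "wset (insert (M + 1) A) (M + 1) = wset A M"
proof -
  have "M + 1 \<notin> A" using assms(2) by auto
  then have "sorted_list_of_set (insert (M + 1) A) = insort (M + 1) (sorted_list_of_set A)"
    using assms(1) by simp
  also have "\<dots> = sorted_list_of_set A @ [M + 1]"
    by (rule sorted_insort_is_snoc) (use assms in auto)
  finally show ?thesis by (simp add: wset_def word_snoc)
qed

text \<open>Filling all modes from M down to L passes through the vacua of decreasing
  charge.\<close>

lemma wset_interval: "wset {L..M} M = 1"
proof (cases "L \<le> M + 1")
  case True
  then have "L - 1 \<le> M" by simp
  then show ?thesis
  proof (induction M rule: int_ge_induct)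
    case base
    then show ?case by (simp add: wset_def)
  next
    case (step M)
    have "{L..M + 1} = insert (M + 1) {L..M}" using step.hyps by auto
    then show ?case using wset_extend[of "{L..M}" M] step.IH by auto
  qed
qed (simp add: wset_def)

lemma minus_one_power_square: "(-1) ^ k * (-1) ^ k = (1::complex)"
  by (cases "even k") simp_all

text \<open>Applying the missing modes, which commute with d, completes A to the full interval,
  where the product is a vacuum and the relation reads d = 0.\<close>

lemma wset_torsion_free:
  assumes "d \<in> odd_polys" "finite A" "A \<subseteq> {L..M}" "d * wset A M = 0"
  shows "d = 0"
  using assms(2-)
proof (induction "card ({L..M} - A)" arbitrary: A)
  case 0
  then have "A = {L..M}" by auto
  with 0(4) show ?case by (simp only: wset_interval mult_1_right)
next
  case (Suc k)
  then have "{L..M} - A \<noteq> {}" by (metis card.empty nat.distinct(1))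
  then obtain n where n: "n \<in> {L..M} - A" by blast
  let ?c = "(-1) ^ card {x\<in>A. x < n} :: complex"
  have g: "Gam (M - int (card A)) n (wset A M) = scl ?c (wset (insert n A) M)"
    by (rule Gam_wset_insert) (use n Suc.prems(1) in simp_all)
  have "scl ?c (d * wset (insert n A) M) = d * scl ?c (wset (insert n A) M)"
    by (rule scl_mult_right[symmetric])
  also have "\<dots> = Gam (M - int (card A)) n (d * wset A M)"
    by (simp only: Gam_mult[OF assms(1)] g)
  also have "\<dots> = 0" by (simp only: Suc.prems Gam_zero)
  finally have "scl ?c (scl ?c (d * wset (insert n A) M)) = 0" by (simp only: scl_zero_right)
  then have "d * wset (insert n A) M = 0" by (simp only: scl_scl minus_one_power_square scl_one)
  moreover have "k = card ({L..M} - insert n A)"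
  proof -
    have "{L..M} - insert n A = ({L..M} - A) - {n}" by blast
    with n Suc.hyps(2) show ?thesis by (simp only: card_Diff_singleton)
  qed
  moreover have "finite (insert n A)" "insert n A \<subseteq> {L..M}" using n Suc.prems by auto
  ultimately show ?case using Suc.hyps(1)[of "insert n A"] by blast
qed

text \<open>The infinite set of modes \<open>{n \<le> 0. n \<in> F} \<union> {n > 0. n \<notin> F}\<close>, cut off at \<open>M\<close>, indexes the semi-infinite
  wedge that corresponds to \<open>F\<close>; \<open>fsign\<close> converts its sign convention to the one of \<open>mode_sign\<close>.\<close>

definition modes :: "int fset \<Rightarrow> int \<Rightarrow> int set" where
  "modes F M = {n. n \<le> 0 \<and> n |\<in>| F} \<union> {n. 0 < n \<and> n \<le> M \<and> n |\<notin>| F}"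

definition fsign :: "int fset \<Rightarrow> complex" where
  "fsign F = (\<Prod>n\<in>{n\<in>fset F. 0 < n}. (-1) ^ nat (n - 1))"

definition fbound :: "int fset \<Rightarrow> int" where
  "fbound F = Max (insert 0 (fset F))"

text \<open>Positive modes in F are holes of the semi-infinite wedge and raise the charge;
  nonpositive ones are occupied and lower it. \<open>card_modes\<close> identifies this number with
  the charge reached from the cutoff.\<close>

definition charge :: "int fset \<Rightarrow> int" where
  "charge F = int (card {n\<in>fset F. 0 < n}) - int (card {n\<in>fset F. n \<le> 0})"

definition ebas :: "int fset \<Rightarrow> complex bpoly" where
  "ebas F = scl (fsign F) (wset (modes F (fbound F)) (fbound F))"

lemma fbound_le_iff: "fbound F \<le> M \<longleftrightarrow> 0 \<le> M \<and> (\<forall>n. n |\<in>| F \<longrightarrow> n \<le> M)"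
  by (auto simp: fbound_def)

lemma finite_modes [simp]: "finite (modes F M)"
proof -
  have "modes F M \<subseteq> fset F \<union> {0..M}" by (auto simp: modes_def)
  then show ?thesis by (rule finite_subset) simp
qed

text \<open>Beyond the elements of F every further mode is occupied, and adding it together with a
  larger cutoff changes nothing.\<close>

lemma ebas_eq:
  assumes "fbound F \<le> M" shows "ebas F = scl (fsign F) (wset (modes F M) M)"
  using assms
proof (induction M rule: int_ge_induct)
  case base
  then show ?case by (simp add: ebas_def)
next
  case (step M)
  have M: "0 \<le> M" "\<And>n. n |\<in>| F \<Longrightarrow> n \<le> M" using step.hyps by (auto simp: fbound_le_iff)
  have "modes F (M + 1) = insert (M + 1) (modes F M)"
    using M by (fastforce simp: modes_def)
  moreover have "modes F M \<subseteq> {..M}" using M by (auto simp: modes_def)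
  ultimately show ?case using step.IH wset_extend[of "modes F M" M] by simp
qed

lemma card_modes:
  assumes "fbound F \<le> M" shows "M - int (card (modes F M)) = charge F"
proof -
  have M: "0 \<le> M" "\<And>n. n |\<in>| F \<Longrightarrow> n \<le> M" using assms by (auto simp: fbound_le_iff)
  have "{0<..M} = {n\<in>fset F. 0 < n} \<union> {n. 0 < n \<and> n \<le> M \<and> n |\<notin>| F}" using M by auto
  moreover have fin: "finite {n. 0 < n \<and> n \<le> M \<and> n |\<notin>| F}" by (rule finite_subset[of _ "{0..M}"]) auto
  ultimately have 1: "card {0<..M} = card {n\<in>fset F. 0 < n} + card {n. 0 < n \<and> n \<le> M \<and> n |\<notin>| F}"
    by (simp only:) (rule card_Un_disjoint, auto)
  have "modes F M = {n\<in>fset F. n \<le> 0} \<union> {n. 0 < n \<and> n \<le> M \<and> n |\<notin>| F}"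
    by (auto simp: modes_def)
  also have "card \<dots> = card {n\<in>fset F. n \<le> 0} + card {n. 0 < n \<and> n \<le> M \<and> n |\<notin>| F}"
    by (rule card_Un_disjoint) (use fin in auto)
  finally have 2: "card (modes F M) = card {n\<in>fset F. n \<le> 0} + card {n. 0 < n \<and> n \<le> M \<and> n |\<notin>| F}" .
  have "card {0<..M} = nat M" by simp
  then show ?thesis using M(1) 1 2 unfolding charge_def by linarith
qed

lemma fsign_square: "fsign F * fsign F = 1"
  unfolding fsign_def prod.distrib[symmetric] minus_one_power_square by simp

lemma fsign_finsert_nonpos: "n \<le> 0 \<Longrightarrow> fsign (finsert n F) = fsign F"
  unfolding fsign_def by (rule prod.cong) auto

lemma fsign_remove:
  assumes "0 < n" "n |\<in>| F"
  shows "fsign F = (-1) ^ nat (n - 1) * fsign (F |-| {|n|})"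
proof -
  have "{k\<in>fset F. 0 < k} = insert n {k\<in>fset (F |-| {|n|}). 0 < k}" using assms by auto
  then show ?thesis unfolding fsign_def by simp
qed

definition psi_basis :: "int \<Rightarrow> int fset \<Rightarrow> fock" where
  "psi_basis n F = (if n \<le> 0 then if n |\<in>| F then 0 else single (finsert n F) (mode_sign n F)
     else if n |\<in>| F then single (F |-| {|n|}) (mode_sign n F) else 0)"

lemma psi_eq: "psi n = lin_ext (psi_basis n)"
  by (auto simp: psi_def create_def annihilate_def psi_basis_def[abs_def])

text \<open>Inserting n into the wedge means inserting n into F for n at most 0, but removing it for
  n > 0. Only in the second case do the two sign conventions count different elements below n, and
  \<open>fsign\<close> makes up for the difference.\<close>

lemma Gam_ebas: "Gam (charge F) n (ebas F) = lin_ext ebas (psi_basis n F)"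
proof -
  define M where "M = max (fbound F) n"
  have M: "fbound F \<le> M" "n \<le> M" by (auto simp: M_def)
  have M0: "0 \<le> M" "\<And>k. k |\<in>| F \<Longrightarrow> k \<le> M" using M(1) by (auto simp: fbound_le_iff)
  let ?A = "modes F M"
  have G: "Gam (charge F) n (ebas F) = scl (fsign F) (Gam (M - int (card ?A)) n (wset ?A M))"
    by (simp add: ebas_eq[OF M(1)] card_modes[OF M(1)] Gam_scl)
  show ?thesis
  proof (cases "n \<in> ?A")
    case True
    have "psi_basis n F = 0" using True M by (auto simp: psi_basis_def modes_def)
    then show ?thesis by (simp add: G Gam_wset_mem[OF finite_modes True])
  next
    case False
    note G = G[unfolded Gam_wset_insert[OF finite_modes False]]
    show ?thesis
    proof (cases "n \<le> 0")
      case True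
      with False have n: "n |\<notin>| F" by (auto simp: modes_def)
      have "modes (finsert n F) M = insert n ?A" using True by (auto simp: modes_def)
      moreover have "{x\<in>?A. x < n} = {x\<in>fset F. x < n}" using True by (auto simp: modes_def)
      moreover have "fbound (finsert n F) \<le> M" using M M0 by (auto simp: fbound_le_iff)
      ultimately have "ebas (finsert n F) = scl (fsign F) (wset (insert n ?A) M)"
        and "mode_sign n F = (-1) ^ card {x\<in>?A. x < n}"
        using True by (simp_all only: ebas_eq fsign_finsert_nonpos mode_sign_def)
      then show ?thesis
        using True n by (simp only: G psi_basis_def if_True if_False lin_ext_single scl_scl mult.commute[of "fsign F"])
    next
      case n0: False
      with False M have n: "n |\<in>| F" by (auto simp: modes_def)
      have 1: "modes (F |-| {|n|}) M = insert n ?A" using n0 M by (auto simp: modes_def)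
      have 2: "fbound (F |-| {|n|}) \<le> M" using M0 by (auto simp: fbound_le_iff)
      let ?a = "{x\<in>fset F. x \<le> 0}" and ?b = "{x\<in>fset F. 0 < x \<and> x < n}" and ?c = "{x. 0 < x \<and> x < n \<and> x |\<notin>| F}"
      have fc: "finite ?c" by (rule finite_subset[of _ "{0..n}"]) auto
      have "{x\<in>?A. x < n} = ?a \<union> ?c" using n0 M by (auto simp: modes_def)
      then have "card {x\<in>?A. x < n} = card (?a \<union> ?c)" by (rule arg_cong)
      also have "\<dots> = card ?a + card ?c" using fc by (intro card_Un_disjoint) auto
      finally have c1: "card {x\<in>?A. x < n} = card ?a + card ?c" .
      have "{x\<in>fset F. x < n} = ?a \<union> ?b" using n0 by auto
      then have "card {x\<in>fset F. x < n} = card (?a \<union> ?b)" by (rule arg_cong)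
      also have "\<dots> = card ?a + card ?b" by (intro card_Un_disjoint) auto
      finally have c2: "card {x\<in>fset F. x < n} = card ?a + card ?b" .
      have "{0<..<n} = ?b \<union> ?c" by auto
      then have "card {0<..<n} = card (?b \<union> ?c)" by (rule arg_cong)
      also have "\<dots> = card ?b + card ?c" using fc by (intro card_Un_disjoint) auto
      finally have "card {0<..<n} = card ?b + card ?c" .
      \<comment> \<open>The n - 1 positive modes below n are split by membership in F, so the sign
        (-1)^(n-1) trades one count for the other.\<close>
      then have c3: "nat (n - 1) = card ?b + card ?c" by simp
      have "fsign F * (-1) ^ card {x\<in>?A. x < n} = mode_sign n F * fsign (F |-| {|n|})"
      proof -
        have r: "y * z * f * (x * z) = x * y * f" if "z * z = 1" for x y z f :: complex
        proof -
          have "y * z * f * (x * z) = x * y * f * (z * z)" by (simp only: ac_simps)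
          then show ?thesis by (simp only: that mult_1_right)
        qed
        have "fsign F = (-1) ^ nat (n - 1) * fsign (F |-| {|n|})" using n0 n by (intro fsign_remove) auto
        then show ?thesis
          unfolding mode_sign_def c1 c2 by (simp only: c3 power_add) (rule r[OF minus_one_power_square])
      qed
      then show ?thesis
        using n0 n by (simp only: G psi_basis_def ebas_eq[OF 2] 1 if_True if_False lin_ext_single scl_scl)
    qed
  qed
qed

text \<open>The full charge sector, with mode 0 allowed; \<open>fock_span\<close> is its part
  without mode 0.\<close>

definition Fock :: "int \<Rightarrow> fock set" where
  "Fock m = {v. \<forall>F\<in>keys v. charge F = m}"

lemma Fock_zero [simp]: "0 \<in> Fock m"
  by (simp add: Fock_def)

lemma Fock_add: "v \<in> Fock m \<Longrightarrow> w \<in> Fock m \<Longrightarrow> v + w \<in> Fock m"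
  using Poly_Mapping.keys_add[of v w] by (auto simp: Fock_def)

lemma Fock_scl: "v \<in> Fock m \<Longrightarrow> scl c v \<in> Fock m"
  by (auto simp: Fock_def in_keys_iff)

lemma Fock_sum: "(\<And>x. x \<in> A \<Longrightarrow> f x \<in> Fock m) \<Longrightarrow> sum f A \<in> Fock m"
  by (induction A rule: infinite_finite_induct) (auto intro: Fock_add)

lemma Fock_single: "charge F = m \<Longrightarrow> single F c \<in> Fock m"
  by (auto simp: Fock_def)

lemma Fock_lin_ext: "v \<in> Fock m \<Longrightarrow> (\<And>F. charge F = m \<Longrightarrow> g F \<in> Fock k) \<Longrightarrow> lin_ext g v \<in> Fock k"
  unfolding lin_ext_def by (intro Fock_sum Fock_scl) (auto simp: Fock_def)

lemma charge_finsert: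
  assumes "n |\<notin>| F" shows "charge (finsert n F) = (if n \<le> 0 then charge F - 1 else charge F + 1)"
proof -
  have "{k\<in>fset (finsert n F). 0 < k} = (if n \<le> 0 then {k\<in>fset F. 0 < k} else insert n {k\<in>fset F. 0 < k})"
    "{k\<in>fset (finsert n F). k \<le> 0} = (if n \<le> 0 then insert n {k\<in>fset F. k \<le> 0} else {k\<in>fset F. k \<le> 0})"
    by auto
  then show ?thesis unfolding charge_def using assms by simp
qed

lemma charge_remove:
  assumes "n |\<in>| F" shows "charge (F |-| {|n|}) = (if n \<le> 0 then charge F + 1 else charge F - 1)"
  using charge_finsert[of n "F |-| {|n|}"] assms by (auto simp: finsert_absorb split: if_splits)

lemma psi_Fock: "v \<in> Fock m \<Longrightarrow> psi n v \<in> Fock (m - 1)"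
  unfolding psi_eq
  by (erule Fock_lin_ext) (auto simp: psi_basis_def charge_finsert charge_remove intro!: Fock_single)

definition Emb :: "fock \<Rightarrow> complex bpoly" where
  "Emb = lin_ext ebas"

lemma Gam_Emb:
  assumes "v \<in> Fock m" shows "Gam m n (Emb v) = Emb (psi n v)"
proof -
  have "Gam m n (Emb v) = (\<Sum>F\<in>keys v. scl (lookup v F) (Gam m n (ebas F)))"
    by (simp add: Emb_def lin_ext_def Gam_sum Gam_scl)
  also have "\<dots> = (\<Sum>F\<in>keys v. scl (lookup v F) (lin_ext ebas (psi_basis n F)))"
    using assms by (intro sum.cong refl) (auto simp: Fock_def Gam_ebas[symmetric])
  also have "\<dots> = Emb (psi n v)"
    by (simp add: Emb_def psi_eq lin_ext_def[of "psi_basis n"] lin_ext_sum lin_ext_scl)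
  finally show ?thesis .
qed

text \<open>Induction on the support: a fermion that kills one of two basis vectors, but not the other one,
  separates them.\<close>

lemma ebas_independent:
  assumes "finite S" "\<And>F. F \<in> S \<Longrightarrow> charge F = m" "\<And>F. d F \<in> odd_polys" "(\<Sum>F\<in>S. d F * ebas F) = 0" "F \<in> S"
  shows "d F = 0"
  using assms
proof (induction "card S" arbitrary: S m d F rule: less_induct)
  case less
  show ?case
  proof (cases "S = {F}")
    case True
    have "d F * wset (modes F (fbound F)) (fbound F) = scl (fsign F) (scl (fsign F) (d F * wset (modes F (fbound F)) (fbound F)))"
      by (simp only: scl_scl fsign_square scl_one)
    also have "\<dots> = scl (fsign F) (d F * ebas F)" by (simp add: ebas_def scl_mult_right)
    also have "d F * ebas F = 0" using less.prems(4) True by simp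
    finally have "d F * wset (modes F (fbound F)) (fbound F) = 0" by (simp only: scl_zero_right)
    moreover obtain L where L: "L \<le> 0" "\<And>n. n |\<in>| F \<Longrightarrow> L \<le> n"
    proof
      show "Min (insert 0 (fset F)) \<le> 0" "\<And>n. n |\<in>| F \<Longrightarrow> Min (insert 0 (fset F)) \<le> n"
        by (intro Min_le; simp)+
    qed
    moreover have "modes F (fbound F) \<subseteq> {L..fbound F}"
    proof
      fix x assume "x \<in> modes F (fbound F)"
      then show "x \<in> {L..fbound F}"
        using L(1) L(2)[of x] fbound_le_iff[of F "fbound F"] by (auto simp: modes_def)
    qed
    ultimately show ?thesis by (intro wset_torsion_free[OF less.prems(3)]) auto
  next
    case False
    then obtain F' where F': "F' \<in> S" "F' \<noteq> F" using less.prems(5) by auto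
    define act where "act n G = (if n \<le> 0 then finsert n G else G |-| {|n|})" for n and G :: "int fset"
    define free where "free n G = (if n \<le> 0 then n |\<notin>| G else n |\<in>| G)" for n and G :: "int fset"
    \<comment> \<open>\<open>free n G\<close> says that fermion n does not kill
      \<open>ebas G\<close>. If it kills some G1 in S, its application leaves a relation over fewer
      vectors, in charge m - 1, to which the induction hypothesis applies.\<close>
    have step: "\<forall>G\<in>S. free n G \<longrightarrow> d G = 0" if "G1 \<in> S" "\<not> free n G1" for n G1
    proof -
      define T where "T = {G\<in>S. free n G}"
      have T: "finite T" "T \<subseteq> S" "G1 \<notin> T" using that less.prems(1) by (auto simp: T_def)
      have inj: "inj_on (act n) T"
        by (rule inj_on_inverseI[of _ "\<lambda>G. if n \<le> 0 then G |-| {|n|} else finsert n G"])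
          (auto simp: T_def act_def free_def)
      let ?inv = "the_inv_into T (act n)"
      define d' where "d' G = scl (if G \<in> act n ` T then mode_sign n (?inv G) else 0) (d (?inv G))" for G
      have d'_act: "d' (act n G) = scl (mode_sign n G) (d G)" if "G \<in> T" for G
        using that by (simp add: d'_def the_inv_into_f_f[OF inj])
      have "(\<Sum>G\<in>act n ` T. d' G * ebas G) = (\<Sum>G\<in>T. d' (act n G) * ebas (act n G))"
        by (simp add: sum.reindex[OF inj])
      also have "\<dots> = (\<Sum>G\<in>T. d G * Gam m n (ebas G))"
      proof (intro sum.cong refl)
        fix G assume G: "G \<in> T"
        then have "charge G = m" using less.prems(2) T by auto
        then have "Gam m n (ebas G) = lin_ext ebas (psi_basis n G)" by (simp flip: Gam_ebas)
        also have "\<dots> = scl (mode_sign n G) (ebas (act n G))"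
          using G by (auto simp: psi_basis_def T_def free_def act_def)
        finally show "d' (act n G) * ebas (act n G) = d G * Gam m n (ebas G)"
          by (simp add: d'_act[OF G] scl_mult_left scl_mult_right)
      qed
      also have "\<dots> = (\<Sum>G\<in>S. d G * Gam m n (ebas G))"
      proof (rule sum.mono_neutral_left[OF less.prems(1) T(2)], intro ballI)
        fix G assume G: "G \<in> S - T"
        then have "charge G = m" using less.prems(2) by auto
        then have "Gam m n (ebas G) = lin_ext ebas (psi_basis n G)" by (simp flip: Gam_ebas)
        then show "d G * Gam m n (ebas G) = 0" using G by (auto simp: psi_basis_def T_def free_def)
      qed
      also have "\<dots> = Gam m n (\<Sum>G\<in>S. d G * ebas G)"
        by (simp add: Gam_sum Gam_mult[OF less.prems(3)])
      also have "\<dots> = 0" by (simp add: less.prems(4))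
      finally have sum0: "(\<Sum>G\<in>act n ` T. d' G * ebas G) = 0" .
      have "card (act n ` T) < card S"
        using card_image[OF inj] psubset_card_mono[OF less.prems(1), of T] T that(1) by auto
      moreover have "charge G = m - 1" if "G \<in> act n ` T" for G
        using that less.prems(2)
        by (cases "n \<le> 0") (auto simp: T_def act_def free_def charge_finsert charge_remove)
      moreover have "d' G \<in> odd_polys" for G
        using less.prems(3)[of "?inv G"] by (auto simp: d'_def odd_polys_def in_keys_iff)
      ultimately have "d' (act n G) = 0" if "G \<in> T" for G
        using less.hyps[of "act n ` T" "m - 1" d' "act n G"] T(1) sum0 that by auto
      then have "scl (mode_sign n G) (scl (mode_sign n G) (d G)) = 0" if "G \<in> T" for G
        using that by (simp add: d'_act)
      then show ?thesis by (simp add: T_def)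
    qed
    from F'(2) obtain n where n: "n |\<in>| F \<longleftrightarrow> n |\<notin>| F'" by (metis fset_eqI)
    have dich: "free n F \<longleftrightarrow> \<not> free n F'" using n by (auto simp: free_def)
    show ?thesis
    proof (cases "free n F")
      case True
      then show ?thesis using step[OF F'(1)] dich less.prems(5) by blast
    next
      case nf: False
      with dich have z: "d G = 0" if "G \<in> S" "free n G" for G
        using step[OF less.prems(5) nf] that by blast
      \<comment> \<open>Now n kills F, so by \<open>step\<close> all vectors that it does not kill
        have coefficient zero. Among them is F', so the relation shrinks.\<close>
      define T where "T = {G\<in>S. \<not> free n G}"
      have "T \<subset> S" using F' nf dich by (auto simp: T_def)
      then have "card T < card S" by (rule psubset_card_mono[OF less.prems(1)])
      moreover have "(\<Sum>G\<in>T. d G * ebas G) = (\<Sum>G\<in>S. d G * ebas G)"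
        using z less.prems(1) by (intro sum.mono_neutral_left) (auto simp: T_def)
      ultimately show ?thesis
        using less.hyps[of T m d F] less.prems nf by (auto simp: T_def)
    qed
  qed
qed

section \<open>Bosonic monomials times the fermionic basis\<close>

text \<open>Everything is generated from the vacua: with \<open>G\<^sub>n = x\<^sub>2\<^sub>n\<^sup>-\<close> one has \<open>g\<^sub>k G\<^sub>n = G\<^sub>n g\<^sub>k + g\<^sub>k\<^sub>-\<^sub>1 G\<^sub>n\<^sub>-\<^sub>1\<close>, and
  \<open>g\<^sub>k\<close> in charge \<open>m\<close> is \<open>G\<^sub>m\<^sub>+\<^sub>1\<^sub>-\<^sub>k 1\<close>.\<close>

inductive generated :: "int \<Rightarrow> complex bpoly \<Rightarrow> bool" where
  generated_one: "generated m 1"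
| generated_Op: "generated m P \<Longrightarrow> generated (m - 1) (special.Op gseq (m - n) P)"
| generated_add: "generated m P \<Longrightarrow> generated m Q \<Longrightarrow> generated m (P + Q)"
| generated_mult: "generated m P \<Longrightarrow> d \<in> odd_polys \<Longrightarrow> generated m (d * P)"

lemma Op_gseq_mult:
  "special.Op gseq a (gseq k * P) = gseq k * special.Op gseq a P - gseq (k - 1) * special.Op gseq (a + 1) P"
proof -
  obtain N where N: "special.vanish N P" using special.vanish_ex by blast
  note * = special.Op_shifted_mult[OF shifted_gseq N, where k = k]
  have "special.Op gseq a (gseq k * P) = (\<Sum>l\<le>N+2. gseq (int l + a) * sigma l (gseq k * P))"
    by (rule special.Op_eq[OF *(1)])
  also have "\<dots> = (\<Sum>r\<le>N. (gseq (int r + a) * gseq k + - 1 * gseq (int (r + 1) + a) * gseq (k - 1)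
      + 0 * gseq (int (r + 2) + a) * gseq (k - 2)) * sigma r P)"
    by (rule *(2)[of "\<lambda>l. gseq (int l + a)"])
  also have "\<dots> = (\<Sum>r\<le>N. gseq k * (gseq (int r + a) * sigma r P)
      - gseq (k - 1) * (gseq (int r + (a + 1)) * sigma r P))"
    by (intro sum.cong refl) (simp add: algebra_simps)
  also have "\<dots> = gseq k * special.Op gseq a P - gseq (k - 1) * special.Op gseq (a + 1) P"
    by (simp add: special.Op_eq[OF N] sum_subtractf sum_distrib_left)
  finally show ?thesis .
qed

lemma zero_odd_polys: "0 \<in> odd_polys"
  by (simp add: odd_polys_def)

lemma generated_zero: "generated m 0"
  using generated_mult[OF generated_one zero_odd_polys] by simp

lemma generated_gseq:
  assumes "generated m P" shows "generated m (gseq k * P)"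
  using assms
proof (induction arbitrary: k rule: generated.induct)
  case (generated_one m)
  \<comment> \<open>The vacuum of charge m + 1 is used: a mode applied to \<open>1\<close> is its
    own creation coefficient.\<close>
  have "generated (m + 1 - 1) (special.Op gseq (m + 1 - (m + 1 - k)) 1)"
    by (rule generated_Op[OF generated.generated_one])
  then show ?case by (simp add: special.Op_1 invariant_one)
next
  case (generated_Op m P n)
  \<comment> \<open>Commuting g_j past a mode leaves g_(j-1) times a neighbouring mode, so n has to
    stay arbitrary in this inner induction.\<close>
  have "generated (m - 1) (gseq (int j) * special.Op gseq (m - n) P)" for j n
  proof (induction j arbitrary: n)
    case 0
    then show ?case using generated.generated_Op[OF generated_Op.hyps] by simp
  next
    case (Suc j)
    have "gseq (int (Suc j)) * special.Op gseq (m - n) P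
        = special.Op gseq (m - n) (gseq (int (Suc j)) * P) + gseq (int j) * special.Op gseq (m - (n - 1)) P"
      using Op_gseq_mult[of "m - n" "int (Suc j)" P] by (simp add: algebra_simps)
    then show ?case
      using generated.generated_Op[OF generated_Op.IH] Suc.IH[of "n - 1"] by (simp only: generated_add)
  qed
  then show ?case
    by (cases "k < 0") (simp_all add: generated_zero, metis int_nat_eq not_less)
next
  case (generated_add m P Q)
  then show ?case by (simp add: distrib_left generated.generated_add)
next
  case (generated_mult m P d)
  then show ?case by (simp add: mult.left_commute[of _ d] generated.generated_mult)
qed

lemma generated_sum: "(\<And>x. x \<in> A \<Longrightarrow> generated m (f x)) \<Longrightarrow> generated m (sum f A)"
  by (induction A rule: infinite_finite_induct) (auto intro: generated_zero generated_add)

lemma const_odd_polys: "single 0 c \<in> odd_polys"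
  by (rule odd_polys_single) simp

lemma generated_scl: "generated m P \<Longrightarrow> generated m (scl c P)"
  by (simp add: scl_conv_mult generated_mult const_odd_polys)

lemma eta_odd_polys: "eta k \<in> odd_polys"
  using eta_invariant invariant_iff by blast

lemma generated_ebar:
  assumes "generated m P" shows "generated m (ebar k * P)"
proof (cases "even k")
  case True
  then obtain j where "k = 2 * j" by blast
  then show ?thesis using generated_gseq[OF assms, of j] by (simp add: gseq_def)
next
  case False
  then obtain j where j: "k = 2 * j + 1" by (elim oddE)
  have "oseq j * P = (\<Sum>i\<le>nat j. eta i * (gseq (j - int i) * P))"
    using oseq_eta[of j "nat j"] by (simp add: sum_distrib_right mult.assoc)
  moreover have "generated m (\<Sum>i\<le>nat j. eta i * (gseq (j - int i) * P))"
    by (intro generated_sum generated_mult generated_gseq assms eta_odd_polys)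
  ultimately show ?thesis using j by (simp add: oseq_def)
qed

lemma ebar_weight:
  "scl (of_nat k) (ebar (int k)) = - (\<Sum>n\<in>{1..k}. scl (\<i> ^ n) (bvar n * ebar (int k - int n)))"
proof -
  have "specialize (scl (of_nat k) (e_coeff (int k)))
      = - (\<Sum>n\<in>{1..k}. scl (\<i> ^ n) (bvar n * ebar (int k - int n)))"
    by (simp add: e_coeff_weight specialize_minus specialize_sum specialize_scl specialize_mult
        specialize_bvar eval_i_qpow ebar_def)
  then show ?thesis by (simp add: specialize_scl eval_i_of_nat ebar_def)
qed

lemma ebar_0 [simp]: "ebar 0 = 1"
  by (simp add: ebar_def)

text \<open>In the recursion \<open>ebar_weight\<close> the last term is \<open>bvar n\<close> with
  the invertible coefficient i^n, while the other terms contain smaller variables; solving for it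
  gives the induction.\<close>

lemma generated_bvar:
  "generated m P \<Longrightarrow> 0 < n \<Longrightarrow> generated m (bvar n * P)"
proof (induction n arbitrary: P rule: less_induct)
  case (less n)
  let ?h = "\<lambda>k. scl (\<i> ^ k) (bvar k * (ebar (int n - int k) * P))"
  have "generated m (?h k)" if "k \<in> {1..<n}" for k
  proof -
    have "k < n" "0 < k" using that by auto
    then show ?thesis by (intro generated_scl less.IH generated_ebar less.prems(1))
  qed
  then have "generated m (\<Sum>k\<in>{1..<n}. ?h k)" by (rule generated_sum)
  then have g: "generated m (scl (- 1 / \<i> ^ n) (scl (of_nat n) (ebar (int n) * P) + (\<Sum>k\<in>{1..<n}. ?h k)))"
    by (intro generated_scl generated_add generated_ebar less.prems(1))
  have "scl (of_nat n) (ebar (int n) * P) = - (\<Sum>k\<in>{1..n}. ?h k)"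
    unfolding scl_mult_left[symmetric] ebar_weight
    by (simp add: sum_distrib_right scl_mult_left mult.assoc)
  also have "{1..n} = insert n {1..<n}" using less.prems(2) by auto
  also have "(\<Sum>k\<in>insert n {1..<n}. ?h k) = scl (\<i> ^ n) (bvar n * P) + (\<Sum>k\<in>{1..<n}. ?h k)"
    by simp
  finally have "scl (of_nat n) (ebar (int n) * P) + (\<Sum>k\<in>{1..<n}. ?h k) = - scl (\<i> ^ n) (bvar n * P)"
    by simp
  then have "scl (- 1 / \<i> ^ n) (scl (of_nat n) (ebar (int n) * P) + (\<Sum>k\<in>{1..<n}. ?h k))
      = scl (- 1 / \<i> ^ n) (scl (- (\<i> ^ n)) (bvar n * P))"
    by (simp only: scl_neg_left)
  also have "\<dots> = bvar n * P" by simp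
  finally show ?case using g by (simp only:)
qed

lemma single_remove:
  fixes \<mu> :: "nat \<Rightarrow>\<^sub>0 nat"
  assumes "lookup \<mu> k \<noteq> 0"
  shows "single k 1 + (\<mu> - single k 1) = \<mu>"
  using assms by (intro poly_mapping_eqI) (auto simp: lookup_add lookup_minus lookup_single when_def)

lemma generated_single: "generated m (single \<mu> c)"
proof (induction "nat (monom_wt \<mu>)" arbitrary: \<mu> rule: less_induct)
  case less
  show ?case
  proof (cases "\<mu> = 0")
    case True
    have "generated m (single 0 c * 1)"
      by (rule generated_mult[OF generated_one const_odd_polys])
    with True show ?thesis by simp
  next
    case False
    then obtain k where k: "lookup \<mu> k \<noteq> 0"
      by (metis poly_mapping_eqI lookup_zero)
    let ?\<nu> = "\<mu> - single k 1"
    have "nat (monom_wt ?\<nu>) < nat (monom_wt \<mu>)"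
      using monom_wt_minus[OF k] monom_wt_nonneg[of ?\<nu>] by linarith
    then have "generated m (bvar (Suc k) * single ?\<nu> c)"
      by (intro generated_bvar less) auto
    moreover have "bvar (Suc k) * single ?\<nu> c = single \<mu> c"
      using single_remove[OF k] by (simp add: bvar_def mult_single)
    ultimately show ?thesis by simp
  qed
qed

lemma generated_all: "generated m P"
proof -
  have "generated m (\<Sum>\<mu>\<in>keys P. single \<mu> (lookup P \<mu>))"
    by (intro generated_sum generated_single)
  then show ?thesis by (simp only: expand_singles[symmetric])
qed

section \<open>The multiplication map from \<open>D\<close> tensored with fermions to bosons\<close>

definition oddm :: "(nat \<Rightarrow>\<^sub>0 nat) \<Rightarrow> bool" where
  "oddm \<mu> \<longleftrightarrow> (\<forall>k. odd k \<longrightarrow> lookup \<mu> k = 0)"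

lemma oddm_zero [simp]: "oddm 0"
  by (simp add: oddm_def)

lemma oddm_add: "oddm \<mu> \<Longrightarrow> oddm \<nu> \<Longrightarrow> oddm (\<mu> + \<nu>)"
  by (simp add: oddm_def lookup_add)

text \<open>\<open>D\<close> tensored with \<open>Fock m\<close>: a Fock vector for each monomial of
  \<open>D\<close>. This encoding makes the action of \<open>D\<close> a shift of exponents and lets
  fermionic operators act coefficientwise.\<close>

definition Y_space :: "int \<Rightarrow> ((nat \<Rightarrow>\<^sub>0 nat) \<Rightarrow>\<^sub>0 fock) set" where
  "Y_space m = {y. \<forall>\<mu>. lookup y \<mu> \<in> Fock m \<and> (lookup y \<mu> \<noteq> 0 \<longrightarrow> oddm \<mu>)}"

definition Psi :: "((nat \<Rightarrow>\<^sub>0 nat) \<Rightarrow>\<^sub>0 fock) \<Rightarrow> complex bpoly" where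
  "Psi y = (\<Sum>\<mu>\<in>keys y. single \<mu> 1 * Emb (lookup y \<mu>))"

lemma Emb_add: "Emb (v + w) = Emb v + Emb w"
  and Emb_zero [simp]: "Emb 0 = 0"
  and Emb_scl: "Emb (scl c v) = scl c (Emb v)"
  by (simp_all add: Emb_def lin_ext_add lin_ext_scl)

lemma Psi_superset:
  assumes "finite K" "keys y \<subseteq> K"
  shows "Psi y = (\<Sum>\<mu>\<in>K. single \<mu> 1 * Emb (lookup y \<mu>))"
  unfolding Psi_def by (rule sum.mono_neutral_left) (use assms in \<open>auto simp: in_keys_iff\<close>)

lemma Psi_add: "Psi (y + z) = Psi y + Psi z"
proof -
  let ?K = "keys y \<union> keys z"
  have "Psi x = (\<Sum>\<mu>\<in>?K. single \<mu> 1 * Emb (lookup x \<mu>))"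
    if "x \<in> {y, z, y + z}" for x
    by (rule Psi_superset) (use that Poly_Mapping.keys_add[of y z] in auto)
  then show ?thesis by (simp add: lookup_add Emb_add distrib_left sum.distrib)
qed

lemma Psi_single: "Psi (single \<mu> v) = single \<mu> 1 * Emb v"
  by (subst Psi_superset[of "{\<mu>}"]) (auto simp: lookup_single)

lemma Psi_zero [simp]: "Psi 0 = 0"
  by (simp add: Psi_def)

lemma Psi_sum: "Psi (sum f A) = (\<Sum>x\<in>A. Psi (f x))"
  by (induction A rule: infinite_finite_induct) (simp_all add: Psi_add)

lemma lookup_map_zero:
  "f 0 = 0 \<Longrightarrow> lookup (Poly_Mapping.map f y) \<mu> = f (lookup y \<mu>)"
  by (simp add: Poly_Mapping.map.rep_eq when_def)

lemma Psi_scl: "Psi (Poly_Mapping.map (scl c) y) = scl c (Psi y)"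
proof -
  have "Psi (Poly_Mapping.map (scl c) y)
      = (\<Sum>\<mu>\<in>keys y. single \<mu> 1 * Emb (lookup (Poly_Mapping.map (scl c) y) \<mu>))"
    by (rule Psi_superset) (auto simp: in_keys_iff lookup_map_zero)
  also have "\<dots> = scl c (Psi y)"
    by (simp add: lookup_map_zero Psi_def scl_sum Emb_scl scl_mult_right)
  finally show ?thesis .
qed

lemma Y_space_zero [simp]: "0 \<in> Y_space m"
  by (simp add: Y_space_def)

lemma Y_space_add: "y \<in> Y_space m \<Longrightarrow> z \<in> Y_space m \<Longrightarrow> y + z \<in> Y_space m"
  by (auto simp: Y_space_def lookup_add Fock_add) (metis add.right_neutral add.left_neutral)

lemma Y_space_sum: "(\<And>x. x \<in> A \<Longrightarrow> f x \<in> Y_space m) \<Longrightarrow> sum f A \<in> Y_space m"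
  by (induction A rule: infinite_finite_induct) (auto intro: Y_space_add)

lemma Y_space_single: "v \<in> Fock m \<Longrightarrow> oddm \<mu> \<Longrightarrow> single \<mu> v \<in> Y_space m"
  by (simp add: Y_space_def lookup_single when_def)

lemma Y_space_map:
  assumes "y \<in> Y_space m" "f 0 = 0" "\<And>v. v \<in> Fock m \<Longrightarrow> f v \<in> Fock k"
  shows "Poly_Mapping.map f y \<in> Y_space k"
  using assms by (auto simp: Y_space_def lookup_map_zero) metis

lemma psi_zero [simp]: "psi n 0 = 0"
  by (simp add: psi_eq)

lemma odd_polys_monomial: "oddm \<mu> \<Longrightarrow> single \<mu> c \<in> odd_polys"
  by (rule odd_polys_single) (simp add: oddm_def)

lemma Gam_Psi:
  assumes "y \<in> Y_space m"
  shows "Gam m n (Psi y) = Psi (Poly_Mapping.map (psi n) y)"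
proof -
  have "Gam m n (Psi y) = (\<Sum>\<mu>\<in>keys y. Gam m n (single \<mu> 1 * Emb (lookup y \<mu>)))"
    by (simp add: Psi_def Gam_sum)
  also have "\<dots> = (\<Sum>\<mu>\<in>keys y. single \<mu> 1 * Emb (lookup (Poly_Mapping.map (psi n) y) \<mu>))"
  proof (intro sum.cong refl)
    fix \<mu> assume "\<mu> \<in> keys y"
    then have "oddm \<mu>" "lookup y \<mu> \<in> Fock m" using assms by (auto simp: Y_space_def in_keys_iff)
    then show "Gam m n (single \<mu> 1 * Emb (lookup y \<mu>))
        = single \<mu> 1 * Emb (lookup (Poly_Mapping.map (psi n) y) \<mu>)"
      by (simp add: Gam_mult odd_polys_monomial Gam_Emb lookup_map_zero)
  qed
  also have "\<dots> = Psi (Poly_Mapping.map (psi n) y)"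
    by (rule Psi_superset[symmetric]) (auto simp: in_keys_iff lookup_map_zero)
  finally show ?thesis .
qed

abbreviation "Psi_image m \<equiv> Psi ` Y_space m"

lemma Psi_image_add: "P \<in> Psi_image m \<Longrightarrow> Q \<in> Psi_image m \<Longrightarrow> P + Q \<in> Psi_image m"
  by (auto simp flip: Psi_add intro: Y_space_add)

lemma Psi_image_zero [simp]: "0 \<in> Psi_image m"
  by (rule image_eqI[of _ _ 0]) simp_all

lemma Psi_image_sum: "(\<And>x. x \<in> A \<Longrightarrow> f x \<in> Psi_image m) \<Longrightarrow> sum f A \<in> Psi_image m"
  by (induction A rule: infinite_finite_induct) (auto intro: Psi_image_add)

lemma Psi_image_Gam: "P \<in> Psi_image m \<Longrightarrow> Gam m n P \<in> Psi_image (m - 1)"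
  by (auto simp: Gam_Psi intro!: imageI Y_space_map psi_Fock)

lemma Psi_image_mult:
  assumes "P \<in> Psi_image m" "d \<in> odd_polys" shows "d * P \<in> Psi_image m"
proof -
  obtain y where y: "y \<in> Y_space m" "P = Psi y" using assms(1) by auto
  have "single \<nu> c * (single \<mu> 1 * Emb (lookup y \<mu>)) \<in> Psi_image m"
    if "\<nu> \<in> keys d" "\<mu> \<in> keys y" for \<nu> \<mu> c
  proof -
    have "oddm \<nu>" using assms(2) that(1) by (auto simp: odd_polys_def oddm_def)
    moreover have "oddm \<mu>" "lookup y \<mu> \<in> Fock m"
      using y(1) that(2) by (auto simp: Y_space_def in_keys_iff)
    ultimately have "single (\<nu> + \<mu>) (scl c (lookup y \<mu>)) \<in> Y_space m"
      by (intro Y_space_single oddm_add Fock_scl)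
    moreover have "Psi (single (\<nu> + \<mu>) (scl c (lookup y \<mu>)))
        = single \<nu> c * (single \<mu> 1 * Emb (lookup y \<mu>))"
      unfolding Psi_single Emb_scl scl_mult_right scl_mult_left[symmetric] mult.assoc[symmetric] mult_single
      by simp
    ultimately show ?thesis by (metis imageI)
  qed
  then have "(\<Sum>\<nu>\<in>keys d. single \<nu> (lookup d \<nu>)) * P \<in> Psi_image m"
    unfolding y(2) Psi_def[of y] sum_product by (intro Psi_image_sum)
  then show ?thesis using expand_singles[of d] by simp
qed

lemma Psi_image_ebas: "ebas F \<in> Psi_image (charge F)"
proof (rule image_eqI)
  show "ebas F = Psi (single 0 (single F 1))"
    by (simp add: Psi_single Emb_def)
  show "single 0 (single F 1) \<in> Y_space (charge F)"
    by (intro Y_space_single Fock_single) auto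
qed

text \<open>For charge k at least 0, F = {1..k} with cutoff k has no occupied modes, so its basis
  vector is the vacuum up to sign. Negative charges follow because fermion m sends the vacuum of
  charge m to that of charge m - 1.\<close>

lemma Psi_image_one: "1 \<in> Psi_image m"
proof -
  have pos: "1 \<in> Psi_image (int k)" for k
  proof -
    define F where "F = fset_of_list [1..int k]"
    have F: "fset F = {1..int k}" by (simp add: F_def fset_of_list.rep_eq)
    have "fbound F \<le> int k" using F by (auto simp: fbound_le_iff)
    moreover have "modes F (int k) = {}" using F by (auto simp: modes_def)
    ultimately have "ebas F = scl (fsign F) 1"
      by (simp add: ebas_eq[of _ "int k"] wset_def)
    then have "single 0 (fsign F) * ebas F = scl (fsign F * fsign F) 1"
      by (simp only: scl_conv_mult[symmetric] scl_scl)
    then have "single 0 (fsign F) * ebas F = 1" unfolding fsign_square scl_one .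
    moreover have "charge F = int k"
    proof -
      have "{n\<in>fset F. 0 < n} = {1..int k}" "{n\<in>fset F. n \<le> 0} = {}" unfolding F by auto
      then show ?thesis unfolding charge_def by (simp only:) simp
    qed
    ultimately show ?thesis
      using Psi_image_mult[OF Psi_image_ebas const_odd_polys, of "fsign F" F] by simp
  qed
  show ?thesis
  proof (cases "0 \<le> m")
    case True
    then show ?thesis using pos[of "nat m"] by simp
  next
    case False
    then have "m \<le> 0" by simp
    then show ?thesis
    proof (induction m rule: int_le_induct)
      case base
      show ?case using pos[of 0] by simp
    next
      case (step m)
      then show ?case using Psi_image_Gam[of 1 m m] by (simp add: Gam_one_diag)
    qed
  qed
qed

text \<open>Inverts the unitriangular change of fermions. The corrections to mode n < 0 involve odd
  modes, which expand by \<open>eta\<close> into even modes i - t with t < -n; these are larger than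
  n and covered by the induction.\<close>

lemma Psi_image_Op: "P \<in> Psi_image m \<Longrightarrow> special.Op gseq (m - n) P \<in> Psi_image (m - 1)"
proof (induction "nat (- n)" arbitrary: n rule: less_induct)
  case less
  let ?k = "nat (- n)"
  have "special.Op oseq (m + int t) P \<in> Psi_image (m - 1)" if t: "t < ?k" for t
  proof -
    obtain N where N: "special.vanish N P" using special.vanish_ex by blast
    obtain K where K: "int N + m + int t \<le> int K" by (metis int_nat_eq linear nat_le_iff)
    have "special.Op oseq (m + int t) P = special.Op (\<lambda>k. \<Sum>i\<le>K. eta i * gseq (k + (- int i))) (m + int t) P"
    proof -
      have "oseq (int l + (m + int t)) = (\<Sum>i\<le>K. eta i * gseq (int l + (m + int t) + (- int i)))" if "l \<le> N" for l
        using oseq_eta[of "int l + (m + int t)" K] K that by simp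
      then show ?thesis unfolding special.Op_eq[OF N] by (intro sum.cong refl) auto
    qed
    also have "\<dots> = (\<Sum>i\<le>K. eta i * special.Op gseq (m + int t + (- int i)) P)"
      unfolding special.Op_seq_sum special.Op_seq_mult
      by (intro sum.cong refl arg_cong[of _ _ "(*) _"]) (rule special.Op_seq_shift)
    also have "\<dots> \<in> Psi_image (m - 1)"
    proof (intro Psi_image_sum Psi_image_mult eta_odd_polys)
      fix i
      have "nat (- (int i - int t)) < ?k" using t by linarith
      then have "special.Op gseq (m - (int i - int t)) P \<in> Psi_image (m - 1)"
        by (intro less)
      then show "special.Op gseq (m + int t + - int i) P \<in> Psi_image (m - 1)" by (simp add: algebra_simps)
    qed
    finally show ?thesis .
  qed
  then have "(\<Sum>t<?k. eta (?k - 1 - t) * special.Op oseq (m + int t) P) \<in> Psi_image (m - 1)"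
    by (intro Psi_image_sum Psi_image_mult eta_odd_polys) auto
  moreover have "special.Op gseq (m - n) P = Gam m n P + (\<Sum>t<?k. eta (?k - 1 - t) * special.Op oseq (m + int t) P)"
  proof -
    have "Gam m n P = special.Op (\<lambda>k. gseq (k + (- n))) m P
        - special.Op (\<lambda>k. \<Sum>t<?k. eta (?k - 1 - t) * oseq (k + int t)) m P"
      unfolding Gam_def sq_def[abs_def] special.Op_seq_diff by simp
    also have "special.Op (\<lambda>k. gseq (k + (- n))) m P = special.Op gseq (m - n) P"
      by (simp only: special.Op_seq_shift) simp
    also have "special.Op (\<lambda>k. \<Sum>t<?k. eta (?k - 1 - t) * oseq (k + int t)) m P
        = (\<Sum>t<?k. eta (?k - 1 - t) * special.Op oseq (m + int t) P)"
      unfolding special.Op_seq_sum special.Op_seq_mult special.Op_seq_shift ..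
    finally show ?thesis by simp
  qed
  ultimately show ?case using Psi_image_Gam[OF less.prems, of n] Psi_image_add by simp
qed

lemma Psi_surj: "P \<in> Psi_image m"
  using generated_all[of m P]
  by (induction rule: generated.induct)
    (simp_all only: Psi_image_one Psi_image_Op Psi_image_add Psi_image_mult)

text \<open>Collecting by F instead of by monomial turns y into coefficients in \<open>D\<close> of
  the vectors \<open>ebas F\<close>, which are independent.\<close>

lemma Psi_eq_zero:
  assumes y: "y \<in> Y_space m" and z: "Psi y = 0" shows "y = 0"
proof -
  define S where "S = (\<Union>\<mu>\<in>keys y. keys (lookup y \<mu>))"
  define d where "d F = (\<Sum>\<mu>\<in>keys y. single \<mu> (lookup (lookup y \<mu>) F))" for F
  have fin: "finite S" by (simp add: S_def)
  have "Psi y = (\<Sum>\<mu>\<in>keys y. \<Sum>F\<in>S. single \<mu> (lookup (lookup y \<mu>) F) * ebas F)"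
    unfolding Psi_def Emb_def
  proof (intro sum.cong refl)
    fix \<mu> assume "\<mu> \<in> keys y"
    then have "keys (lookup y \<mu>) \<subseteq> S" by (auto simp: S_def)
    from lin_ext_superset[OF fin this, of ebas]
    show "single \<mu> 1 * lin_ext ebas (lookup y \<mu>)
        = (\<Sum>F\<in>S. single \<mu> (lookup (lookup y \<mu>) F) * ebas F)"
      by (simp add: sum_distrib_left scl_conv_mult mult_single flip: mult.assoc)
  qed
  also have "\<dots> = (\<Sum>F\<in>S. d F * ebas F)"
    unfolding d_def sum_distrib_right by (rule sum.swap)
  finally have sum0: "(\<Sum>F\<in>S. d F * ebas F) = 0" using z by simp
  have lk: "lookup (d F) \<mu> = lookup (lookup y \<mu>) F" for F \<mu>
    by (simp add: d_def lookup_sum lookup_single when_def in_keys_iff)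
  have "d F \<in> odd_polys" for F
    using y by (auto simp: odd_polys_def in_keys_iff lk Y_space_def oddm_def) (metis lookup_zero)
  moreover have "charge F = m" if "F \<in> S" for F
    using y that by (auto simp: S_def Y_space_def Fock_def)
  ultimately have d0: "d F = 0" if "F \<in> S" for F
    using ebas_independent[OF fin _ _ sum0 that] by blast
  show "y = 0"
  proof (rule poly_mapping_eqI, rule poly_mapping_eqI)
    fix \<mu> F
    show "lookup (lookup y \<mu>) F = lookup (lookup 0 \<mu>) F"
    proof (cases "F \<in> S")
      case True
      then show ?thesis using d0 lk[of F \<mu>] by simp
    next
      case False
      then show ?thesis by (cases "\<mu> \<in> keys y") (auto simp: S_def in_keys_iff)
    qed
  qed
qed

section \<open>The relations in fermionic form\<close>

lemma psi_add: "psi n (v + w) = psi n v + psi n w"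
  and psi_scl: "psi n (scl c v) = scl c (psi n v)"
  by (simp_all add: psi_eq lin_ext_add lin_ext_scl)

lemma psi_sum: "psi n (sum f A) = (\<Sum>x\<in>A. psi n (f x))"
  by (simp add: psi_eq lin_ext_sum)

lemma psi_minus: "psi n (- v) = - psi n v"
  using psi_add[of n "- v" v] by (simp add: eq_neg_iff_add_eq_0)

lemma omega_eq:
  assumes "\<And>n. int K < n \<Longrightarrow> psi n v = 0"
  shows "omega v = - (\<Sum>n\<in>{1..K}. psi (- int n) (psi (int n) v))"
proof -
  have "(\<Sum>n | 1 \<le> n \<and> psi n v \<noteq> 0. psi (- n) (psi n v)) = (\<Sum>n\<in>{1..int K}. psi (- n) (psi n v))"
    by (rule sum.mono_neutral_left) (use assms in \<open>auto simp: not_less[symmetric]\<close>)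
  also have "\<dots> = (\<Sum>n\<in>{1..K}. psi (- int n) (psi (int n) v))"
    by (rule sum.reindex_bij_witness[of _ int nat]) auto
  finally show ?thesis by (simp add: omega_def)
qed

lemma psi_bound: "\<exists>K. \<forall>n>int K. psi n v = 0"
proof -
  obtain K where K: "\<forall>n\<in>{n. 1 \<le> n \<and> psi n v \<noteq> 0}. n \<le> K"
    using finite_psi_nonzero[of v] by (meson Max_ge)
  then have "\<forall>n>int (nat K). psi n v = 0" by (smt (verit) mem_Collect_eq int_nat_eq)
  then show ?thesis ..
qed

lemma psi_bound_finite:
  assumes "finite A" shows "\<exists>K. \<forall>v\<in>A. \<forall>n>int K. psi n v = 0"
  using assms
proof induction
  case (insert v A)
  then obtain K where K: "\<forall>v\<in>A. \<forall>n>int K. psi n v = 0" by blast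
  obtain L where L: "\<forall>n>int L. psi n v = 0" using psi_bound by blast
  have "\<forall>w\<in>insert v A. \<forall>n>int (max K L). psi n w = 0" using K L by auto
  then show ?case by blast
qed simp

lemma omega_add: "omega (v + w) = omega v + omega w"
proof -
  have "finite {v, w, v + w}" by simp
  from psi_bound_finite[OF this] obtain K where K: "\<forall>u\<in>{v, w, v + w}. \<forall>n>int K. psi n u = 0" by (elim exE)
  have "omega u = - (\<Sum>n\<in>{1..K}. psi (- int n) (psi (int n) u))" if "u \<in> {v, w, v + w}" for u
    by (rule omega_eq) (use K that in blast)
  then show ?thesis by (simp add: psi_add sum.distrib)
qed

lemma omega_scl: "omega (scl c v) = scl c (omega v)"
proof -
  have "finite {v, scl c v}" by simp
  from psi_bound_finite[OF this] obtain K where K: "\<forall>u\<in>{v, scl c v}. \<forall>n>int K. psi n u = 0" by (elim exE)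
  have "omega u = - (\<Sum>n\<in>{1..K}. psi (- int n) (psi (int n) u))" if "u \<in> {v, scl c v}" for u
    by (rule omega_eq) (use K that in blast)
  then show ?thesis
    by (simp add: psi_scl scl_sum scl_neg_right)
qed

lemma omega_zero [simp]: "omega 0 = 0"
  by (simp add: omega_def)

lemma Fock_minus: "v \<in> Fock m \<Longrightarrow> - v \<in> Fock m"
  by (auto simp: Fock_def in_keys_iff)

lemma omega_Fock:
  assumes "v \<in> Fock (m + 2)" shows "omega v \<in> Fock m"
proof -
  have "psi (- n) (psi n v) \<in> Fock m" for n
    using psi_Fock[OF psi_Fock[OF assms]] by (simp add: algebra_simps)
  then show ?thesis unfolding omega_def by (intro Fock_minus Fock_sum)
qed

definition fock_relations :: "int \<Rightarrow> fock set" where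
  "fock_relations m = {psi 0 a + omega b | a b. a \<in> Fock (m + 1) \<and> b \<in> Fock (m + 2)}"

lemma fock_relations_Fock: "fock_relations m \<subseteq> Fock m"
  using psi_Fock[of _ "m + 1" 0] by (auto simp: fock_relations_def intro!: Fock_add omega_Fock)

lemma xbar_Psi: "y \<in> Y_space m \<Longrightarrow> xbar m (Psi y) = Psi (Poly_Mapping.map (psi 0) y)"
  by (simp add: xbar_eq Gam_Psi)

text \<open>The scalar -i combines the factor i from q with the minus sign in
  \<open>omega\<close>.\<close>

lemma xbar_div2_Psi:
  assumes y: "y \<in> Y_space (m + 2)"
  shows "xbar_div2 (m + 2) (Psi y) = Psi (Poly_Mapping.map (\<lambda>v. scl (- \<i>) (omega v)) y)"
proof -
  obtain N where N: "special.vanish N (Psi y)" using special.vanish_ex by blast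
  obtain L where L: "\<forall>v\<in>lookup y ` keys y. \<forall>n>int L. psi n v = 0"
    using psi_bound_finite[of "lookup y ` keys y"] by auto
  \<comment> \<open>K has to serve two truncations: the telescoped bosonic sum and
    \<open>omega\<close> on all coefficients of y.\<close>
  define K where "K = max L (nat (int N + (m + 2) + 1))"
  have K: "int N + (m + 2) < int K" "L \<le> K" unfolding K_def by linarith+
  have om: "omega (lookup y \<mu>)
      = - (\<Sum>n\<in>{1..K}. psi (- int n) (psi (int n) (lookup y \<mu>)))" for \<mu>
  proof (rule omega_eq)
    fix n assume "int K < n"
    then show "psi n (lookup y \<mu>) = 0"
      using L K(2) by (cases "\<mu> \<in> keys y") (auto simp: in_keys_iff)
  qed
  have "xbar_div2 (m + 2) (Psi y) = scl \<i> (\<Sum>n\<in>{1..K}. Gam (m + 1) (- int n) (Gam (m + 2) (int n) (Psi y)))"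
  proof -
    have "m + 2 - 1 = m + 1" by simp
    then show ?thesis by (simp only: xbar_div2_eq[OF N K(1)])
  qed
  also have "\<dots> = scl \<i> (\<Sum>n\<in>{1..K}. Psi (Poly_Mapping.map (psi (- int n)) (Poly_Mapping.map (psi (int n)) y)))"
  proof (intro arg_cong[of _ _ "scl \<i>"] sum.cong refl)
    fix n
    have "Poly_Mapping.map (psi (int n)) y \<in> Y_space (m + 1)"
      by (rule Y_space_map[OF y]) (use psi_Fock[of _ "m + 2" "int n"] in \<open>simp_all add: algebra_simps\<close>)
    then show "Gam (m + 1) (- int n) (Gam (m + 2) (int n) (Psi y))
        = Psi (Poly_Mapping.map (psi (- int n)) (Poly_Mapping.map (psi (int n)) y))"
      by (simp add: Gam_Psi[OF y] Gam_Psi)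
  qed
  also have "\<dots> = Psi (Poly_Mapping.map (scl \<i>)
      (\<Sum>n\<in>{1..K}. Poly_Mapping.map (psi (- int n)) (Poly_Mapping.map (psi (int n)) y)))"
    by (simp add: Psi_scl Psi_sum)
  also have "Poly_Mapping.map (scl \<i>)
      (\<Sum>n\<in>{1..K}. Poly_Mapping.map (psi (- int n)) (Poly_Mapping.map (psi (int n)) y))
     = Poly_Mapping.map (\<lambda>v. scl (- \<i>) (omega v)) y"
  proof (rule poly_mapping_eqI)
    fix \<mu>
    have "scl \<i> (\<Sum>n\<in>{1..K}. psi (- int n) (psi (int n) (lookup y \<mu>)))
        = scl (- \<i>) (omega (lookup y \<mu>))"
      unfolding om by (rule poly_mapping_eqI) simp
    then show "lookup (Poly_Mapping.map (scl \<i>)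
        (\<Sum>n\<in>{1..K}. Poly_Mapping.map (psi (- int n)) (Poly_Mapping.map (psi (int n)) y))) \<mu>
        = lookup (Poly_Mapping.map (\<lambda>v. scl (- \<i>) (omega v)) y) \<mu>"
      by (simp add: lookup_map_zero lookup_sum)
  qed
  finally show ?thesis .
qed

text \<open>Both operators act on the Fock factor alone, so the relations are \<open>D\<close>
  tensored with the fermionic relations.\<close>

lemma relations_eq:
  "relations m = Psi ` {y \<in> Y_space m. \<forall>\<mu>. lookup y \<mu> \<in> fock_relations m}"
    (is "_ = Psi ` ?R")
proof (intro equalityI subsetI)
  fix P assume "P \<in> relations m"
  then obtain Q1 Q2 where P: "P = xbar (m + 1) Q1 + xbar_div2 (m + 2) Q2" by (auto simp: relations_def)
  obtain a where a: "a \<in> Y_space (m + 1)" "Q1 = Psi a" using Psi_surj[of Q1 "m + 1"] by auto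
  obtain b where b: "b \<in> Y_space (m + 2)" "Q2 = Psi b" using Psi_surj[of Q2 "m + 2"] by auto
  let ?b = "\<lambda>v. scl (- \<i>) (omega v)"
  let ?y = "Poly_Mapping.map (psi 0) a + Poly_Mapping.map ?b b"
  have "P = Psi ?y" by (simp add: P a b xbar_Psi xbar_div2_Psi Psi_add)
  moreover have "?y \<in> Y_space m"
    using psi_Fock[of _ "m + 1" 0]
    by (intro Y_space_add Y_space_map[OF a(1)] Y_space_map[OF b(1)]) (auto intro: Fock_scl omega_Fock)
  moreover have "lookup ?y \<mu> \<in> fock_relations m" for \<mu>
    using a(1) b(1) unfolding fock_relations_def
    by (auto simp: lookup_add lookup_map_zero Y_space_def omega_scl[symmetric] intro!: exI Fock_scl)
  ultimately show "P \<in> Psi ` ?R" by blast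
next
  fix P assume "P \<in> Psi ` ?R"
  then obtain y where y: "y \<in> Y_space m" "P = Psi y" "\<And>\<mu>. lookup y \<mu> \<in> fock_relations m" by auto
  have "\<forall>v\<in>fock_relations m. \<exists>a b. a \<in> Fock (m + 1) \<and> b \<in> Fock (m + 2) \<and> v = psi 0 a + omega b"
    by (auto simp: fock_relations_def)
  then obtain a b where ab: "\<And>v. v \<in> fock_relations m \<Longrightarrow> a v \<in> Fock (m + 1) \<and> b v \<in> Fock (m + 2) \<and> v = psi 0 (a v) + omega (b v)"
    by metis
  \<comment> \<open>The choices are normalized to send 0 to 0, so that they can be mapped over
    finitely supported coefficients. In \<open>b'\<close> the factor i cancels the -i of the divided
    square.\<close>
  define a' where "a' v = (if v = 0 then 0 else a v)" for v
  define b' where "b' v = (if v = 0 then 0 else scl \<i> (b v))" for v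
  let ?a = "Poly_Mapping.map a' y" and ?b = "Poly_Mapping.map b' y"
  have ab0: "a' 0 = 0" "b' 0 = 0" by (simp_all add: a'_def b'_def)
  have Y: "?a \<in> Y_space (m + 1)" "?b \<in> Y_space (m + 2)"
    using y(1) ab[OF y(3)] by (auto simp: Y_space_def lookup_map_zero[where f = a', OF ab0(1)]
        lookup_map_zero[where f = b', OF ab0(2)] a'_def b'_def intro: Fock_scl)
  have "y = Poly_Mapping.map (psi 0) ?a + Poly_Mapping.map (\<lambda>v. scl (- \<i>) (omega v)) ?b"
  proof (rule poly_mapping_eqI)
    fix \<mu>
    have "v = psi 0 (a' v) + scl (- \<i>) (omega (b' v))" if "v \<in> fock_relations m" for v
      using ab[OF that] by (auto simp: a'_def b'_def omega_scl)
    then show "lookup y \<mu>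
        = lookup (Poly_Mapping.map (psi 0) ?a + Poly_Mapping.map (\<lambda>v. scl (- \<i>) (omega v)) ?b) \<mu>"
      using y(3) by (simp add: lookup_add lookup_map_zero ab0)
  qed
  then have "Psi y = Psi (Poly_Mapping.map (psi 0) ?a + Poly_Mapping.map (\<lambda>v. scl (- \<i>) (omega v)) ?b)"
    by (rule arg_cong)
  then have "P = xbar (m + 1) (Psi ?a) + xbar_div2 (m + 2) (Psi ?b)"
    unfolding y(2) using Y by (simp only: xbar_Psi xbar_div2_Psi Psi_add)
  then show "P \<in> relations m" by (auto simp: relations_def)
qed

section \<open>Linear representatives modulo the fermionic relations\<close>

interpretation fock_vs: vector_space "scl :: complex \<Rightarrow> fock \<Rightarrow> fock"
  by unfold_locales (simp_all add: scl_add_right scl_add_left)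

interpretation fock_pair: vector_space_pair "scl :: complex \<Rightarrow> fock \<Rightarrow> fock" "scl :: complex \<Rightarrow> fock \<Rightarrow> fock" ..

lemma subspace_fock_relations: "fock_vs.subspace (fock_relations m)"
proof (rule fock_vs.subspaceI)
  show "0 \<in> fock_relations m"
    unfolding fock_relations_def by (auto intro!: exI[of _ 0])
  show "v + w \<in> fock_relations m" if v: "v \<in> fock_relations m" and w: "w \<in> fock_relations m" for v w
  proof -
    obtain a b where "a \<in> Fock (m + 1)" "b \<in> Fock (m + 2)" "v = psi 0 a + omega b"
      using v by (auto simp: fock_relations_def)
    moreover obtain a' b' where "a' \<in> Fock (m + 1)" "b' \<in> Fock (m + 2)" "w = psi 0 a' + omega b'"
      using w by (auto simp: fock_relations_def)
    ultimately have "v + w = psi 0 (a + a') + omega (b + b')" "a + a' \<in> Fock (m + 1)" "b + b' \<in> Fock (m + 2)"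
      by (simp_all add: psi_add omega_add Fock_add)
    then show ?thesis by (auto simp: fock_relations_def)
  qed
  show "scl c v \<in> fock_relations m" if v: "v \<in> fock_relations m" for c v
  proof -
    obtain a b where "a \<in> Fock (m + 1)" "b \<in> Fock (m + 2)" "v = psi 0 a + omega b"
      using v by (auto simp: fock_relations_def)
    then have "scl c v = psi 0 (scl c a) + omega (scl c b)" "scl c a \<in> Fock (m + 1)" "scl c b \<in> Fock (m + 2)"
      by (simp_all add: psi_scl omega_scl scl_add_right Fock_scl)
    then show ?thesis by (auto simp: fock_relations_def)
  qed
qed

text \<open>Extend a basis of S to a basis of the whole space, kill the basis of S and fix the added
  vectors.\<close>

lemma projection_along_subspace:
  assumes S: "fock_vs.subspace S"
  shows "\<exists>\<kappa>. (\<forall>v w. \<kappa> (v + w) = \<kappa> v + \<kappa> w) \<and> (\<forall>c v. \<kappa> (scl c v) = scl c (\<kappa> v))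
    \<and> (\<forall>v. \<kappa> v = 0 \<longleftrightarrow> v \<in> S) \<and> (\<forall>v. v - \<kappa> v \<in> S)"
proof -
  obtain B where B: "B \<subseteq> S" "fock_vs.independent B" "S \<subseteq> fock_vs.span B"
    using fock_vs.maximal_independent_subset by blast
  let ?C = "fock_vs.extend_basis B"
  have C: "fock_vs.independent ?C" "fock_vs.span ?C = UNIV"
    using fock_vs.independent_extend_basis[OF B(2)] fock_vs.span_extend_basis[OF B(2)] by auto
  obtain \<kappa> where lin: "Vector_Spaces.linear (scl :: complex \<Rightarrow> fock \<Rightarrow> fock) (scl :: complex \<Rightarrow> fock \<Rightarrow> fock) \<kappa>" and \<kappa>: "\<forall>x\<in>?C. \<kappa> x = (if x \<in> B then 0 else x)"
    using fock_pair.linear_independent_extend[OF C(1), of "\<lambda>x. if x \<in> B then 0 else x"] by blast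
  interpret k: Vector_Spaces.linear "scl :: complex \<Rightarrow> fock \<Rightarrow> fock" "scl :: complex \<Rightarrow> fock \<Rightarrow> fock" \<kappa> by (rule lin)
  have BC: "B \<subseteq> ?C" by (rule fock_vs.extend_basis_superset[OF B(2)])
  have zero: "\<kappa> v = 0" if "v \<in> S" for v
  proof -
    have v: "v \<in> fock_vs.span B" using B(3) that by blast
    show ?thesis by (rule fock_pair.linear_eq_0_on_span[OF lin _ v]) (use BC \<kappa> in auto)
  qed
  have diff: "v - \<kappa> v \<in> S" for v
  proof -
    have "v \<in> fock_vs.span ?C" using C(2) by simp
    then show ?thesis
    proof (rule fock_vs.span_induct)
      show "fock_vs.subspace {v. v - \<kappa> v \<in> S}"
      proof (rule fock_vs.subspaceI)
        show "v + w \<in> {v. v - \<kappa> v \<in> S}" if "v \<in> {v. v - \<kappa> v \<in> S}" "w \<in> {v. v - \<kappa> v \<in> S}" for v w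
          using that fock_vs.subspace_add[OF S, of "v - \<kappa> v" "w - \<kappa> w"] by (simp add: k.add algebra_simps)
        show "scl c v \<in> {v. v - \<kappa> v \<in> S}" if "v \<in> {v. v - \<kappa> v \<in> S}" for c v
          using that fock_vs.subspace_scale[OF S, of "v - \<kappa> v" c] by (simp add: k.scale fock_vs.scale_right_diff_distrib)
      qed (use fock_vs.subspace_0[OF S] in \<open>simp add: k.zero\<close>)
      show "x - \<kappa> x \<in> S" if "x \<in> ?C" for x
        using \<kappa> that B(1) fock_vs.subspace_0[OF S] by auto
    qed
  qed
  have "\<kappa> v = 0 \<longleftrightarrow> v \<in> S" for v
    using zero diff[of v] by auto
  then show ?thesis using diff k.add k.scale by blast
qed

text \<open>A linear choice of one representative per class modulo the fermionic relations. Quotient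
  elements thereby become Fock vectors, and the Koszul computation avoids cosets.\<close>

definition kappa :: "int \<Rightarrow> fock \<Rightarrow> fock" where
  "kappa m = (SOME \<kappa>. (\<forall>v w. \<kappa> (v + w) = \<kappa> v + \<kappa> w) \<and> (\<forall>c v. \<kappa> (scl c v) = scl c (\<kappa> v))
    \<and> (\<forall>v. \<kappa> v = 0 \<longleftrightarrow> v \<in> fock_relations m) \<and> (\<forall>v. v - \<kappa> v \<in> fock_relations m))"

lemma kappa_add: "kappa m (v + w) = kappa m v + kappa m w"
  and kappa_scl: "kappa m (scl c v) = scl c (kappa m v)"
  and kappa_eq_0: "kappa m v = 0 \<longleftrightarrow> v \<in> fock_relations m"
  and kappa_diff: "v - kappa m v \<in> fock_relations m"
  using someI_ex[OF projection_along_subspace[OF subspace_fock_relations[of m]]]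
  unfolding kappa_def[symmetric] by blast+

lemma kappa_zero [simp]: "kappa m 0 = 0"
  using kappa_add[of m 0 0] by simp

lemma kappa_minus: "kappa m (- v) = - kappa m v"
  using kappa_add[of m "- v" v] by (simp add: eq_neg_iff_add_eq_0)

lemma kappa_idem: "kappa m (kappa m v) = kappa m v"
  using kappa_diff[of v m] kappa_add[of m v "- kappa m v"] by (simp add: kappa_eq_0[symmetric] kappa_minus)

lemma kappa_Fock: "v \<in> Fock m \<Longrightarrow> kappa m v \<in> Fock m"
  using Fock_add[of v m "- (v - kappa m v)"] Fock_minus[of "v - kappa m v" m] kappa_diff[of v m]
    fock_relations_Fock[of m] by auto

section \<open>Coordinates of bosonic polynomials modulo the relations\<close>

definition Psi_inv :: "int \<Rightarrow> complex bpoly \<Rightarrow> (nat \<Rightarrow>\<^sub>0 nat) \<Rightarrow>\<^sub>0 fock" where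
  "Psi_inv m = the_inv_into (Y_space m) Psi"

lemma Y_space_minus: "y \<in> Y_space m \<Longrightarrow> - y \<in> Y_space m"
  by (auto simp: Y_space_def Fock_minus)

lemma Psi_minus: "Psi (- y) = - Psi y"
  using Psi_add[of "- y" y] by (simp add: eq_neg_iff_add_eq_0)

lemma inj_on_Psi: "inj_on Psi (Y_space m)"
proof (rule inj_onI)
  fix y z assume "y \<in> Y_space m" "z \<in> Y_space m" "Psi y = Psi z"
  then have "y + - z \<in> Y_space m" "Psi (y + - z) = 0"
    by (simp_all only: Y_space_add Y_space_minus Psi_add Psi_minus right_minus)
  then have "y + - z = 0" by (rule Psi_eq_zero)
  then show "y = z" by simp
qed

lemma Psi_inv_in: "Psi_inv m P \<in> Y_space m"
  and Psi_Psi_inv: "Psi (Psi_inv m P) = P"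
  unfolding Psi_inv_def
  by (rule the_inv_into_into[OF inj_on_Psi Psi_surj order_refl])
    (rule f_the_inv_into_f[OF inj_on_Psi Psi_surj])

lemma Psi_inv_Psi: "y \<in> Y_space m \<Longrightarrow> Psi_inv m (Psi y) = y"
  unfolding Psi_inv_def by (rule the_inv_into_f_f[OF inj_on_Psi])

lemma Psi_inv_eqI: "y \<in> Y_space m \<Longrightarrow> Psi y = P \<Longrightarrow> Psi_inv m P = y"
  using Psi_inv_Psi by blast

text \<open>The coefficient at the monomial \<mu> of the class of P, as an element of
  \<open>D\<close> tensored with normalized Fock representatives.\<close>

definition theta :: "int \<Rightarrow> complex bpoly \<Rightarrow> (nat \<Rightarrow>\<^sub>0 nat) \<Rightarrow> fock" where
  "theta m P \<mu> = kappa m (lookup (Psi_inv m P) \<mu>)"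

lemma theta_add: "theta m (P + Q) \<mu> = theta m P \<mu> + theta m Q \<mu>"
proof -
  have "Psi_inv m (P + Q) = Psi_inv m P + Psi_inv m Q"
    by (rule Psi_inv_eqI) (simp_all add: Y_space_add Psi_inv_in Psi_add Psi_Psi_inv)
  then show ?thesis by (simp add: theta_def lookup_add kappa_add)
qed

lemma theta_scl: "theta m (scl c P) \<mu> = scl c (theta m P \<mu>)"
proof -
  have "Psi_inv m (scl c P) = Poly_Mapping.map (scl c) (Psi_inv m P)"
    by (rule Psi_inv_eqI) (simp_all add: Y_space_map[OF Psi_inv_in] Fock_scl Psi_scl Psi_Psi_inv)
  then show ?thesis by (simp add: theta_def lookup_map_zero kappa_scl)
qed

lemma theta_zero [simp]: "theta m 0 \<mu> = 0"
  using theta_scl[of m 0 0 \<mu>] by simp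

lemma theta_sum: "theta m (sum f A) \<mu> = (\<Sum>x\<in>A. theta m (f x) \<mu>)"
  by (induction A rule: infinite_finite_induct) (simp_all add: theta_add)

lemma theta_eq_0_iff: "(\<forall>\<mu>. theta m P \<mu> = 0) \<longleftrightarrow> P \<in> relations m"
proof
  assume "\<forall>\<mu>. theta m P \<mu> = 0"
  then have "\<forall>\<mu>. lookup (Psi_inv m P) \<mu> \<in> fock_relations m"
    by (simp add: theta_def kappa_eq_0)
  then have "Psi (Psi_inv m P) \<in> relations m"
    unfolding relations_eq using Psi_inv_in by blast
  then show "P \<in> relations m" by (simp only: Psi_Psi_inv)
next
  assume "P \<in> relations m"
  then obtain y where y: "y \<in> Y_space m" "P = Psi y" "\<forall>\<mu>. lookup y \<mu> \<in> fock_relations m"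
    unfolding relations_eq by auto
  then show "\<forall>\<mu>. theta m P \<mu> = 0" by (simp add: theta_def Psi_inv_Psi kappa_eq_0)
qed

lemma theta_bvar:
  assumes "even k"
  shows "theta m (bvar (Suc k) * P) \<mu>
    = (if lookup \<mu> k = 0 then 0 else theta m P (\<mu> - single k 1))"
proof -
  let ?e = "single k 1 :: nat \<Rightarrow>\<^sub>0 nat"
  define y where "y = Psi_inv m P"
  have y: "y \<in> Y_space m" "Psi y = P" by (simp_all add: y_def Psi_inv_in Psi_Psi_inv)
  define z where "z = (\<Sum>\<nu>\<in>keys y. single (?e + \<nu>) (lookup y \<nu>))"
  have e: "oddm ?e" using assms by (auto simp: oddm_def lookup_single when_def)
  have "z \<in> Y_space m"
    unfolding z_def using y(1) e
    by (intro Y_space_sum Y_space_single oddm_add) (auto simp: Y_space_def in_keys_iff)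
  moreover have "Psi z = bvar (Suc k) * P"
  proof -
    have "Psi z = (\<Sum>\<nu>\<in>keys y. single (?e + \<nu>) 1 * Emb (lookup y \<nu>))"
      by (simp add: z_def Psi_sum Psi_single)
    also have "\<dots> = (\<Sum>\<nu>\<in>keys y. bvar (Suc k) * (single \<nu> 1 * Emb (lookup y \<nu>)))"
      by (simp add: bvar_def mult_single flip: mult.assoc)
    finally show ?thesis unfolding sum_distrib_left[symmetric] Psi_def[symmetric] y(2) .
  qed
  ultimately have inv: "Psi_inv m (bvar (Suc k) * P) = z" by (rule Psi_inv_eqI)
  have lz: "lookup z \<mu> = (\<Sum>\<nu>\<in>keys y. lookup y \<nu> when ?e + \<nu> = \<mu>)"
    by (simp add: z_def lookup_sum lookup_single)
  have "lookup z \<mu> = (if lookup \<mu> k = 0 then 0 else lookup y (\<mu> - ?e))"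
  proof (cases "lookup \<mu> k = 0")
    case True
    then have "?e + \<nu> \<noteq> \<mu>" for \<nu> by (auto simp: lookup_add)
    then show ?thesis unfolding lz using True by simp
  next
    case False
    then have "?e + \<nu> = \<mu> \<longleftrightarrow> \<nu> = \<mu> - ?e" for \<nu>
      using single_remove[of \<mu> k] by (metis add_diff_cancel_left')
    then show ?thesis unfolding lz using False by (simp add: when_def in_keys_iff)
  qed
  then show ?thesis by (simp add: theta_def inv y_def)
qed

lemma theta_finite: "finite {\<mu>. theta m P \<mu> \<noteq> 0}"
  by (rule finite_subset[OF _ finite_keys[of "Psi_inv m P"]]) (auto simp: theta_def in_keys_iff)

lemma theta_kappa: "theta m P \<mu> \<in> kappa m ` Fock m"
  using Psi_inv_in[of m P] by (auto simp: theta_def Y_space_def)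

lemma theta_oddm: "theta m P \<mu> \<noteq> 0 \<Longrightarrow> oddm \<mu>"
  using Psi_inv_in[of m P] by (auto simp: theta_def Y_space_def) (metis kappa_zero)

text \<open>Vectors in the image of \<open>kappa\<close> represent themselves, since
  \<open>kappa\<close> is idempotent, so t itself can serve as the family of coefficients.\<close>

lemma theta_surj:
  assumes fin: "finite {\<mu>. t \<mu> \<noteq> 0}" and t: "\<And>\<mu>. t \<mu> \<in> kappa m ` Fock m" and odd: "\<And>\<mu>. t \<mu> \<noteq> 0 \<Longrightarrow> oddm \<mu>"
  shows "\<exists>P. \<forall>\<mu>. theta m P \<mu> = t \<mu>"
proof -
  have l: "lookup (Abs_poly_mapping t) = t"
    using fin by (rule Abs_poly_mapping_inverse[OF CollectI])
  have "Abs_poly_mapping t \<in> Y_space m"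
    using t odd kappa_Fock by (auto simp: Y_space_def l) (metis imageE)
  moreover have "kappa m (t \<mu>) = t \<mu>" for \<mu> using t[of \<mu>] by (auto simp: kappa_idem)
  ultimately have "theta m (Psi (Abs_poly_mapping t)) \<mu> = t \<mu>" for \<mu>
    by (simp add: theta_def Psi_inv_Psi l)
  then show ?thesis by blast
qed

section \<open>Splitting off the mode \<open>0\<close>\<close>

text \<open>The projector to vectors without mode 0, along the image of
  \<open>psi 0\<close>.\<close>

definition drop0 :: "fock \<Rightarrow> fock" where
  "drop0 v = psi_star 0 (psi 0 v)"

lemma psi_star_0: "psi_star 0 = annihilate 0"
  by (simp add: psi_star_def)

lemma psi_star_0_add: "psi_star 0 (v + w) = psi_star 0 v + psi_star 0 w"
  and psi_star_0_scl: "psi_star 0 (scl c v) = scl c (psi_star 0 v)"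
  by (simp_all add: psi_star_0 annihilate_def lin_ext_add lin_ext_scl)

lemma psi_star_0_zero [simp]: "psi_star 0 0 = 0"
  by (simp add: psi_star_0 annihilate_def)

lemma psi_star_0_minus: "psi_star 0 (- v) = - psi_star 0 v"
  using psi_star_0_add[of "- v" v] by (simp add: eq_neg_iff_add_eq_0)

lemma psi_star_0_sum: "psi_star 0 (sum f A) = (\<Sum>x\<in>A. psi_star 0 (f x))"
  by (induction A rule: infinite_finite_induct) (simp_all add: psi_star_0_add)

lemma drop0_add: "drop0 (v + w) = drop0 v + drop0 w"
  and drop0_scl: "drop0 (scl c v) = scl c (drop0 v)"
  and drop0_minus: "drop0 (- v) = - drop0 v"
  and drop0_sum: "drop0 (sum f A) = (\<Sum>x\<in>A. drop0 (f x))"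
  by (simp_all add: drop0_def psi_add psi_scl psi_minus psi_sum psi_star_0_add psi_star_0_scl
      psi_star_0_minus psi_star_0_sum)

lemma drop0_split: "v = psi 0 (psi_star 0 v) + drop0 v"
  using psi_psi_star[of 0 0 v] by (simp add: drop0_def)

lemma psi_square: "psi n (psi n v) = 0"
proof -
  have "scl 2 (psi n (psi n v)) = 0"
    using psi_psi[of n n v] scl_add_left[of 1 1 "psi n (psi n v)"] by simp
  then have "scl (1/2) (scl 2 (psi n (psi n v))) = 0" by simp
  then show ?thesis by simp
qed

lemma drop0_psi_0 [simp]: "drop0 (psi 0 v) = 0"
  by (simp add: drop0_def psi_square)

lemma drop0_psi:
  assumes "n \<noteq> 0" shows "drop0 (psi n v) = psi n (drop0 v)"
proof -
  have "psi 0 (psi n v) = - psi n (psi 0 v)" using psi_psi[of 0 n v] by (simp add: eq_neg_iff_add_eq_0)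
  moreover have "psi_star 0 (psi n w) = - psi n (psi_star 0 w)" for w
    using psi_psi_star[of n 0 w] assms by (simp add: eq_neg_iff_add_eq_0 add.commute)
  ultimately show ?thesis by (simp add: drop0_def psi_star_0_minus)
qed

text \<open>The summands of \<open>omega\<close> involve only nonzero modes, and those commute with
  the even operator \<open>drop0\<close>.\<close>

lemma drop0_omega: "drop0 (omega v) = omega (drop0 v)"
proof -
  have "finite {v, drop0 v}" by simp
  from psi_bound_finite[OF this] obtain K where K: "\<forall>u\<in>{v, drop0 v}. \<forall>n>int K. psi n u = 0" by (elim exE)
  have "omega u = - (\<Sum>n\<in>{1..K}. psi (- int n) (psi (int n) u))" if "u \<in> {v, drop0 v}" for u
    by (rule omega_eq) (use K that in blast)
  then show ?thesis by (simp add: drop0_minus drop0_sum drop0_psi)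
qed

lemma psi_star_0_Fock: "v \<in> Fock m \<Longrightarrow> psi_star 0 v \<in> Fock (m + 1)"
  unfolding psi_star_0 annihilate_def
  by (erule Fock_lin_ext) (auto simp: charge_remove intro!: Fock_single)

lemma annihilate_keys: "F \<in> keys (annihilate n v) \<Longrightarrow> n |\<notin>| F"
proof -
  assume "F \<in> keys (annihilate n v)"
  then obtain G where "lookup (scl (lookup v G)
     (if n |\<in>| G then single (G |-| {|n|}) (mode_sign n G) else 0)) F \<noteq> 0"
    unfolding annihilate_def lin_ext_def in_keys_iff lookup_sum by (metis (no_types, lifting) sum.neutral)
  then show ?thesis by (auto simp: lookup_single when_def split: if_splits)
qed

lemma fock_basis_eq: "fock_basis m = {single F 1 | F. charge F = m \<and> 0 |\<notin>| F}"
proof (intro equalityI subsetI)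
  fix v assume "v \<in> fock_basis m"
  then obtain rs ss where *: "v = foldr psi rs (foldr psi_star ss vacuum)" "sorted_wrt (<) rs" "sorted_wrt (<) ss"
    "\<forall>r\<in>set rs. r < 0" "\<forall>s\<in>set ss. 0 < s" "int (length ss) = int (length rs) + m"
    unfolding fock_basis_def by blast
  let ?F = "fset_of_list (rs @ ss)"
  have F: "fset ?F = set rs \<union> set ss" by (simp add: fset_of_list.rep_eq)
  have "{n\<in>fset ?F. 0 < n} = set ss" "{n\<in>fset ?F. n \<le> 0} = set rs"
    unfolding F using *(4,5) by auto
  moreover have "card (set ss) = length ss" "card (set rs) = length rs"
    using *(2,3) by (simp_all add: distinct_card strict_sorted_iff)
  ultimately have "charge ?F = m" unfolding charge_def using *(6) by simp
  moreover have "0 |\<notin>| ?F" unfolding F using *(4,5) by auto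
  moreover have "v = single ?F 1"
    unfolding *(1) by (rule fock_basis_vector) (use * in auto)
  ultimately show "v \<in> {single F 1 | F. charge F = m \<and> 0 |\<notin>| F}" by blast
next
  fix v assume "v \<in> {single F (1::complex) | F. charge F = m \<and> 0 |\<notin>| F}"
  then obtain F where F: "v = single F 1" "charge F = m" "0 |\<notin>| F" by blast
  define rs where "rs = sorted_list_of_set {n\<in>fset F. n \<le> 0}"
  define ss where "ss = sorted_list_of_set {n\<in>fset F. 0 < n}"
  have s: "set rs = {n\<in>fset F. n \<le> 0}" "set ss = {n\<in>fset F. 0 < n}" by (simp_all add: rs_def ss_def)
  have sr: "sorted_wrt (<) rs" "sorted_wrt (<) ss" by (simp_all add: rs_def ss_def)
  have n: "\<forall>r\<in>set rs. r < 0" "\<forall>r\<in>set ss. 0 < r" using F(3) s by (auto simp: order_le_less)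
  have "int (length ss) = int (length rs) + m"
    using F(2) by (simp add: rs_def ss_def charge_def)
  moreover have "fset_of_list (rs @ ss) = F"
    by (rule fset_inject[THEN iffD1]) (use s in \<open>auto simp: fset_of_list.rep_eq\<close>)
  ultimately show "v \<in> fock_basis m"
    unfolding fock_basis_def F(1) using fock_basis_vector[OF sr] sr n
    by (intro CollectI exI[of _ rs] exI[of _ ss]) auto
qed

lemma fock_span_eq: "fock_span m = {v \<in> Fock m. \<forall>F\<in>keys v. 0 |\<notin>| F}"
proof (intro equalityI subsetI)
  fix v assume "v \<in> fock_span m"
  then obtain B c where B: "B \<subseteq> fock_basis m" and v: "v = (\<Sum>v\<in>B. scl (c v) v)"
    unfolding fock_span_def by blast
  have "charge F = m \<and> 0 |\<notin>| F" if "F \<in> keys v" for F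
  proof -
    from that obtain w where w: "w \<in> B" "lookup (scl (c w) w) F \<noteq> 0"
      unfolding v in_keys_iff lookup_sum by (metis (no_types, lifting) sum.neutral)
    then show ?thesis using B unfolding fock_basis_eq by (auto simp: lookup_single when_def split: if_splits)
  qed
  then show "v \<in> {v \<in> Fock m. \<forall>F\<in>keys v. 0 |\<notin>| F}" by (auto simp: Fock_def)
next
  fix v assume v: "v \<in> {v \<in> Fock m. \<forall>F\<in>keys v. 0 |\<notin>| F}"
  \<comment> \<open>Coefficients in \<open>fock_span\<close> are indexed by vectors, so they are
    transported along this injection.\<close>
  let ?s = "\<lambda>F. single F (1::complex)"
  have inj: "inj_on ?s (keys v)"
    by (rule inj_onI) (metis lookup_single_eq lookup_single_not_eq one_neq_zero)
  have "v = (\<Sum>F\<in>keys v. scl (lookup v F) (?s F))"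
    using expand_singles[of v] by simp
  also have "\<dots> = (\<Sum>w\<in>?s ` keys v. scl (lookup v (the_inv_into (keys v) ?s w)) w)"
    by (simp add: sum.reindex[OF inj] the_inv_into_f_f[OF inj])
  finally have "v = \<dots>" .
  moreover have "?s ` keys v \<subseteq> fock_basis m"
    unfolding fock_basis_eq using v by (auto simp: Fock_def)
  ultimately show "v \<in> fock_span m"
    unfolding fock_span_def
    by (intro CollectI exI[of _ "?s ` keys v"]
        exI[of _ "\<lambda>w. lookup v (the_inv_into (keys v) ?s w)"]) auto
qed

lemma drop0_fock_span: "v \<in> Fock m \<Longrightarrow> drop0 v \<in> fock_span m"
  unfolding fock_span_eq drop0_def
  using psi_star_0_Fock[OF psi_Fock[of v m 0]] annihilate_keys[of _ 0] by (auto simp: psi_star_0)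

lemma drop0_id:
  assumes "v \<in> fock_span m" shows "drop0 v = v"
proof -
  have "psi_star 0 v = 0"
    unfolding psi_star_0 annihilate_def lin_ext_def using assms by (auto simp: fock_span_eq intro!: sum.neutral)
  then show ?thesis using drop0_split[of v] by simp
qed

text \<open>Modulo the image of \<open>psi 0\<close> every vector equals its part without mode 0,
  and there \<open>omega\<close> is the only remaining source of relations.\<close>

lemma drop0_relations_iff:
  assumes "v \<in> Fock m"
  shows "drop0 v \<in> omega ` fock_span (m + 2) \<longleftrightarrow> v \<in> fock_relations m"
proof
  assume "drop0 v \<in> omega ` fock_span (m + 2)"
  then obtain h where "h \<in> Fock (m + 2)" "drop0 v = omega h" by (auto simp: fock_span_eq)
  then show "v \<in> fock_relations m"
    unfolding fock_relations_def
    using drop0_split[of v] psi_star_0_Fock[OF assms]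
    by (intro CollectI exI[of _ "psi_star 0 v"] exI[of _ h]) simp
next
  assume "v \<in> fock_relations m"
  then obtain a b where "b \<in> Fock (m + 2)" "v = psi 0 a + omega b" by (auto simp: fock_relations_def)
  then show "drop0 v \<in> omega ` fock_span (m + 2)"
    by (auto simp: drop0_add drop0_omega intro!: imageI drop0_fock_span)
qed

section \<open>Exactness of the Koszul complex\<close>

definition mdeg :: "(nat \<Rightarrow>\<^sub>0 nat) \<Rightarrow> nat" where
  "mdeg \<mu> = (\<Sum>k\<in>keys \<mu>. lookup \<mu> k)"

abbreviation unit_mon :: "nat \<Rightarrow> nat \<Rightarrow>\<^sub>0 nat" ("\<epsilon>") where
  "\<epsilon> k \<equiv> single k 1"

lemma mdeg_superset:
  assumes "finite K" "keys \<mu> \<subseteq> K"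
  shows "mdeg \<mu> = (\<Sum>k\<in>K. lookup \<mu> k)"
  unfolding mdeg_def by (rule sum.mono_neutral_left) (use assms in \<open>auto simp: in_keys_iff\<close>)

lemma mdeg_add: "mdeg (\<mu> + \<nu>) = mdeg \<mu> + mdeg \<nu>"
proof -
  let ?K = "keys \<mu> \<union> keys \<nu>"
  have "mdeg x = (\<Sum>k\<in>?K. lookup x k)" if "x \<in> {\<mu>, \<nu>, \<mu> + \<nu>}" for x
    by (rule mdeg_superset) (use that Poly_Mapping.keys_add[of \<mu> \<nu>] in auto)
  then show ?thesis by (simp add: lookup_add sum.distrib)
qed

lemma mdeg_unit [simp]: "mdeg (single k (Suc 0)) = 1"
  by (simp add: mdeg_def)

lemma mdeg_remove: "k \<in> keys \<mu> \<Longrightarrow> mdeg (\<mu> - \<epsilon> k) + 1 = mdeg \<mu>"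
  using mdeg_add[of "\<epsilon> k" "\<mu> - \<epsilon> k"] single_remove[of \<mu> k] by (simp add: in_keys_iff)

text \<open>\<open>sg_swap\<close> is the anticommutation of wedging with form k and contracting
  with form i, in the convention where N lists the forms that are absent.\<close>

locale koszul =
  fixes sg :: "nat \<Rightarrow> nat set \<Rightarrow> complex"
  assumes sg_square: "sg k N * sg k N = 1"
    and sg_swap: "\<And>N i k. finite N \<Longrightarrow> i \<in> N \<Longrightarrow> k \<notin> N \<Longrightarrow>
      sg k (insert k N) * sg i (insert k N) = - (sg i N * sg k (insert k (N - {i})))"
begin

text \<open>The Koszul differential in coordinates: wedging with form k takes k out of the removed
  set, and multiplication by variable k lowers the exponent at which x is read.\<close>

definition KK :: "(nat set \<Rightarrow> (nat \<Rightarrow>\<^sub>0 nat) \<Rightarrow> fock) \<Rightarrow> nat set \<Rightarrow> (nat \<Rightarrow>\<^sub>0 nat) \<Rightarrow> fock" where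
  "KK x N \<mu> = (\<Sum>k\<in>keys \<mu> - N. scl (sg k (insert k N)) (x (insert k N) (\<mu> - \<epsilon> k)))"

text \<open>The contraction \<open>\<Sum> \<partial>/\<partial>b\<^sub>i \<otimes> \<iota>\<^sub>i\<close>, divided by the eigenvalue of its anticommutator with the
  differential, which is the Euler operator.\<close>

definition HH :: "(nat set \<Rightarrow> (nat \<Rightarrow>\<^sub>0 nat) \<Rightarrow> fock) \<Rightarrow> nat set \<Rightarrow> (nat \<Rightarrow>\<^sub>0 nat) \<Rightarrow> fock" where
  "HH x N \<mu> = scl (1 / of_nat (mdeg \<mu> + card N)) (\<Sum>i\<in>N.
     scl (sg i N * of_nat (Suc (lookup \<mu> i))) (x (N - {i}) (\<mu> + \<epsilon> i)))"

text \<open>The diagonal terms contribute the exponents at k outside N. The cross terms are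
  evaluated by the cocycle condition and contribute the exponents plus one for i in N. The total is
  the degree plus \<open>card N\<close>, which \<open>HH\<close> divides out.\<close>

lemma KK_HH:
  assumes N: "finite N" and deg: "0 < mdeg \<mu> + card N"
    and cocycle: "\<And>i. i \<in> N \<Longrightarrow> KK x (N - {i}) (\<mu> + \<epsilon> i) = 0"
  shows "KK (HH x) N \<mu> = x N \<mu>"
proof -
  let ?A = "keys \<mu> - N" and ?l = "lookup \<mu>"
  let ?c = "1 / of_nat (mdeg \<mu> + card N) :: complex"
  define T where "T i k = scl (sg k (insert k N) * sg i (insert k N) * of_nat (Suc (?l i)))
      (x (insert k (N - {i})) (\<mu> - \<epsilon> k + \<epsilon> i))" for i k
  have h: "scl (sg k (insert k N)) (HH x (insert k N) (\<mu> - \<epsilon> k))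
      = scl ?c (scl (of_nat (?l k)) (x N \<mu>) + (\<Sum>i\<in>N. T i k))" if k: "k \<in> ?A" for k
  proof -
    have lk: "?l k \<noteq> 0" using k by (simp add: in_keys_iff)
    have d: "mdeg (\<mu> - \<epsilon> k) + card (insert k N) = mdeg \<mu> + card N"
      using mdeg_remove[of k \<mu>] k N by simp
    have restore: "\<mu> - \<epsilon> k + \<epsilon> k = \<mu>" using single_remove[of \<mu> k] lk by (simp add: add.commute)
    have "Suc (lookup (\<mu> - \<epsilon> k) k) = ?l k" using lk by (simp add: lookup_minus)
    moreover have "insert k N - {k} = N" using k by auto
    ultimately have 1: "scl (sg k (insert k N)) (scl (sg k (insert k N) * of_nat (Suc (lookup (\<mu> - \<epsilon> k) k)))
        (x (insert k N - {k}) (\<mu> - \<epsilon> k + \<epsilon> k))) = scl (of_nat (?l k)) (x N \<mu>)"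
      by (simp only: restore scl_scl mult.assoc[symmetric] sg_square mult_1_left)
    have 2: "scl (sg k (insert k N)) (scl (sg i (insert k N) * of_nat (Suc (lookup (\<mu> - \<epsilon> k) i)))
        (x (insert k N - {i}) (\<mu> - \<epsilon> k + \<epsilon> i))) = T i k" if "i \<in> N" for i
    proof -
      have "i \<noteq> k" using that k by auto
      then have "lookup (\<mu> - \<epsilon> k) i = ?l i" "insert k N - {i} = insert k (N - {i})"
        by (auto simp: lookup_minus lookup_single)
      then show ?thesis by (simp only: T_def scl_scl mult.assoc)
    qed
    have "scl (sg k (insert k N)) (HH x (insert k N) (\<mu> - \<epsilon> k))
      = scl ?c (\<Sum>i\<in>insert k N. scl (sg k (insert k N)) (scl (sg i (insert k N) * of_nat (Suc (lookup (\<mu> - \<epsilon> k) i)))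
        (x (insert k N - {i}) (\<mu> - \<epsilon> k + \<epsilon> i))))"
      unfolding HH_def d by (simp only: scl_sum scl_scl mult.left_commute mult.commute)
    also have "\<dots> = scl ?c (scl (of_nat (?l k)) (x N \<mu>) + (\<Sum>i\<in>N. T i k))"
      using k N 1 2 by simp
    finally show ?thesis .
  qed
  \<comment> \<open>The cocycle condition at N - {i} with exponent raised at i isolates x N \<mu>;
    \<open>sg_swap\<close> matches the remaining terms with T.\<close>
  have t: "(\<Sum>k\<in>?A. T i k) = scl (of_nat (Suc (?l i))) (x N \<mu>)" if i: "i \<in> N" for i
  proof -
    have keys: "keys (\<mu> + \<epsilon> i) - (N - {i}) = insert i ?A"
      using i by (auto simp: in_keys_iff lookup_add lookup_single when_def split: if_splits)
    have ia: "i \<notin> ?A" using i by simp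
    have r: "\<mu> + \<epsilon> i - \<epsilon> k = \<mu> - \<epsilon> k + \<epsilon> i" if "k \<in> ?A" for k
      using that i by (intro poly_mapping_eqI) (auto simp: lookup_add lookup_minus lookup_single when_def in_keys_iff)
    have "0 = scl (sg i N * of_nat (Suc (?l i))) (KK x (N - {i}) (\<mu> + \<epsilon> i))"
      using cocycle[OF i] by simp
    also have "KK x (N - {i}) (\<mu> + \<epsilon> i)
        = scl (sg i N) (x N \<mu>) + (\<Sum>k\<in>?A. scl (sg k (insert k (N - {i}))) (x (insert k (N - {i})) (\<mu> - \<epsilon> k + \<epsilon> i)))"
      unfolding KK_def keys using ia i r by (simp add: insert_absorb)
    also have "scl (sg i N * of_nat (Suc (?l i))) \<dots> = scl (of_nat (Suc (?l i))) (x N \<mu>) - (\<Sum>k\<in>?A. T i k)"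
    proof -
      have "scl (sg i N * of_nat (Suc (?l i))) (scl (sg i N) (x N \<mu>)) = scl (of_nat (Suc (?l i))) (x N \<mu>)"
      proof -
        have "sg i N * of_nat (Suc (?l i)) * sg i N = of_nat (Suc (?l i)) * (sg i N * sg i N)" by (simp only: ac_simps)
        then show ?thesis by (simp only: scl_scl sg_square mult_1_right)
      qed
      moreover have "scl (sg i N * of_nat (Suc (?l i)))
          (scl (sg k (insert k (N - {i}))) (x (insert k (N - {i})) (\<mu> - \<epsilon> k + \<epsilon> i))) = - T i k" if "k \<in> ?A" for k
      proof -
        have "k \<notin> N" using that by simp
        have "sg i N * of_nat (Suc (?l i)) * sg k (insert k (N - {i}))
            = of_nat (Suc (?l i)) * (sg i N * sg k (insert k (N - {i})))" by (simp only: ac_simps)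
        also have "sg i N * sg k (insert k (N - {i})) = - (sg k (insert k N) * sg i (insert k N))"
          using sg_swap[OF N i \<open>k \<notin> N\<close>] by simp
        finally have "sg i N * of_nat (Suc (?l i)) * sg k (insert k (N - {i}))
            = - (sg k (insert k N) * sg i (insert k N) * of_nat (Suc (?l i)))" by (simp only: mult_minus_right mult.commute)
        then show ?thesis by (simp only: T_def scl_scl scl_neg_left)
      qed
      ultimately show ?thesis by (simp add: scl_add_right scl_sum sum_negf)
    qed
    finally show ?thesis by simp
  qed
  have "KK (HH x) N \<mu> = (\<Sum>k\<in>?A. scl ?c (scl (of_nat (?l k)) (x N \<mu>) + (\<Sum>i\<in>N. T i k)))"
    unfolding KK_def by (intro sum.cong refl h)
  also have "\<dots> = scl ?c ((\<Sum>k\<in>?A. scl (of_nat (?l k)) (x N \<mu>)) + (\<Sum>k\<in>?A. \<Sum>i\<in>N. T i k))"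
    by (simp only: scl_sum[symmetric] sum.distrib)
  also have "(\<Sum>k\<in>?A. \<Sum>i\<in>N. T i k) = (\<Sum>i\<in>N. scl (of_nat (Suc (?l i))) (x N \<mu>))"
    by (subst sum.swap) (simp add: t)
  also have "(\<Sum>k\<in>?A. scl (of_nat (?l k)) (x N \<mu>)) + (\<Sum>i\<in>N. scl (of_nat (Suc (?l i))) (x N \<mu>))
      = scl (of_nat ((\<Sum>k\<in>?A. ?l k) + (\<Sum>i\<in>N. Suc (?l i)))) (x N \<mu>)"
  proof -
    have "(\<Sum>k\<in>B. scl (of_nat (f k)) w) = scl (of_nat (\<Sum>k\<in>B. f k)) w" for B and f :: "nat \<Rightarrow> nat" and w :: fock
      by (induction B rule: infinite_finite_induct) (simp_all add: scl_add_left)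
    then show ?thesis by (simp only: of_nat_add scl_add_left)
  qed
  also have "(\<Sum>k\<in>?A. ?l k) + (\<Sum>i\<in>N. Suc (?l i)) = mdeg \<mu> + card N"
  proof -
    have "(\<Sum>i\<in>N. Suc (?l i)) = (\<Sum>i\<in>N. ?l i) + card N" by (rule sum_Suc)
    moreover have "mdeg \<mu> = (\<Sum>k\<in>?A \<union> N. ?l k)" using N by (intro mdeg_superset) auto
    moreover have "(\<Sum>k\<in>?A \<union> N. ?l k) = (\<Sum>k\<in>?A. ?l k) + (\<Sum>k\<in>N. ?l k)"
      using N by (intro sum.union_disjoint) auto
    ultimately show ?thesis by simp
  qed
  also have "scl ?c (scl (of_nat (mdeg \<mu> + card N)) (x N \<mu>)) = x N \<mu>"
    using deg by (auto simp del: of_nat_add)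
  finally show ?thesis .
qed

lemma sg_anticommute:
  assumes "finite N" "k \<notin> N" "l \<notin> N" "k \<noteq> l"
  shows "sg k (insert k N) * sg l (insert l (insert k N)) = - (sg l (insert l N) * sg k (insert k (insert l N)))"
proof -
  let ?a = "sg l (insert l (insert k N))" and ?b = "sg k (insert l (insert k N))"
    and ?c = "sg k (insert k N)" and ?d = "sg l (insert l N)"
  have "insert k N - {k} = N" using assms by auto
  then have "?a * ?b = - (?c * ?d)" using sg_swap[of "insert k N" k l] assms by simp
  moreover have "c * a = - (d * b)" if "a * b = - (c * d)" "b * b = 1" "c * c = 1" for a b c d :: complex
  proof -
    have "c * a = c * (a * b) * b" using that(2) by (simp add: mult.assoc)
    also have "\<dots> = - (c * c) * d * b" by (simp add: that(1) mult.assoc)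
    finally show ?thesis using that(3) by simp
  qed
  ultimately have "?c * ?a = - (?d * ?b)" using sg_square by blast
  then show ?thesis by (simp only: insert_commute[of l k])
qed

text \<open>The double sum is antisymmetric in the two added indices, because multiplications
  commute while forms anticommute.\<close>

lemma KK_KK:
  assumes N: "finite N" shows "KK (KK x) N \<mu> = 0"
proof -
  let ?A = "keys \<mu> - N"
  define g where "g k l = scl (sg k (insert k N) * sg l (insert l (insert k N)))
      (x (insert l (insert k N)) (\<mu> - \<epsilon> k - \<epsilon> l))" for k l
  define t where "t k l = (if l \<in> keys (\<mu> - \<epsilon> k) \<and> l \<noteq> k then g k l else 0)" for k l
  have "scl (sg k (insert k N)) (KK x (insert k N) (\<mu> - \<epsilon> k)) = (\<Sum>l\<in>?A. t k l)" for k
  proof -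
    have sub: "keys (\<mu> - \<epsilon> k) \<subseteq> keys \<mu>" by (auto simp: in_keys_iff lookup_minus)
    have "scl (sg k (insert k N)) (KK x (insert k N) (\<mu> - \<epsilon> k))
        = (\<Sum>l\<in>keys (\<mu> - \<epsilon> k) - insert k N. g k l)"
      by (simp add: KK_def scl_sum g_def)
    also have "\<dots> = (\<Sum>l\<in>?A. t k l)"
      by (rule sum.mono_neutral_cong_left) (use sub in \<open>auto simp: t_def\<close>)
    finally show ?thesis .
  qed
  then have K: "KK (KK x) N \<mu> = (\<Sum>k\<in>?A. \<Sum>l\<in>?A. t k l)" by (simp add: KK_def[of "KK x"])
  have anti: "t k l = - t l k" if "k \<in> ?A" "l \<in> ?A" for k l
  proof (cases "k = l")
    case False
    have "l \<in> keys (\<mu> - \<epsilon> k)" "k \<in> keys (\<mu> - \<epsilon> l)"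
      using that False by (auto simp: in_keys_iff lookup_minus lookup_single)
    moreover have "\<mu> - \<epsilon> k - \<epsilon> l = \<mu> - \<epsilon> l - \<epsilon> k"
      by (rule poly_mapping_eqI) (simp add: lookup_minus)
    moreover have "sg k (insert k N) * sg l (insert l (insert k N)) = - (sg l (insert l N) * sg k (insert k (insert l N)))"
      by (rule sg_anticommute) (use that N False in auto)
    ultimately show ?thesis
      using False by (simp add: t_def g_def insert_commute[of l k] scl_neg_left)
  qed (simp add: t_def)
  have "(\<Sum>k\<in>?A. \<Sum>l\<in>?A. t k l) = (\<Sum>k\<in>?A. \<Sum>l\<in>?A. - t l k)"
    by (intro sum.cong refl anti)
  also have "\<dots> = - (\<Sum>k\<in>?A. \<Sum>l\<in>?A. t k l)"
    unfolding sum_negf by (subst sum.swap) (rule refl)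
  finally have "scl 2 (\<Sum>k\<in>?A. \<Sum>l\<in>?A. t k l) = 0"
    using scl_add_left[of 1 1 "\<Sum>k\<in>?A. \<Sum>l\<in>?A. t k l"] by (simp add: eq_neg_iff_add_eq_0)
  then have "scl (1/2) (scl 2 (\<Sum>k\<in>?A. \<Sum>l\<in>?A. t k l)) = 0" by simp
  then show ?thesis by (simp add: K)
qed

lemma KK_add: "KK (\<lambda>N \<mu>. x N \<mu> + y N \<mu>) N \<mu> = KK x N \<mu> + KK y N \<mu>"
  by (simp add: KK_def scl_add_right sum.distrib)

lemma KK_scl: "KK (\<lambda>N \<mu>. scl c (x N \<mu>)) N \<mu> = scl c (KK x N \<mu>)"
  by (simp add: KK_def scl_sum mult.commute)

end

section \<open>Quotient spaces\<close>

lemma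
  assumes M: "module R M" and N: "submodule N R M"
  shows quot_carrier: "carrier (quot_module M N) = (\<lambda>x. N +>\<^bsub>M\<^esub> x) ` carrier M"
    and quot_eq_iff: "\<And>x y. x \<in> carrier M \<Longrightarrow> y \<in> carrier M \<Longrightarrow>
      N +>\<^bsub>M\<^esub> x = N +>\<^bsub>M\<^esub> y \<longleftrightarrow> x \<ominus>\<^bsub>M\<^esub> y \<in> N"
    and quot_add: "\<And>x y. x \<in> carrier M \<Longrightarrow> y \<in> carrier M \<Longrightarrow>
      (N +>\<^bsub>M\<^esub> x) \<oplus>\<^bsub>quot_module M N\<^esub> (N +>\<^bsub>M\<^esub> y) = N +>\<^bsub>M\<^esub> (x \<oplus>\<^bsub>M\<^esub> y)"
    and quot_zero: "\<zero>\<^bsub>quot_module M N\<^esub> = N +>\<^bsub>M\<^esub> \<zero>\<^bsub>M\<^esub>"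
    and quot_smult: "\<And>a x. a \<in> carrier R \<Longrightarrow> x \<in> carrier M \<Longrightarrow>
      a \<odot>\<^bsub>quot_module M N\<^esub> (N +>\<^bsub>M\<^esub> x) = N +>\<^bsub>M\<^esub> (a \<odot>\<^bsub>M\<^esub> x)"
proof -
  interpret module R M by fact
  have subg: "subgroup N (add_monoid M)" using N by (rule submodule.axioms(1))
  interpret N: abelian_subgroup N M
    by (rule abelian_subgroupI3[OF _ M.abelian_group_axioms])
      (rule additive_subgroup.intro[OF subg])
  show "carrier (quot_module M N) = (\<lambda>x. N +>\<^bsub>M\<^esub> x) ` carrier M"
    by (auto simp: quot_module_def A_RCOSETS_def')
  show eq: "N +>\<^bsub>M\<^esub> x = N +>\<^bsub>M\<^esub> y \<longleftrightarrow> x \<ominus>\<^bsub>M\<^esub> y \<in> N" if "x \<in> carrier M" "y \<in> carrier M" for x y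
  proof
    assume "N +>\<^bsub>M\<^esub> x = N +>\<^bsub>M\<^esub> y"
    then have "x \<in> N +>\<^bsub>M\<^esub> y" using N.a_rcos_self[OF that(1)] by simp
    then show "x \<ominus>\<^bsub>M\<^esub> y \<in> N" using N.a_rcos_module[OF that(2,1)] by (simp add: M.minus_eq)
  next
    assume "x \<ominus>\<^bsub>M\<^esub> y \<in> N"
    then have "x \<in> N +>\<^bsub>M\<^esub> y" using N.a_rcos_module[OF that(2,1)] by (simp add: M.minus_eq)
    then show "N +>\<^bsub>M\<^esub> x = N +>\<^bsub>M\<^esub> y" using N.a_repr_independence'[of x y] that(2) by simp
  qed
  show "(N +>\<^bsub>M\<^esub> x) \<oplus>\<^bsub>quot_module M N\<^esub> (N +>\<^bsub>M\<^esub> y) = N +>\<^bsub>M\<^esub> (x \<oplus>\<^bsub>M\<^esub> y)"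
    if "x \<in> carrier M" "y \<in> carrier M" for x y
    using N.a_rcos_sum[OF that] by (simp add: quot_module_def)
  show "\<zero>\<^bsub>quot_module M N\<^esub> = N +>\<^bsub>M\<^esub> \<zero>\<^bsub>M\<^esub>"
    using N.a_subset by (simp add: quot_module_def)
  show "a \<odot>\<^bsub>quot_module M N\<^esub> (N +>\<^bsub>M\<^esub> x) = N +>\<^bsub>M\<^esub> (a \<odot>\<^bsub>M\<^esub> x)"
    if ax: "a \<in> carrier R" "x \<in> carrier M" for a x
  proof -
    have "N +>\<^bsub>M\<^esub> (a \<odot>\<^bsub>M\<^esub> y) = N +>\<^bsub>M\<^esub> (a \<odot>\<^bsub>M\<^esub> x)" if y: "y \<in> N +>\<^bsub>M\<^esub> x" for y
    proof -
      obtain n where n: "n \<in> N" "y = n \<oplus>\<^bsub>M\<^esub> x"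
        using y by (auto simp: a_r_coset_def')
      have nc: "n \<in> carrier M" using N.a_Hcarr n(1) by blast
      have an: "a \<odot>\<^bsub>M\<^esub> n \<in> N" using submodule.smult_closed[OF N ax(1) n(1)] .
      have "a \<odot>\<^bsub>M\<^esub> y = (a \<odot>\<^bsub>M\<^esub> n) \<oplus>\<^bsub>M\<^esub> (a \<odot>\<^bsub>M\<^esub> x)"
        using n(2) nc ax by (simp add: smult_r_distr)
      then have "a \<odot>\<^bsub>M\<^esub> y \<in> N +>\<^bsub>M\<^esub> (a \<odot>\<^bsub>M\<^esub> x)"
        using an by (auto simp: a_r_coset_def')
      then show ?thesis
        using N.a_repr_independence'[of "a \<odot>\<^bsub>M\<^esub> y" "a \<odot>\<^bsub>M\<^esub> x"] ax by simp
    qed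
    then have "(\<Union>y\<in>N +>\<^bsub>M\<^esub> x. N +>\<^bsub>M\<^esub> (a \<odot>\<^bsub>M\<^esub> y)) = (\<Union>y\<in>N +>\<^bsub>M\<^esub> x. N +>\<^bsub>M\<^esub> (a \<odot>\<^bsub>M\<^esub> x))"
      by (intro SUP_cong refl)
    also have "\<dots> = N +>\<^bsub>M\<^esub> (a \<odot>\<^bsub>M\<^esub> x)"
      using N.a_rcos_self[OF ax(2)] by (intro SUP_const) blast
    finally show ?thesis by (simp add: quot_module_def)
  qed
qed

text \<open>The kernel condition gives both well-definedness and injectivity of the induced map;
  surjectivity is asked only modulo L.\<close>

lemma quot_module_iso:
  assumes M: "module R M" and K: "submodule K R M" and N: "module R N" and L: "submodule L R N"
    and \<phi>: "\<And>x. x \<in> carrier M \<Longrightarrow> \<phi> x \<in> carrier N"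
    and add: "\<And>x y. x \<in> carrier M \<Longrightarrow> y \<in> carrier M \<Longrightarrow> \<phi> (x \<oplus>\<^bsub>M\<^esub> y) = \<phi> x \<oplus>\<^bsub>N\<^esub> \<phi> y"
    and smult: "\<And>a x. a \<in> carrier R \<Longrightarrow> x \<in> carrier M \<Longrightarrow> \<phi> (a \<odot>\<^bsub>M\<^esub> x) = a \<odot>\<^bsub>N\<^esub> \<phi> x"
    and ker: "\<And>x. x \<in> carrier M \<Longrightarrow> \<phi> x \<in> L \<longleftrightarrow> x \<in> K"
    and surj: "\<And>y. y \<in> carrier N \<Longrightarrow> \<exists>x\<in>carrier M. y \<ominus>\<^bsub>N\<^esub> \<phi> x \<in> L"
  shows "linear_isos R (quot_module M K) (quot_module N L) \<noteq> {}"
proof -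
  interpret M: module R M by fact
  interpret N: module R N by fact
  let ?k = "\<lambda>x. K +>\<^bsub>M\<^esub> x" and ?l = "\<lambda>y. L +>\<^bsub>N\<^esub> y"
  define rep where "rep C = (SOME x. x \<in> carrier M \<and> ?k x = C)" for C
  define h where "h C = ?l (\<phi> (rep C))" for C
  have minus: "\<phi> (x \<ominus>\<^bsub>M\<^esub> y) = \<phi> x \<ominus>\<^bsub>N\<^esub> \<phi> y" if "x \<in> carrier M" "y \<in> carrier M" for x y
  proof -
    have "\<phi> (x \<ominus>\<^bsub>M\<^esub> y) \<oplus>\<^bsub>N\<^esub> \<phi> y = \<phi> (x \<ominus>\<^bsub>M\<^esub> y \<oplus>\<^bsub>M\<^esub> y)"
      using that by (simp add: add)
    also have "x \<ominus>\<^bsub>M\<^esub> y \<oplus>\<^bsub>M\<^esub> y = x"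
      using that by (simp add: M.minus_eq M.a_assoc M.l_neg)
    finally have "\<phi> x \<ominus>\<^bsub>N\<^esub> \<phi> y = \<phi> (x \<ominus>\<^bsub>M\<^esub> y) \<oplus>\<^bsub>N\<^esub> \<phi> y \<ominus>\<^bsub>N\<^esub> \<phi> y" by simp
    then show ?thesis using that \<phi> by (simp add: N.minus_eq N.a_assoc N.r_neg)
  qed
  have kl: "?k x = ?k y \<longleftrightarrow> ?l (\<phi> x) = ?l (\<phi> y)" if "x \<in> carrier M" "y \<in> carrier M" for x y
    using that by (simp add: quot_eq_iff[OF M K] quot_eq_iff[OF N L] \<phi> ker flip: minus)
  have h: "h (?k x) = ?l (\<phi> x)" if "x \<in> carrier M" for x
  proof -
    have "rep (?k x) \<in> carrier M \<and> ?k (rep (?k x)) = ?k x"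
      unfolding rep_def by (rule someI[of _ x]) (use that in simp)
    then show ?thesis unfolding h_def using kl that by blast
  qed
  have "inj_on h (carrier (quot_module M K))"
    unfolding inj_on_def quot_carrier[OF M K] by (simp add: h kl)
  moreover have "h ` carrier (quot_module M K) = carrier (quot_module N L)"
  proof -
    have "?l y \<in> (\<lambda>x. ?l (\<phi> x)) ` carrier M" if y: "y \<in> carrier N" for y
    proof -
      obtain x where "x \<in> carrier M" "y \<ominus>\<^bsub>N\<^esub> \<phi> x \<in> L" using surj[OF y] by blast
      then have "x \<in> carrier M" "?l y = ?l (\<phi> x)" using y \<phi> by (simp_all add: quot_eq_iff[OF N L])
      then show ?thesis by blast
    qed
    then have "?l ` carrier N = (\<lambda>x. ?l (\<phi> x)) ` carrier M" using \<phi> by blast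
    also have "\<dots> = h ` ?k ` carrier M" by (simp add: image_image h)
    finally show ?thesis by (simp add: quot_carrier[OF M K] quot_carrier[OF N L])
  qed
  moreover have "h (C \<oplus>\<^bsub>quot_module M K\<^esub> D) = h C \<oplus>\<^bsub>quot_module N L\<^esub> h D"
    if CD: "C \<in> carrier (quot_module M K)" "D \<in> carrier (quot_module M K)" for C D
  proof -
    obtain x y where "x \<in> carrier M" "y \<in> carrier M" "C = ?k x" "D = ?k y"
      using CD by (auto simp: quot_carrier[OF M K])
    then show ?thesis by (simp add: quot_add[OF M K] quot_add[OF N L] h add \<phi>)
  qed
  moreover have "h (a \<odot>\<^bsub>quot_module M K\<^esub> C) = a \<odot>\<^bsub>quot_module N L\<^esub> h C"
    if C: "a \<in> carrier R" "C \<in> carrier (quot_module M K)" for a C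
  proof -
    obtain x where "x \<in> carrier M" "C = ?k x" using C by (auto simp: quot_carrier[OF M K])
    then show ?thesis using C(1) by (simp add: quot_smult[OF M K] quot_smult[OF N L] h smult \<phi>)
  qed
  ultimately have "h \<in> linear_isos R (quot_module M K) (quot_module N L)"
    by (simp add: linear_isos_def bij_betw_def)
  then show ?thesis by blast
qed

section \<open>Cochains in coordinates\<close>

lemma complex_ring_simps [simp]:
  "carrier complex_ring = UNIV" "one complex_ring = 1" "zero complex_ring = 0"
  "add complex_ring = (+)" "monoid.mult complex_ring = (*)"
  by (simp_all add: ring_of_type_algebra_def)

lemma complex_module_a_inv:
  assumes "module complex_ring M" "x \<in> carrier M"
  shows "\<ominus>\<^bsub>M\<^esub> x = (-1) \<odot>\<^bsub>M\<^esub> x"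
proof -
  interpret module complex_ring M by fact
  have "((-1) \<odot>\<^bsub>M\<^esub> x) \<oplus>\<^bsub>M\<^esub> x = ((-1) \<oplus>\<^bsub>complex_ring\<^esub> 1) \<odot>\<^bsub>M\<^esub> x"
    using assms(2) smult_l_distr[of "-1" 1 x] smult_one[of x] by simp
  also have "\<dots> = \<zero>\<^bsub>M\<^esub>" using smult_l_null[of x] assms(2) by simp
  finally show ?thesis using assms(2) by (intro M.minus_equality) simp_all
qed

lemma complex_submoduleI:
  assumes M: "module complex_ring M" and "H \<subseteq> carrier M" "\<zero>\<^bsub>M\<^esub> \<in> H"
    and "\<And>a b. a \<in> H \<Longrightarrow> b \<in> H \<Longrightarrow> a \<oplus>\<^bsub>M\<^esub> b \<in> H" "\<And>c a. a \<in> H \<Longrightarrow> c \<odot>\<^bsub>M\<^esub> a \<in> H"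
  shows "submodule H complex_ring M"
proof (rule module.submoduleI[OF M])
  show "\<ominus>\<^bsub>M\<^esub> a \<in> H" if "a \<in> H" for a
    using complex_module_a_inv[OF M, of a] assms(2,5) that by auto
qed (use assms in auto)

lemma free_space_simps [simp]:
  "carrier (free_space S) = S" "zero (free_space S) = 0" "add (free_space S) = (+)"
  "module.smult (free_space S) = scl"
  by (simp_all add: free_space_def)

lemma module_free_space_on:
  assumes "0 \<in> S" "\<And>a b. a \<in> S \<Longrightarrow> b \<in> S \<Longrightarrow> a + b \<in> S" "\<And>c a. a \<in> S \<Longrightarrow> scl c a \<in> S"
  shows "module complex_ring (free_space S)"
proof -
  have "submodule S complex_ring (free_space UNIV)"
    by (rule complex_submoduleI[OF module_free_space]) (use assms in auto)
  from submodule.submodule_is_module[OF this module_free_space] show ?thesis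
    by (simp add: free_space_def)
qed

lemma free_space_minus:
  assumes "module complex_ring (free_space S)" "x \<in> S" "y \<in> S"
  shows "x \<ominus>\<^bsub>free_space S\<^esub> y = x - y"
proof -
  have "scl (-1) y = - y" by (simp add: scl_neg_left)
  then show ?thesis
    using complex_module_a_inv[OF assms(1), of y] assms(3) by (simp add: a_minus_def)
qed

section \<open>Cosets and their coordinates\<close>

definition cl :: "int \<Rightarrow> complex bpoly \<Rightarrow> complex bpoly set" where
  "cl m P = relations m +>\<^bsub>free_space UNIV\<^esub> P"

lemma submodule_relations: "submodule (relations m) complex_ring (free_space UNIV)"
  by (rule complex_submoduleI[OF module_free_space])
    (auto simp: theta_eq_0_iff[symmetric] theta_add theta_scl)

lemma module_A_space: "module complex_ring (A_space m)"
  unfolding A_space_def by (rule module_quot_module[OF module_free_space submodule_relations])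

lemma A_carrier: "carrier (A_space m) = range (cl m)"
  using quot_carrier[OF module_free_space submodule_relations[of m]] by (simp add: A_space_def cl_def)

lemma theta_diff: "theta m (P - Q) \<mu> = theta m P \<mu> - theta m Q \<mu>"
  using theta_add[of m "P - Q" Q \<mu>] by simp

lemma cl_eq_iff: "cl m P = cl m Q \<longleftrightarrow> (\<forall>\<mu>. theta m P \<mu> = theta m Q \<mu>)"
proof -
  have "cl m P = cl m Q \<longleftrightarrow> P - Q \<in> relations m"
    using quot_eq_iff[OF module_free_space submodule_relations[of m], of P Q]
      free_space_minus[OF module_free_space, of P Q] by (simp add: cl_def)
  then show ?thesis by (simp add: theta_eq_0_iff[symmetric] theta_diff)
qed

lemma cl_add: "cl m P \<oplus>\<^bsub>A_space m\<^esub> cl m Q = cl m (P + Q)"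
  using quot_add[OF module_free_space submodule_relations[of m], of P Q] by (simp add: cl_def A_space_def)

lemma cl_smult: "c \<odot>\<^bsub>A_space m\<^esub> cl m P = cl m (scl c P)"
  using quot_smult[OF module_free_space submodule_relations[of m], of c P] by (simp add: cl_def A_space_def)

lemma cl_zero: "\<zero>\<^bsub>A_space m\<^esub> = cl m 0"
  using quot_zero[OF module_free_space submodule_relations[of m]] by (simp add: cl_def A_space_def)

lemma cl_carrier [simp]: "cl m P \<in> carrier (A_space m)"
  by (simp add: A_carrier)

text \<open>Multiplication by an odd mode shifts the coordinates, so it respects the relations and
  all cosets in the defining union coincide.\<close>

lemma b_act_cl: "even k \<Longrightarrow> b_act m (Suc k) (cl m P) = cl m (bvar (Suc k) * P)"
proof -
  assume k: "even k"
  have "cl m (bvar (Suc k) * P') = cl m (bvar (Suc k) * P)" if "P' \<in> cl m P" for P'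
  proof -
    from that obtain r where r: "r \<in> relations m" "P' = r + P" by (auto simp: cl_def a_r_coset_def')
    then show ?thesis using k by (simp add: cl_eq_iff theta_bvar theta_add theta_eq_0_iff[symmetric])
  qed
  moreover have "P \<in> cl m P"
    using theta_eq_0_iff[of m 0] by (auto simp: cl_def a_r_coset_def' intro!: bexI[of _ 0])
  ultimately have "(\<Union>P'\<in>cl m P. cl m (bvar (Suc k) * P')) = cl m (bvar (Suc k) * P)" by blast
  then show ?thesis by (simp add: b_act_def cl_def)
qed

lemma finsum_cl:
  assumes "finite S"
  shows "finsum (A_space m) (\<lambda>i. cl m (P i)) S = cl m (\<Sum>i\<in>S. P i)"
proof -
  interpret A: module complex_ring "A_space m" by (rule module_A_space)
  show ?thesis using assms
    by induction (simp_all add: cl_zero cl_add)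
qed

definition th :: "int \<Rightarrow> complex bpoly set \<Rightarrow> (nat \<Rightarrow>\<^sub>0 nat) \<Rightarrow> fock" where
  "th m C = theta m (SOME P. cl m P = C)"

lemma th_cl: "th m (cl m P) = theta m P"
proof -
  have "cl m (SOME Q. cl m Q = cl m P) = cl m P" by (rule someI[of _ P]) simp
  then show ?thesis unfolding th_def cl_eq_iff by auto
qed

lemma th_eqI: "C \<in> carrier (A_space m) \<Longrightarrow> D \<in> carrier (A_space m) \<Longrightarrow> (\<And>\<mu>. th m C \<mu> = th m D \<mu>) \<Longrightarrow> C = D"
  unfolding A_carrier by (elim rangeE) (simp add: th_cl cl_eq_iff)

lemma th_add: "C \<in> carrier (A_space m) \<Longrightarrow> D \<in> carrier (A_space m) \<Longrightarrow>
    th m (C \<oplus>\<^bsub>A_space m\<^esub> D) \<mu> = th m C \<mu> + th m D \<mu>"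
  by (auto simp: A_carrier th_cl cl_add theta_add)

lemma th_smult: "C \<in> carrier (A_space m) \<Longrightarrow> th m (c \<odot>\<^bsub>A_space m\<^esub> C) \<mu> = scl c (th m C \<mu>)"
  by (auto simp: A_carrier th_cl cl_smult theta_scl)

lemma th_zero [simp]: "th m (\<zero>\<^bsub>A_space m\<^esub>) \<mu> = 0"
  by (simp add: cl_zero th_cl)

lemma A_zero_iff: "C \<in> carrier (A_space m) \<Longrightarrow> C = \<zero>\<^bsub>A_space m\<^esub> \<longleftrightarrow> (\<forall>\<mu>. th m C \<mu> = 0)"
  unfolding A_carrier by (elim rangeE) (simp only: th_cl cl_zero cl_eq_iff theta_zero)

text \<open>The index of the form dual to variable k, which stands for b_-(k+1). Odd negative
  indices correspond to even k, and the order is reversed.\<close>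

definition idx :: "nat \<Rightarrow> int" where
  "idx k = - int k - 1"

lemma inj_idx: "inj idx"
  by (rule injI) (simp add: idx_def)

lemma idx_odd_neg: "idx k \<in> odd_neg \<longleftrightarrow> even k"
  by (simp add: idx_def odd_neg_def)

lemma odd_neg_idx: "i \<in> odd_neg \<Longrightarrow> \<exists>k. even k \<and> i = idx k"
  by (rule exI[of _ "nat (- i - 1)"]) (auto simp: odd_neg_def idx_def even_nat_iff)

lemma wedge_basis_idx: "idx ` N \<in> wedge_basis p \<longleftrightarrow> finite N \<and> card N = p \<and> (\<forall>k\<in>N. even k)"
  using inj_idx by (auto simp: wedge_basis_def card_image inj_on_subset finite_image_iff idx_odd_neg)

lemma wedge_basis_obtain:
  assumes "I \<in> wedge_basis p" obtains N where "I = idx ` N" "finite N" "card N = p" "\<forall>k\<in>N. even k"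
proof -
  have "I = idx ` (idx -` I)" using assms odd_neg_idx by (fastforce simp: wedge_basis_def)
  then show ?thesis using that assms wedge_basis_idx by metis
qed

text \<open>The parity of the exponent in \<open>wedge_sign\<close>, with a sum in place of the
  difference so that no truncated subtraction occurs in the sign identities.\<close>

definition sg :: "nat \<Rightarrow> nat set \<Rightarrow> complex" where
  "sg k N = (-1) ^ (k div 2 + card {j\<in>N. j < k})"

interpretation koszul sg
proof
  show "sg k N * sg k N = 1" for k N
    unfolding sg_def by (rule minus_one_power_square)
  fix N :: "nat set" and i k
  assume N: "finite N" and i: "i \<in> N" and k: "k \<notin> N"
  have ik: "i \<noteq> k" using i k by auto
  have 1: "{j\<in>insert k N. j < k} = {j\<in>N. j < k}" by auto
  have 2: "{j\<in>insert k N. j < i} = (if k < i then insert k {j\<in>N. j < i} else {j\<in>N. j < i})" by auto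
  have 3: "{j\<in>N. j < k} = (if i < k then insert i {j\<in>insert k (N - {i}). j < k} else {j\<in>insert k (N - {i}). j < k})"
    using i ik by auto
  have c2: "card {j\<in>insert k N. j < i} = (if k < i then Suc (card {j\<in>N. j < i}) else card {j\<in>N. j < i})"
    unfolding 2 using N k by simp
  have c3: "card {j\<in>N. j < k} = (if i < k then Suc (card {j\<in>insert k (N - {i}). j < k}) else card {j\<in>insert k (N - {i}). j < k})"
    unfolding 3 using N ik by simp
  show "sg k (insert k N) * sg i (insert k N) = - (sg i N * sg k (insert k (N - {i})))"
  proof (cases "k < i")
    case True
    then have "\<not> i < k" by simp
    then show ?thesis using True unfolding sg_def 1 c2 c3 by (simp add: power_add)
  next
    case False
    then have "i < k" using ik by simp
    then show ?thesis using False unfolding sg_def 1 c2 c3 by (simp add: power_add)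
  qed
qed

lemma wedge_sign_idx:
  assumes "even k" "\<forall>j\<in>N. even j" "finite N"
  shows "wedge_sign (idx k) (idx ` N) = sg k N"
proof -
  have "{j\<in>idx ` N. idx k < j} = idx ` {j\<in>N. j < k}" by (auto simp: idx_def)
  then have c: "card {j\<in>idx ` N. idx k < j} = card {j\<in>N. j < k}"
    using inj_idx by (simp add: card_image inj_on_subset)
  have "nat ((- idx k - 1) div 2) = k div 2" by (simp add: idx_def nat_div_distrib)
  \<comment> \<open>All elements of N are even, so at most k/2 lie below k and the subtraction in
    \<open>wedge_sign\<close> does not truncate.\<close>
  moreover have "card {j\<in>N. j < k} \<le> k div 2"
  proof -
    have "{j\<in>N. j < k} \<subseteq> (\<lambda>j. 2 * j) ` {..<k div 2}"
      using assms(1,2) by (auto elim!: evenE)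
    then have "card {j\<in>N. j < k} \<le> card ((\<lambda>j. 2 * j) ` {..<k div 2})" by (rule card_mono[rotated]) simp
    also have "\<dots> \<le> card {..<k div 2}" by (rule card_image_le) simp
    finally show ?thesis by simp
  qed
  moreover have "(-1) ^ (a - b) = ((-1) ^ (a + b) :: complex)" if "b \<le> a" for a b :: nat
  proof -
    have "a + b = (a - b) + 2 * b" using that by simp
    then show ?thesis by (simp only: power_add power_mult) simp
  qed
  ultimately show ?thesis by (simp add: wedge_sign_def sg_def c)
qed

section \<open>Cochain modules and the differential in coordinates\<close>

lemma cochain_simps [simp]:
  "zero (cochains m p) = (\<lambda>I. \<zero>\<^bsub>A_space m\<^esub>)"
  "add (cochains m p) = (\<lambda>f g I. f I \<oplus>\<^bsub>A_space m\<^esub> g I)"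
  "module.smult (cochains m p) = (\<lambda>c f I. c \<odot>\<^bsub>A_space m\<^esub> f I)"
  by (simp_all add: cochains_def)

lemma cochains_carrier: "f \<in> carrier (cochains m p) \<longleftrightarrow> (\<forall>I. f I \<in> carrier (A_space m))
    \<and> finite {I. f I \<noteq> \<zero>\<^bsub>A_space m\<^esub>} \<and> (\<forall>I. f I \<noteq> \<zero>\<^bsub>A_space m\<^esub> \<longrightarrow> I \<in> wedge_basis p)"
  by (auto simp: cochains_def)

lemma cochain_support: "f \<in> carrier (cochains m p) \<Longrightarrow> f I \<noteq> \<zero>\<^bsub>A_space m\<^esub> \<Longrightarrow> I \<in> wedge_basis p"
  and cochain_finite: "f \<in> carrier (cochains m p) \<Longrightarrow> finite {I. f I \<noteq> \<zero>\<^bsub>A_space m\<^esub>}"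
  by (auto simp: cochains_def)

lemma module_cochains: "module complex_ring (cochains m p)"
proof -
  interpret A: module complex_ring "A_space m" by (rule module_A_space)
  have c: "f I \<in> carrier (A_space m)" if "f \<in> carrier (cochains m p)" for f I
    using that by (simp add: cochains_carrier)
  have add: "(\<lambda>I. f I \<oplus>\<^bsub>A_space m\<^esub> g I) \<in> carrier (cochains m p)"
    if f: "f \<in> carrier (cochains m p)" and g: "g \<in> carrier (cochains m p)" for f g
  proof -
    have z: "f I \<noteq> \<zero>\<^bsub>A_space m\<^esub> \<or> g I \<noteq> \<zero>\<^bsub>A_space m\<^esub>" if "f I \<oplus>\<^bsub>A_space m\<^esub> g I \<noteq> \<zero>\<^bsub>A_space m\<^esub>" for I
      using that by auto
    show ?thesis unfolding cochains_carrier
    proof (intro conjI allI impI)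
      show "f I \<oplus>\<^bsub>A_space m\<^esub> g I \<in> carrier (A_space m)" for I using c[OF f] c[OF g] by simp
      show "finite {I. f I \<oplus>\<^bsub>A_space m\<^esub> g I \<noteq> \<zero>\<^bsub>A_space m\<^esub>}"
        by (rule finite_subset[OF _ finite_UnI[OF cochain_finite[OF f] cochain_finite[OF g]]]) (use z in blast)
      show "I \<in> wedge_basis p" if "f I \<oplus>\<^bsub>A_space m\<^esub> g I \<noteq> \<zero>\<^bsub>A_space m\<^esub>" for I
        using z[OF that] cochain_support[OF f] cochain_support[OF g] by blast
    qed
  qed
  have smult: "(\<lambda>I. a \<odot>\<^bsub>A_space m\<^esub> f I) \<in> carrier (cochains m p)"
    if f: "f \<in> carrier (cochains m p)" for f a
  proof -
    have z: "f I \<noteq> \<zero>\<^bsub>A_space m\<^esub>" if "a \<odot>\<^bsub>A_space m\<^esub> f I \<noteq> \<zero>\<^bsub>A_space m\<^esub>" for I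
      using that A.smult_r_null[of a] by fastforce
    show ?thesis unfolding cochains_carrier
    proof (intro conjI allI impI)
      show "a \<odot>\<^bsub>A_space m\<^esub> f I \<in> carrier (A_space m)" for I using c[OF f] by simp
      show "finite {I. a \<odot>\<^bsub>A_space m\<^esub> f I \<noteq> \<zero>\<^bsub>A_space m\<^esub>}"
        by (rule finite_subset[OF _ cochain_finite[OF f]]) (use z in blast)
      show "I \<in> wedge_basis p" if "a \<odot>\<^bsub>A_space m\<^esub> f I \<noteq> \<zero>\<^bsub>A_space m\<^esub>" for I
        by (rule cochain_support[OF f z[OF that]])
    qed
  qed
  show ?thesis
  proof (rule moduleI)
    show "cring complex_ring" by (rule cring_from_type_algebra)
    show "abelian_group (cochains m p)"
    proof (rule abelian_groupI)
      show "\<exists>g\<in>carrier (cochains m p). g \<oplus>\<^bsub>cochains m p\<^esub> f = \<zero>\<^bsub>cochains m p\<^esub>"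
        if f: "f \<in> carrier (cochains m p)" for f
      proof (rule bexI[OF _ smult[OF f, of "-1"]])
        have "((-1) \<odot>\<^bsub>A_space m\<^esub> f I) \<oplus>\<^bsub>A_space m\<^esub> f I = \<zero>\<^bsub>A_space m\<^esub>" for I
          using complex_module_a_inv[OF module_A_space c[OF f, of I]] A.M.l_neg[OF c[OF f, of I]] by simp
        then show "(\<lambda>I. (-1) \<odot>\<^bsub>A_space m\<^esub> f I) \<oplus>\<^bsub>cochains m p\<^esub> f = \<zero>\<^bsub>cochains m p\<^esub>" by simp
      qed
      show "\<zero>\<^bsub>cochains m p\<^esub> \<in> carrier (cochains m p)" by (simp add: cochains_carrier)
    qed (simp_all add: add c A.M.a_ac)
  next
    fix a b f g
    assume f: "f \<in> carrier (cochains m p)"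
    show "a \<odot>\<^bsub>cochains m p\<^esub> f \<in> carrier (cochains m p)"
      using smult[OF f] by simp
    show "(a \<oplus>\<^bsub>complex_ring\<^esub> b) \<odot>\<^bsub>cochains m p\<^esub> f
        = a \<odot>\<^bsub>cochains m p\<^esub> f \<oplus>\<^bsub>cochains m p\<^esub> b \<odot>\<^bsub>cochains m p\<^esub> f"
      using A.smult_l_distr[of a b, OF _ _ c[OF f]] by simp
    show "(a \<otimes>\<^bsub>complex_ring\<^esub> b) \<odot>\<^bsub>cochains m p\<^esub> f = a \<odot>\<^bsub>cochains m p\<^esub> (b \<odot>\<^bsub>cochains m p\<^esub> f)"
      using A.smult_assoc1[of a b, OF _ _ c[OF f]] by simp
    show "\<one>\<^bsub>complex_ring\<^esub> \<odot>\<^bsub>cochains m p\<^esub> f = f"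
      using A.smult_one[OF c[OF f]] by simp
    assume g: "g \<in> carrier (cochains m p)"
    show "a \<odot>\<^bsub>cochains m p\<^esub> (f \<oplus>\<^bsub>cochains m p\<^esub> g)
        = a \<odot>\<^bsub>cochains m p\<^esub> f \<oplus>\<^bsub>cochains m p\<^esub> a \<odot>\<^bsub>cochains m p\<^esub> g"
      using A.smult_r_distr[of a, OF _ c[OF f] c[OF g]] by simp
  qed
qed

definition coord :: "int \<Rightarrow> (int set \<Rightarrow> complex bpoly set) \<Rightarrow> nat set \<Rightarrow> (nat \<Rightarrow>\<^sub>0 nat) \<Rightarrow> fock" where
  "coord m f N \<mu> = th m (f (idx ` N)) \<mu>"

lemma coord_add: "f \<in> carrier (cochains m p) \<Longrightarrow> g \<in> carrier (cochains m p) \<Longrightarrow>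
    coord m (f \<oplus>\<^bsub>cochains m p\<^esub> g) = (\<lambda>N \<mu>. coord m f N \<mu> + coord m g N \<mu>)"
  by (simp add: coord_def fun_eq_iff th_add cochains_carrier)

lemma coord_smult: "f \<in> carrier (cochains m p) \<Longrightarrow> coord m (c \<odot>\<^bsub>cochains m p\<^esub> f) = (\<lambda>N \<mu>. scl c (coord m f N \<mu>))"
  by (simp add: coord_def fun_eq_iff th_smult cochains_carrier)

lemma coord_zero: "coord m (\<lambda>I. \<zero>\<^bsub>A_space m\<^esub>) N \<mu> = 0"
  by (simp add: coord_def)

lemma cochain_eqI:
  assumes f: "f \<in> carrier (cochains m p)" and g: "g \<in> carrier (cochains m p)"
    and eq: "\<And>N \<mu>. finite N \<Longrightarrow> card N = p \<Longrightarrow> \<forall>k\<in>N. even k \<Longrightarrow> coord m f N \<mu> = coord m g N \<mu>"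
  shows "f = g"
proof
  fix I
  show "f I = g I"
  proof (cases "I \<in> wedge_basis p")
    case True
    then obtain N where "I = idx ` N" "finite N" "card N = p" "\<forall>k\<in>N. even k" by (rule wedge_basis_obtain)
    then show ?thesis
      using eq[of N] f g by (intro th_eqI[of _ m]) (auto simp: cochains_carrier coord_def)
  next
    case False
    then show ?thesis using f g unfolding cochains_carrier by metis
  qed
qed

lemma de_rham_index_finite:
  assumes f: "f \<in> carrier (cochains m p)"
  shows "finite {i\<in>odd_neg - J. f (insert i J) \<noteq> \<zero>\<^bsub>A_space m\<^esub>}"
proof (rule finite_imageD)
  show "finite ((\<lambda>i. insert i J) ` {i\<in>odd_neg - J. f (insert i J) \<noteq> \<zero>\<^bsub>A_space m\<^esub>})"
    by (rule finite_subset[of _ "{I. f I \<noteq> \<zero>\<^bsub>A_space m\<^esub>}"]) (use f in \<open>auto simp: cochains_carrier\<close>)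
  show "inj_on (\<lambda>i. insert i J) {i\<in>odd_neg - J. f (insert i J) \<noteq> \<zero>\<^bsub>A_space m\<^esub>}"
    by (rule inj_onI) blast
qed

lemma de_rham_eq:
  assumes f: "f \<in> carrier (cochains m p)"
  shows "de_rham_d m f J = cl m (\<Sum>i\<in>{i\<in>odd_neg - J. f (insert i J) \<noteq> \<zero>\<^bsub>A_space m\<^esub>}.
    scl (wedge_sign i (insert i J)) (bvar (nat (- i)) * (SOME P. cl m P = f (insert i J))))"
proof -
  let ?S = "{i\<in>odd_neg - J. f (insert i J) \<noteq> \<zero>\<^bsub>A_space m\<^esub>}"
  interpret A: module complex_ring "A_space m" by (rule module_A_space)
  have t: "wedge_sign i (insert i J) \<odot>\<^bsub>A_space m\<^esub> b_act m (nat (- i)) (f (insert i J))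
      = cl m (scl (wedge_sign i (insert i J)) (bvar (nat (- i)) * (SOME P. cl m P = f (insert i J))))"
    if "i \<in> ?S" for i
  proof -
    have "f (insert i J) \<in> range (cl m)" using f by (auto simp: cochains_carrier simp flip: A_carrier)
    then have "cl m (SOME P. cl m P = f (insert i J)) = f (insert i J)"
      by (intro someI_ex[of "\<lambda>P. cl m P = f (insert i J)"]) auto
    moreover obtain k where "even k" "i = idx k" using odd_neg_idx[of i] \<open>i \<in> ?S\<close> by auto
    moreover from this have "nat (- i) = Suc k" by (simp add: idx_def nat_add_distrib)
    ultimately show ?thesis using b_act_cl cl_smult by metis
  qed
  have "de_rham_d m f J = finsum (A_space m) (\<lambda>i. cl m (scl (wedge_sign i (insert i J))
      (bvar (nat (- i)) * (SOME P. cl m P = f (insert i J))))) ?S"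
    unfolding de_rham_d_def by (rule A.M.finsum_cong') (use t in auto)
  then show ?thesis by (simp only: finsum_cl[OF de_rham_index_finite[OF f]])
qed

text \<open>The support-based sum in \<open>de_rham_d\<close> and the exponent-based sum in
  \<open>KK\<close> agree: both reduce to those k where the cochain is nonzero and \<mu> contains
  variable k.\<close>

lemma coord_de_rham:
  assumes f: "f \<in> carrier (cochains m p)" and N: "finite N"
  shows "coord m (de_rham_d m f) N \<mu> = KK (coord m f) N \<mu>"
proof -
  let ?J = "idx ` N"
  let ?S = "{i\<in>odd_neg - ?J. f (insert i ?J) \<noteq> \<zero>\<^bsub>A_space m\<^esub>}"
  define T where "T = {k. k \<notin> N \<and> f (idx ` insert k N) \<noteq> \<zero>\<^bsub>A_space m\<^esub>}"
  have ev: "\<forall>j\<in>insert k N. even j" if "k \<in> T" for k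
    using that f wedge_basis_idx[of "insert k N" p] unfolding T_def cochains_carrier by blast
  have S: "?S = idx ` T"
  proof (intro equalityI subsetI)
    fix i assume i: "i \<in> ?S"
    then obtain k where "i = idx k" using odd_neg_idx by blast
    then show "i \<in> idx ` T" using i by (auto simp: T_def)
  next
    fix i assume "i \<in> idx ` T"
    then obtain k where k: "i = idx k" "k \<in> T" by blast
    then have "i \<in> odd_neg" using ev[of k] idx_odd_neg by auto
    moreover have "i \<notin> ?J" using k inj_idx by (auto simp: T_def inj_def)
    ultimately show "i \<in> ?S" using k by (auto simp: T_def)
  qed
  have finT: "finite T"
    using de_rham_index_finite[OF f, of ?J] inj_idx unfolding S by (simp add: finite_image_iff inj_on_subset)
  have zero: "coord m f (insert k N) \<nu> = 0" if "k \<notin> N" "k \<notin> T" for k \<nu>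
    using that by (simp add: T_def coord_def)
  have "coord m (de_rham_d m f) N \<mu> = (\<Sum>i\<in>?S. scl (wedge_sign i (insert i ?J))
      (theta m (bvar (nat (- i)) * (SOME P. cl m P = f (insert i ?J))) \<mu>))"
    by (simp add: coord_def de_rham_eq[OF f] th_cl theta_sum theta_scl)
  also have "\<dots> = (\<Sum>k\<in>T. scl (wedge_sign (idx k) (insert (idx k) ?J))
      (theta m (bvar (nat (- idx k)) * (SOME P. cl m P = f (insert (idx k) ?J))) \<mu>))"
    unfolding S using inj_idx by (simp add: sum.reindex inj_on_subset)
  also have "\<dots> = (\<Sum>k\<in>T. if lookup \<mu> k = 0 then 0
      else scl (sg k (insert k N)) (coord m f (insert k N) (\<mu> - \<epsilon> k)))"
  proof (intro sum.cong refl)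
    fix k assume k: "k \<in> T"
    have "wedge_sign (idx k) (insert (idx k) ?J) = sg k (insert k N)"
      using wedge_sign_idx[of k "insert k N"] ev[OF k] N by simp
    moreover have "nat (- idx k) = Suc k" by (simp add: idx_def nat_add_distrib)
    moreover have "theta m (bvar (Suc k) * (SOME P. cl m P = f (insert (idx k) ?J))) \<mu>
        = (if lookup \<mu> k = 0 then 0 else coord m f (insert k N) (\<mu> - \<epsilon> k))"
      using ev[OF k] by (simp add: theta_bvar coord_def th_def)
    ultimately show "scl (wedge_sign (idx k) (insert (idx k) ?J))
      (theta m (bvar (nat (- idx k)) * (SOME P. cl m P = f (insert (idx k) ?J))) \<mu>)
      = (if lookup \<mu> k = 0 then 0 else scl (sg k (insert k N)) (coord m f (insert k N) (\<mu> - \<epsilon> k)))"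
      by simp
  qed
  also have "\<dots> = (\<Sum>k\<in>T \<inter> keys \<mu>. scl (sg k (insert k N)) (coord m f (insert k N) (\<mu> - \<epsilon> k)))"
    by (rule sum.mono_neutral_cong_right[OF finT]) (auto simp: in_keys_iff)
  also have "\<dots> = KK (coord m f) N \<mu>"
    unfolding KK_def by (rule sum.mono_neutral_left) (use zero in \<open>auto simp: T_def\<close>)
  finally show ?thesis .
qed

lemma de_rham_support:
  assumes f: "f \<in> carrier (cochains m p)" and J: "de_rham_d m f J \<noteq> \<zero>\<^bsub>A_space m\<^esub>"
  shows "\<exists>i\<in>odd_neg - J. f (insert i J) \<noteq> \<zero>\<^bsub>A_space m\<^esub>"
proof (rule ccontr)
  assume "\<not> ?thesis"
  then have "{i\<in>odd_neg - J. f (insert i J) \<noteq> \<zero>\<^bsub>A_space m\<^esub>} = {}" by blast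
  then have "de_rham_d m f J = cl m 0" by (simp only: de_rham_eq[OF f] sum.empty)
  then show False using J by (simp only: cl_zero)
qed

lemma de_rham_carrier:
  assumes f: "f \<in> carrier (cochains m (p + 1))"
  shows "de_rham_d m f \<in> carrier (cochains m p)"
proof -
  have sub: "{J. de_rham_d m f J \<noteq> \<zero>\<^bsub>A_space m\<^esub>} \<subseteq> (\<Union>I\<in>{I. f I \<noteq> \<zero>\<^bsub>A_space m\<^esub>}. (\<lambda>i. I - {i}) ` I)"
  proof
    fix J assume "J \<in> {J. de_rham_d m f J \<noteq> \<zero>\<^bsub>A_space m\<^esub>}"
    then obtain i where "i \<notin> J" "f (insert i J) \<noteq> \<zero>\<^bsub>A_space m\<^esub>" using de_rham_support[OF f] by blast
    moreover from this have "J = insert i J - {i}" by simp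
    ultimately show "J \<in> (\<Union>I\<in>{I. f I \<noteq> \<zero>\<^bsub>A_space m\<^esub>}. (\<lambda>i. I - {i}) ` I)" by blast
  qed
  have "finite (\<Union>I\<in>{I. f I \<noteq> \<zero>\<^bsub>A_space m\<^esub>}. (\<lambda>i. I - {i}) ` I)"
    using f by (auto simp: cochains_carrier wedge_basis_def)
  then have "finite {J. de_rham_d m f J \<noteq> \<zero>\<^bsub>A_space m\<^esub>}" by (rule finite_subset[OF sub])
  moreover have "J \<in> wedge_basis p" if nz: "de_rham_d m f J \<noteq> \<zero>\<^bsub>A_space m\<^esub>" for J
  proof -
    obtain i where i: "i \<notin> J" "f (insert i J) \<noteq> \<zero>\<^bsub>A_space m\<^esub>" using de_rham_support[OF f nz] by blast
    then have "insert i J \<in> wedge_basis (p + 1)" using f by (simp add: cochains_carrier)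
    then show ?thesis using i(1) by (auto simp: wedge_basis_def)
  qed
  ultimately show ?thesis unfolding cochains_carrier using de_rham_eq[OF f] by simp
qed

lemma cocycles_iff:
  "f \<in> cocycles m p \<longleftrightarrow> f \<in> carrier (cochains m p) \<and> (\<forall>N \<mu>. finite N \<longrightarrow> KK (coord m f) N \<mu> = 0)"
proof (cases "f \<in> carrier (cochains m p)")
  case f: True
  have "de_rham_d m f J = \<zero>\<^bsub>A_space m\<^esub>" if z: "\<And>N \<mu>. finite N \<Longrightarrow> KK (coord m f) N \<mu> = 0" for J
  proof (rule ccontr)
    assume nz: "de_rham_d m f J \<noteq> \<zero>\<^bsub>A_space m\<^esub>"
    then obtain i where "f (insert i J) \<noteq> \<zero>\<^bsub>A_space m\<^esub>" using de_rham_support[OF f] by blast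
    then have "insert i J \<in> wedge_basis p" using f by (simp add: cochains_carrier)
    then have "J \<in> wedge_basis (card J)" by (auto simp: wedge_basis_def)
    then obtain N where N: "J = idx ` N" "finite N" using wedge_basis_obtain by metis
    have "th m (de_rham_d m f J) \<mu> = 0" for \<mu>
      using coord_de_rham[OF f N(2), of \<mu>] z[OF N(2)] N(1) by (simp add: coord_def)
    then show False using nz A_zero_iff[of "de_rham_d m f J" m] by (simp add: de_rham_eq[OF f])
  qed
  moreover have "KK (coord m f) N \<mu> = 0" if "de_rham_d m f = (\<lambda>I. \<zero>\<^bsub>A_space m\<^esub>)" "finite N" for N \<mu>
    using coord_de_rham[OF f that(2), of \<mu>] that(1) by (simp add: coord_zero)
  ultimately show ?thesis using f by (auto simp: cocycles_def fun_eq_iff)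
qed (simp add: cocycles_def)

lemma submodule_cocycles: "submodule (cocycles m p) complex_ring (cochains m p)"
proof (rule complex_submoduleI[OF module_cochains])
  interpret C: module complex_ring "cochains m p" by (rule module_cochains)
  show "cocycles m p \<subseteq> carrier (cochains m p)" by (auto simp: cocycles_def)
  have "KK (coord m (\<zero>\<^bsub>cochains m p\<^esub>)) N \<mu> = 0" for N \<mu> by (simp add: KK_def coord_zero)
  then show "\<zero>\<^bsub>cochains m p\<^esub> \<in> cocycles m p"
    unfolding cocycles_iff using C.M.zero_closed by blast
  show "f \<oplus>\<^bsub>cochains m p\<^esub> g \<in> cocycles m p" if "f \<in> cocycles m p" "g \<in> cocycles m p" for f g
    using that C.M.a_closed[of f g] coord_add[of f m p g] unfolding cocycles_iff by (simp only: KK_add) simp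
  show "c \<odot>\<^bsub>cochains m p\<^esub> f \<in> cocycles m p" if "f \<in> cocycles m p" for c f
    using that C.smult_closed[of c f] coord_smult[of f m p c] unfolding cocycles_iff by (simp only: KK_scl) simp
qed

section \<open>Realizing the homotopy by cochains\<close>

lemma coord_kappa: "coord m f N \<mu> \<in> kappa m ` Fock m"
  by (simp add: coord_def th_def theta_kappa)

lemma kappa_image_scl: "v \<in> kappa m ` Fock m \<Longrightarrow> scl c v \<in> kappa m ` Fock m"
  by (auto simp flip: kappa_scl intro: Fock_scl)

lemma kappa_image_zero: "0 \<in> kappa m ` Fock m"
  by (rule image_eqI[of _ _ 0]) simp_all

lemma kappa_image_add:
  assumes "v \<in> kappa m ` Fock m" "w \<in> kappa m ` Fock m" shows "v + w \<in> kappa m ` Fock m"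
proof -
  obtain a b where "v = kappa m a" "a \<in> Fock m" "w = kappa m b" "b \<in> Fock m" using assms by blast
  then have "v + w = kappa m (a + b)" "a + b \<in> Fock m" by (simp_all add: kappa_add Fock_add)
  then show ?thesis by blast
qed

lemma kappa_image_sum: "(\<And>x. x \<in> A \<Longrightarrow> f x \<in> kappa m ` Fock m) \<Longrightarrow> sum f A \<in> kappa m ` Fock m"
  by (induction A rule: infinite_finite_induct)
    (simp_all add: kappa_image_zero kappa_image_add)

lemma coord_finite: "finite {\<mu>. coord m f N \<mu> \<noteq> 0}"
  by (simp add: coord_def th_def theta_finite)

lemma coord_oddm: "coord m f N \<mu> \<noteq> 0 \<Longrightarrow> oddm \<mu>"
  by (simp add: coord_def th_def theta_oddm)

lemma HH_realized:
  assumes N: "finite N"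
  shows "\<exists>P. \<forall>\<mu>. theta m P \<mu> = HH (coord m f) N \<mu>"
proof (rule theta_surj)
  have nz: "\<exists>i\<in>N. coord m f (N - {i}) (\<mu> + \<epsilon> i) \<noteq> 0" if "HH (coord m f) N \<mu> \<noteq> 0" for \<mu>
  proof (rule ccontr)
    assume "\<not> ?thesis"
    then have "HH (coord m f) N \<mu> = 0" by (simp add: HH_def)
    with that show False ..
  qed
  have "finite (\<Union>i\<in>N. (\<lambda>\<mu>. \<mu> + \<epsilon> i) -` {\<mu>. coord m f (N - {i}) \<mu> \<noteq> 0})"
    using N by (intro finite_UN_I finite_vimageI coord_finite) (simp_all add: inj_def)
  then show "finite {\<mu>. HH (coord m f) N \<mu> \<noteq> 0}"
    by (rule finite_subset[rotated]) (use nz in auto)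
  show "HH (coord m f) N \<mu> \<in> kappa m ` Fock m" for \<mu>
    unfolding HH_def by (intro kappa_image_scl kappa_image_sum coord_kappa)
  show "oddm \<mu>" if h: "HH (coord m f) N \<mu> \<noteq> 0" for \<mu>
  proof -
    obtain i where "coord m f (N - {i}) (\<mu> + \<epsilon> i) \<noteq> 0" using nz[OF h] by blast
    then have "oddm (\<mu> + \<epsilon> i)" by (rule coord_oddm)
    then show ?thesis by (simp add: oddm_def lookup_add)
  qed
qed

text \<open>The Koszul homotopy yields a preimage in every bidegree except the constants at p = 0,
  where the differential has no component.\<close>

lemma coboundaries_iff:
  "f \<in> de_rham_d m ` carrier (cochains m (p + 1)) \<longleftrightarrow> f \<in> cocycles m p \<and> (p = 0 \<longrightarrow> coord m f {} 0 = 0)"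
proof
  assume "f \<in> de_rham_d m ` carrier (cochains m (p + 1))"
  then obtain g where g: "g \<in> carrier (cochains m (p + 1))" "f = de_rham_d m g" by blast
  have "KK (coord m f) N \<mu> = 0" if N: "finite N" for N \<mu>
  proof -
    have "KK (coord m f) N \<mu> = KK (KK (coord m g)) N \<mu>"
      unfolding KK_def[of "coord m f"] KK_def[of "KK (coord m g)"]
      by (intro sum.cong refl arg_cong[of _ _ "scl _"]) (simp only: g(2) coord_de_rham[OF g(1)] finite_insert N)
    then show ?thesis using KK_KK[OF N] by simp
  qed
  moreover have "coord m f {} 0 = 0"
    unfolding g(2) coord_de_rham[OF g(1) finite.emptyI] by (simp add: KK_def)
  ultimately show "f \<in> cocycles m p \<and> (p = 0 \<longrightarrow> coord m f {} 0 = 0)"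
    using de_rham_carrier[OF g(1)] g(2) by (auto simp: cocycles_iff)
next
  assume f: "f \<in> cocycles m p \<and> (p = 0 \<longrightarrow> coord m f {} 0 = 0)"
  then have fc: "f \<in> carrier (cochains m p)" by (simp add: cocycles_iff)
  have "\<forall>N. \<exists>P. finite N \<longrightarrow> (\<forall>\<mu>. theta m P \<mu> = HH (coord m f) N \<mu>)" using HH_realized by blast
  then obtain P where P: "\<And>N \<mu>. finite N \<Longrightarrow> theta m (P N) \<mu> = HH (coord m f) N \<mu>" by metis
  define g where "g I = (if I \<in> wedge_basis (p + 1) then cl m (P (idx -` I)) else \<zero>\<^bsub>A_space m\<^esub>)" for I
  have vim: "idx -` (idx ` N) = N" for N using inj_idx by (rule inj_vimage_image_eq)
  have Xg: "coord m g N \<mu> = HH (coord m f) N \<mu>" if "finite N" "card N = p + 1" "\<forall>k\<in>N. even k" for N \<mu>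
    using that wedge_basis_idx[of N "p + 1"] by (simp add: coord_def g_def vim th_cl P)
  have gA: "g I \<in> carrier (A_space m)" for I by (simp add: g_def cl_zero)
  have gc: "g \<in> carrier (cochains m (p + 1))"
  proof -
    \<comment> \<open>The support of g arises from that of f by adding an index i that occurs in an
      exponent of f, which leaves finitely many sets.\<close>
    let ?B = "\<Union>J\<in>{J. f J \<noteq> \<zero>\<^bsub>A_space m\<^esub>}. \<Union>\<mu>\<in>{\<mu>. th m (f J) \<mu> \<noteq> 0}. (\<lambda>i. insert (idx i) J) ` keys \<mu>"
    have "{I. g I \<noteq> \<zero>\<^bsub>A_space m\<^esub>} \<subseteq> ?B"
    proof
      fix I assume "I \<in> {I. g I \<noteq> \<zero>\<^bsub>A_space m\<^esub>}"
      then have nz: "g I \<noteq> \<zero>\<^bsub>A_space m\<^esub>" by simp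
      then have "I \<in> wedge_basis (p + 1)" by (auto simp: g_def)
      then obtain N where N: "I = idx ` N" "finite N" "card N = p + 1" "\<forall>k\<in>N. even k" by (rule wedge_basis_obtain)
      obtain \<mu> where "th m (g I) \<mu> \<noteq> 0" using nz A_zero_iff[OF gA] by blast
      then have "HH (coord m f) N \<mu> \<noteq> 0" using Xg[OF N(2-4), of \<mu>] N(1) by (simp add: coord_def)
      then obtain i where i: "i \<in> N" "coord m f (N - {i}) (\<mu> + \<epsilon> i) \<noteq> 0"
        unfolding HH_def by (metis (no_types, lifting) scl_zero_right sum.neutral)
      let ?J = "idx ` (N - {i})"
      have th: "th m (f ?J) (\<mu> + \<epsilon> i) \<noteq> 0" using i(2) by (simp add: coord_def)
      then have "f ?J \<noteq> \<zero>\<^bsub>A_space m\<^esub>" by (metis th_zero)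
      moreover have "i \<in> keys (\<mu> + \<epsilon> i)" by (simp add: in_keys_iff lookup_add)
      moreover have "I = insert (idx i) ?J" using N(1) i(1) by auto
      ultimately show "I \<in> ?B" using th by blast
    qed
    moreover have "finite ?B"
      using fc by (intro finite_UN_I finite_imageI finite_keys) (simp_all add: cochains_carrier th_def theta_finite)
    ultimately have "finite {I. g I \<noteq> \<zero>\<^bsub>A_space m\<^esub>}" by (rule finite_subset)
    then show ?thesis using gA by (auto simp: cochains_carrier g_def)
  qed
  have "de_rham_d m g = f"
  proof (rule cochain_eqI[OF de_rham_carrier[OF gc] fc])
    fix N \<mu> assume N: "finite N" "card N = p" "\<forall>k\<in>N. even (k::nat)"
    show "coord m (de_rham_d m g) N \<mu> = coord m f N \<mu>"
    proof (cases "oddm \<mu>")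
      case True
      have "KK (coord m g) N \<mu> = KK (HH (coord m f)) N \<mu>"
        unfolding KK_def
      proof (intro sum.cong refl arg_cong[of _ _ "scl _"])
        fix k assume k: "k \<in> keys \<mu> - N"
        \<comment> \<open>Monomials of \<open>D\<close> contain only even k, so the enlarged set
          still indexes a basis form and g has the prescribed coordinates there.\<close>
        then have "even k" using True by (auto simp: oddm_def in_keys_iff)
        then show "coord m g (insert k N) (\<mu> - \<epsilon> k) = HH (coord m f) (insert k N) (\<mu> - \<epsilon> k)"
          using N k by (intro Xg) auto
      qed
      moreover have "KK (HH (coord m f)) N \<mu> = coord m f N \<mu>"
      proof (cases "0 < mdeg \<mu> + card N")
        case True
        show ?thesis
          by (rule KK_HH[OF N(1) True]) (use f N(1) in \<open>simp add: cocycles_iff\<close>)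
      next
        case False
        \<comment> \<open>The excluded constants: here the assumption on the constant coordinate of
          f is used.\<close>
        then have "N = {}" "p = 0" "\<mu> = 0"
          using N by (auto simp: mdeg_def in_keys_iff intro: poly_mapping_eqI)
        then show ?thesis using f by (simp add: KK_def)
      qed
      ultimately show ?thesis using coord_de_rham[OF gc N(1)] by simp
    next
      case False
      then show ?thesis using coord_oddm by metis
    qed
  qed
  then show "f \<in> de_rham_d m ` carrier (cochains m (p + 1))" using gc by blast
qed

abbreviation cocycle_space :: "int \<Rightarrow> nat \<Rightarrow> (complex, int set \<Rightarrow> complex bpoly set) module" where
  "cocycle_space m p \<equiv> (cochains m p)\<lparr>carrier := cocycles m p\<rparr>"

lemma module_cocycle_space: "module complex_ring (cocycle_space m p)"
  by (rule submodule.submodule_is_module[OF submodule_cocycles module_cochains])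

lemma submodule_coboundaries:
  "submodule (de_rham_d m ` carrier (cochains m (p + 1))) complex_ring (cocycle_space m p)"
    (is "submodule ?B _ _")
proof (rule complex_submoduleI[OF module_cocycle_space])
  interpret Z: module complex_ring "cocycle_space m p" by (rule module_cocycle_space)
  have c: "f \<in> carrier (cochains m p)" if "f \<in> cocycles m p" for f using that by (simp add: cocycles_iff)
  show "?B \<subseteq> carrier (cocycle_space m p)" using coboundaries_iff[of _ m p] by auto
  show "\<zero>\<^bsub>cocycle_space m p\<^esub> \<in> ?B"
    unfolding coboundaries_iff using Z.M.zero_closed by (simp add: coord_zero)
  show "f \<oplus>\<^bsub>cocycle_space m p\<^esub> g \<in> ?B" if "f \<in> ?B" "g \<in> ?B" for f g
    using that Z.M.a_closed[of f g] coord_add[of f m p g] c unfolding coboundaries_iff by auto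
  show "a \<odot>\<^bsub>cocycle_space m p\<^esub> f \<in> ?B" if "f \<in> ?B" for a f
    using that Z.smult_closed[of a f] coord_smult[of f m p a] c unfolding coboundaries_iff by auto
qed

section \<open>The cohomology\<close>

lemma cohomology_positive:
  assumes "1 \<le> p" shows "carrier (cohomology m p) = {\<zero>\<^bsub>cohomology m p\<^esub>}"
proof -
  let ?B = "de_rham_d m ` carrier (cochains m (p + 1))"
  interpret Z: module complex_ring "cocycle_space m p" by (rule module_cocycle_space)
  have B: "?B = carrier (cocycle_space m p)" using assms coboundaries_iff[of _ m p] by auto
  have "?B +>\<^bsub>cocycle_space m p\<^esub> f = ?B +>\<^bsub>cocycle_space m p\<^esub> \<zero>\<^bsub>cocycle_space m p\<^esub>"
    if "f \<in> carrier (cocycle_space m p)" for f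
    using quot_eq_iff[OF module_cocycle_space submodule_coboundaries, of f m p "\<zero>\<^bsub>cocycle_space m p\<^esub>"] that
      Z.M.zero_closed Z.M.minus_closed[OF that Z.M.zero_closed] unfolding B by blast
  then show ?thesis
    unfolding cohomology_def quot_carrier[OF module_cocycle_space submodule_coboundaries]
      quot_zero[OF module_cocycle_space submodule_coboundaries]
    using Z.M.zero_closed by blast
qed

lemma module_fock_space: "module complex_ring (fock_space m)"
  unfolding fock_space_def
proof (rule module_free_space_on)
  show "v + w \<in> fock_span m" if "v \<in> fock_span m" "w \<in> fock_span m" for v w
    using that Poly_Mapping.keys_add[of v w] by (auto simp: fock_span_eq Fock_add)
qed (auto simp: fock_span_eq Fock_scl in_keys_iff)

lemma submodule_omega: "submodule (omega ` fock_span (m + 2)) complex_ring (fock_space m)"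
proof (rule complex_submoduleI[OF module_fock_space])
  interpret F: module complex_ring "fock_space (m + 2)" by (rule module_fock_space)
  show "omega ` fock_span (m + 2) \<subseteq> carrier (fock_space m)"
  proof
    fix w assume "w \<in> omega ` fock_span (m + 2)"
    then obtain v where v: "v \<in> fock_span (m + 2)" "w = omega v" by blast
    then have "w = drop0 (omega v)" by (simp add: drop0_omega drop0_id)
    moreover have "omega v \<in> Fock m" using v by (intro omega_Fock) (simp add: fock_span_eq)
    ultimately show "w \<in> carrier (fock_space m)" by (simp add: fock_space_def drop0_fock_span)
  qed
  show "\<zero>\<^bsub>fock_space m\<^esub> \<in> omega ` fock_span (m + 2)"
    using F.M.zero_closed by (auto simp: fock_space_def intro!: image_eqI[of _ _ 0])
  show "a \<oplus>\<^bsub>fock_space m\<^esub> b \<in> omega ` fock_span (m + 2)"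
    if "a \<in> omega ` fock_span (m + 2)" "b \<in> omega ` fock_span (m + 2)" for a b
    using that F.M.a_closed by (auto simp: fock_space_def simp flip: omega_add)
  show "c \<odot>\<^bsub>fock_space m\<^esub> a \<in> omega ` fock_span (m + 2)" if "a \<in> omega ` fock_span (m + 2)" for c a
    using that F.smult_closed[of c] by (auto simp: fock_space_def simp flip: omega_scl)
qed

text \<open>A class at p = 0 is determined by its constant coordinate, a normalized representative
  modulo the fermionic relations; \<open>drop0\<close> turns these relations into the image of
  \<open>omega\<close>.\<close>

lemma cohomology_zero: "cohomology m 0 \<simeq>\<^sub>\<complex> W_space m"
  unfolding isomorphic_spaces_def cohomology_def W_space_def
proof (rule quot_module_iso[where \<phi> = "\<lambda>f. drop0 (coord m f {} 0)"])
  have Xf: "coord m f {} 0 \<in> Fock m" for f using coord_kappa[of m f "{}" 0] kappa_Fock by auto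
  show "module complex_ring (cocycle_space m 0)" by (rule module_cocycle_space)
  show "submodule (de_rham_d m ` carrier (cochains m (0 + 1))) complex_ring (cocycle_space m 0)"
    by (rule submodule_coboundaries)
  show "module complex_ring (fock_space m)" by (rule module_fock_space)
  show "submodule (omega ` carrier (fock_space (m + 2))) complex_ring (fock_space m)"
    using submodule_omega by (simp add: fock_space_def)
  show "drop0 (coord m f {} 0) \<in> carrier (fock_space m)" for f
    by (simp add: fock_space_def drop0_fock_span Xf)
  show "drop0 (coord m (f \<oplus>\<^bsub>cocycle_space m 0\<^esub> g) {} 0) = drop0 (coord m f {} 0) \<oplus>\<^bsub>fock_space m\<^esub> drop0 (coord m g {} 0)"
    if "f \<in> carrier (cocycle_space m 0)" "g \<in> carrier (cocycle_space m 0)" for f g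
    using that coord_add[of f m 0 g] by (simp add: cocycles_iff fock_space_def drop0_add)
  show "drop0 (coord m (a \<odot>\<^bsub>cocycle_space m 0\<^esub> f) {} 0) = a \<odot>\<^bsub>fock_space m\<^esub> drop0 (coord m f {} 0)"
    if "f \<in> carrier (cocycle_space m 0)" for a f
    using that coord_smult[of f m 0 a] by (simp add: cocycles_iff fock_space_def drop0_scl)
  show "drop0 (coord m f {} 0) \<in> omega ` carrier (fock_space (m + 2)) \<longleftrightarrow> f \<in> de_rham_d m ` carrier (cochains m (0 + 1))"
    if "f \<in> carrier (cocycle_space m 0)" for f
  proof -
    have "kappa m (coord m f {} 0) = coord m f {} 0" using coord_kappa[of m f "{}" 0] by (auto simp: kappa_idem)
    then have "coord m f {} 0 \<in> fock_relations m \<longleftrightarrow> coord m f {} 0 = 0" by (simp add: kappa_eq_0[symmetric])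
    then show ?thesis
      using that drop0_relations_iff[OF Xf[of f]] coboundaries_iff[of f m 0] by (simp add: fock_space_def)
  qed
  \<comment> \<open>The preimage of h is concentrated on the full wedge, with constant coefficient
    \<open>kappa m h\<close>. It hits h only modulo \<open>omega\<close>, since \<open>kappa\<close>
    moves h by a fermionic relation.\<close>
  show "\<exists>f\<in>carrier (cocycle_space m 0). h \<ominus>\<^bsub>fock_space m\<^esub> drop0 (coord m f {} 0) \<in> omega ` carrier (fock_space (m + 2))"
    if "h \<in> carrier (fock_space m)" for h
  proof -
    have h: "h \<in> fock_span m" "h \<in> Fock m" using that by (simp_all add: fock_space_def fock_span_eq)
    have "\<exists>P. \<forall>\<mu>. theta m P \<mu> = (if \<mu> = 0 then kappa m h else 0)"
    proof (rule theta_surj)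
      show "finite {\<mu>. (if \<mu> = (0 :: nat \<Rightarrow>\<^sub>0 nat) then kappa m h else 0) \<noteq> 0}"
        by (rule finite_subset[of _ "{0}"]) auto
    qed (use h(2) kappa_image_zero[of m] in \<open>auto split: if_splits\<close>)
    then obtain P where P: "\<And>\<mu>. theta m P \<mu> = (if \<mu> = 0 then kappa m h else 0)" by blast
    define f where "f I = (if I = {} then cl m P else \<zero>\<^bsub>A_space m\<^esub>)" for I :: "int set"
    have "finite {I. f I \<noteq> \<zero>\<^bsub>A_space m\<^esub>}" by (rule finite_subset[of _ "{{}}"]) (auto simp: f_def)
    then have fc: "f \<in> carrier (cochains m 0)"
      by (auto simp: cochains_carrier f_def cl_zero wedge_basis_def)
    have "KK (coord m f) N \<mu> = 0" for N \<mu>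
      unfolding KK_def by (intro sum.neutral) (simp add: coord_def f_def)
    then have "f \<in> cocycles m 0" using fc by (simp add: cocycles_iff)
    moreover have X0: "coord m f {} 0 = kappa m h" by (simp add: coord_def f_def th_cl P)
    moreover have "h \<ominus>\<^bsub>fock_space m\<^esub> drop0 (kappa m h) \<in> omega ` carrier (fock_space (m + 2))"
    proof -
      have "h \<ominus>\<^bsub>fock_space m\<^esub> drop0 (kappa m h) = h - drop0 (kappa m h)"
        unfolding fock_space_def
        by (rule free_space_minus[OF module_fock_space[unfolded fock_space_def] h(1)])
          (intro drop0_fock_span kappa_Fock h(2))
      also have "\<dots> = drop0 (h - kappa m h)"
        using drop0_add[of h "- kappa m h"] by (simp add: drop0_id[OF h(1)] drop0_minus)
      also have "\<dots> \<in> omega ` fock_span (m + 2)"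
        using kappa_diff[of h m] fock_relations_Fock[of m] drop0_relations_iff[of "h - kappa m h" m] by blast
      finally show ?thesis by (simp add: fock_space_def)
    qed
    ultimately show ?thesis by (intro bexI[of _ f]) simp_all
  qed
qed

theorem proposition4:
  fixes m :: int and p :: nat
  assumes "0 \<le> m"
  shows "(p = 0 \<longrightarrow> cohomology m p \<simeq>\<^sub>\<complex> W_space m)
    \<and> (1 \<le> p \<longrightarrow> carrier (cohomology m p) = {\<zero>\<^bsub>cohomology m p\<^esub>})"
  using cohomology_zero cohomology_positive by blast

end
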